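(* Let $g$ be the Littlewood--Paley $g$-function defined by $$g(f)(x)=\left(\int_0^\infty|t\partial_tW_tf(x)|^2\,\frac{dt}{t}\right)^{1/2}.$$ There is a constant $C>0$ depending only on the dimension $n$ such that for any $f\in\mathrm{BMO}(\mathbb{R}^n)$ with $g(f)(x)<\infty$ for a.e. $x\in\mathbb{R}^n$, one has $g(f)\in\mathrm{BLO}(\mathbb{R}^n)$ and $$\|g(f)\|_{\mathrm{BLO}(\mathbb{R}^n)}\le C\,\|f\|_{\mathrm{BMO}(\mathbb{R}^n)}.$$
   Context: $\mathrm{BLO}(\mathbb{R}^n)$ is the set of real-valued locally integrable functions $f$ on $\mathbb{R}^n$ with $\|f\|_{\mathrm{BLO}(\mathbb{R}^n)}:=\sup_B\frac1{|B|}\int_B\big[f(x)-\operatorname{ess\,inf}_B f\big]\,dx<\infty$, and $\mathrm{BMO}(\mathbb{R}^n)$ is the set of locally integrable $f$ with $\|f\|_{\mathrm{BMO}(\mathbb{R}^n)}:=\sup_B\frac1{|B|}\int_B|f-f_B|\,dx<\infty$, $f_B=\frac1{|B|}\int_Bf$, the suprema being over all balls $B\subset\mathbb{R}^n$. The heat semigroup is $W_tf(x)=\int_{\mathbb{R}^n}(4\pi t)^{-n/2}\exp(-|x-y|^2/(4t))f(y)\,dy$, $t>0$. *)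

theory Defs
  imports "HOL-Analysis.Analysis"
begin

definition locally_integrable ::
  "('a::euclidean_space \<Rightarrow> 'b::{banach, second_countable_topology}) \<Rightarrow> bool" where
  "locally_integrable f \<longleftrightarrow> (\<forall>K. compact K \<longrightarrow> f absolutely_integrable_on K)"

definition balls :: "'a::euclidean_space set set" where
  "balls = {ball x r | x r. r > 0}"

definition average ::
  "'a::euclidean_space set \<Rightarrow> ('a \<Rightarrow> 'b::{banach, second_countable_topology}) \<Rightarrow> 'b" where
  "average B f = (LINT y:B|lebesgue. f y) /\<^sub>R measure lebesgue B"

definition ess_inf :: "'a::euclidean_space set \<Rightarrow> ('a \<Rightarrow> real) \<Rightarrow> ereal" where
  "ess_inf B f = Sup {c. AE x in lebesgue. x \<in> B \<longrightarrow> c \<le> ereal (f x)}"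

(* Both seminorms take values in [0, \<infinity>], so they are meaningful without assuming finiteness.
   If ess_inf B f is -\<infinity>, the integrand in blo_norm is \<infinity> on B; otherwise it is
   nonnegative a.e. on B, so the truncation by e2ennreal loses nothing. *)

definition bmo_norm ::
  "('a::euclidean_space \<Rightarrow> 'b::{banach, second_countable_topology}) \<Rightarrow> ennreal" where
  "bmo_norm f = (SUP B\<in>balls.
     (\<integral>\<^sup>+x\<in>B. ennreal (norm (f x - average B f)) \<partial>lebesgue) / emeasure lebesgue B)"

definition BMO :: "('a::euclidean_space \<Rightarrow> 'b::{banach, second_countable_topology}) set" where
  "BMO = {f. locally_integrable f \<and> bmo_norm f < \<infinity>}"

definition blo_norm :: "('a::euclidean_space \<Rightarrow> real) \<Rightarrow> ennreal" where
  "blo_norm f = (SUP B\<in>balls.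
     (\<integral>\<^sup>+x\<in>B. e2ennreal (ereal (f x) - ess_inf B f) \<partial>lebesgue) / emeasure lebesgue B)"

definition BLO :: "('a::euclidean_space \<Rightarrow> real) set" where
  "BLO = {f. locally_integrable f \<and> blo_norm f < \<infinity>}"

definition heat_kernel :: "real \<Rightarrow> 'a::euclidean_space \<Rightarrow> real" where
  "heat_kernel t z =
     (4 * pi * t) powr (- (real DIM('a) / 2)) * exp (- (norm z)\<^sup>2 / (4 * t))"

definition heat_semigroup ::
  "real \<Rightarrow> ('a::euclidean_space \<Rightarrow> 'b::{banach, second_countable_topology}) \<Rightarrow> 'a \<Rightarrow> 'b" where
  "heat_semigroup t f x = (LINT y|lebesgue. heat_kernel t (x - y) *\<^sub>R f y)"

definition ennreal_sqrt :: "ennreal \<Rightarrow> ennreal" where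
  "ennreal_sqrt a = (if a = \<infinity> then \<infinity> else ennreal (sqrt (enn2real a)))"

(* The value \<infinity> is allowed, so that finiteness of the g-function is a genuine hypothesis.
   For f in BMO the integral defining the heat semigroup converges absolutely and is
   differentiable in t > 0, so no default values of the Bochner integral or of
   vector_derivative enter. *)

definition g_function ::
  "('a::euclidean_space \<Rightarrow> 'b::{banach, second_countable_topology}) \<Rightarrow> 'a \<Rightarrow> ennreal" where
  "g_function f x = ennreal_sqrt
     (\<integral>\<^sup>+t\<in>{0<..}.
        ennreal ((norm (t *\<^sub>R vector_derivative (\<lambda>s. heat_semigroup s f x) (at t)))\<^sup>2 / t)
      \<partial>lebesgue)"

end

theory Submission
  imports Defs "HOL-Probability.Distributions"
begin

text \<open>
  Fix a ball \<open>B\<close> of radius \<open>r\<close> and split the \<open>t\<close>-integral in \<open>g(f)\<^sup>2\<close> at \<open>r\<^sup>2\<close>. For \<open>t > r\<^sup>2\<close> the smoothness of the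
  heat kernel gives \<open>|\<partial>\<^sub>t W\<^sub>t f(y) - \<partial>\<^sub>t W\<^sub>t f(y')| \<le> C r t\<^sup>-\<^sup>3\<^sup>/\<^sup>2 N\<close> on \<open>B\<close>, with \<open>N\<close> the BMO norm, so by Minkowski the far
  part of \<open>g(f)\<close> oscillates by at most \<open>C N\<close> on \<open>B\<close>; since the local part is nonnegative,
  \<open>g(f)(y) \<le> g\<^sub>l\<^sub>o\<^sub>c(f)(y) + C N + g(f)(y')\<close> on \<open>B\<close>, and it remains to bound the mean of \<open>g\<^sub>l\<^sub>o\<^sub>c(f)\<^sup>2\<close> over \<open>B\<close> by \<open>C N\<^sup>2\<close>.

  For this, \<open>f\<close> is replaced by \<open>W\<^sub>e f\<close> with \<open>e \<rightarrow> 0\<close>. This is an average of translates of \<open>f\<close>, so it has the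
  same bound on its mean oscillation, but it is continuous, and for continuous functions a Calderon--Zygmund
  stopping argument that terminates after finitely many bisections bounds the \<open>L\<^sup>2\<close> oscillation by \<open>N\<close>.
  The part of \<open>f\<close> near \<open>B\<close> is then handled by the \<open>L\<^sup>2\<close> bound for the square function, which follows
  from \<open>q\<^sub>t * q\<^sub>t = \<partial>\<^sub>s\<^sup>2 p\<^sub>s\<close> at \<open>s = 2 t\<close> (\<open>p\<close> the heat kernel, \<open>q = \<partial>\<^sub>t p\<close>) and the fact that \<open>t \<partial>\<^sub>s\<^sup>2 p\<^sub>s\<close> at \<open>s = 2 t\<close> has the
  primitive \<open>t q\<^sub>2\<^sub>t / 2 - p\<^sub>2\<^sub>t / 4\<close>, whose \<open>L\<^sup>1\<close> norm is bounded uniformly in \<open>t\<close>. The part away from \<open>B\<close> is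
  controlled by the Gaussian decay of the kernel.
\<close>

section \<open>The heat kernel and its time derivatives\<close>

text \<open>Smoothing is what keeps the stopping argument finite: for a merely locally integrable
  function the stopped cubes form an infinite family and the remaining set calls for Lebesgue
  differentiation, whereas uniform continuity makes every sufficiently small cube harmless. The
  scale at which this happens, and the bound on the function, degenerate as e tends to 0 and must
  not enter the estimate; this is achieved by a self-improvement of the bound on mean squares from
  \<open>A\<close> to \<open>A / 2\<close> plus a multiple of \<open>N^2\<close>. Smoothing must
  also preserve the hypothesis, which is why mean oscillation is measured by the double integral of
  \<open>norm (f y - f z)\<close>: it involves no average and passes to averages of translates.
  Smoothing is undone by the semigroup law: for t \<ge> 2 e the time derivative at t is the time
  derivative at t - e of the semigroup applied to the smoothed function, and the weights t and t - e
  are comparable. Finiteness of g(f) enters at the end: every ball contains points where it is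
  finite, and between such points the comparison can be carried out in the reals.\<close>

definition heat_kernel_dt :: "real \<Rightarrow> 'a::euclidean_space \<Rightarrow> real" where
  "heat_kernel_dt t z = heat_kernel t z * ((norm z)\<^sup>2 / (4 * t\<^sup>2) - real DIM('a) / (2 * t))"

definition heat_kernel_dtt :: "real \<Rightarrow> 'a::euclidean_space \<Rightarrow> real" where
  "heat_kernel_dtt t z = heat_kernel t z *
     (((norm z)\<^sup>2 / (4 * t\<^sup>2) - real DIM('a) / (2 * t))\<^sup>2 - (norm z)\<^sup>2 / (2 * t ^ 3) + real DIM('a) / (2 * t\<^sup>2))"

lemma heat_kernel_nonneg [simp]: "heat_kernel t z \<ge> 0"
  by (simp add: heat_kernel_def)

lemma heat_kernel_minus [simp]: "heat_kernel t (- z) = heat_kernel t z"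
  "heat_kernel_dt t (- z) = heat_kernel_dt t z" "heat_kernel_dtt t (- z) = heat_kernel_dtt t z"
  by (simp_all add: heat_kernel_def heat_kernel_dt_def heat_kernel_dtt_def)

lemma heat_kernel_commute: "heat_kernel t (x - y) = heat_kernel t (y - x)"
  "heat_kernel_dt t (x - y) = heat_kernel_dt t (y - x)"
  "heat_kernel_dtt t (x - y) = heat_kernel_dtt t (y - x)"
  using heat_kernel_minus[of t "x - y"] by simp_all

lemma has_field_derivative_heat_kernel:
  fixes z :: "'a::euclidean_space"
  assumes "t > 0"
  shows "((\<lambda>s. heat_kernel s z) has_field_derivative heat_kernel_dt t z) (at t)"
proof -
  have "(4 * pi * t) powr (- (real DIM('a) / 2)) = (4 * pi * t) * (4 * pi * t) powr (- (real DIM('a) / 2) - 1)"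
    using assms by (subst powr_mult_base) auto
  then show ?thesis
    unfolding heat_kernel_def heat_kernel_dt_def
    using assms
    by (auto intro!: derivative_eq_intros simp: field_simps power2_eq_square)
qed

lemma has_field_derivative_heat_kernel_dt:
  fixes z :: "'a::euclidean_space"
  assumes "t > 0"
  shows "((\<lambda>s. heat_kernel_dt s z) has_field_derivative heat_kernel_dtt t z) (at t)"
proof -
  have "((\<lambda>s. heat_kernel s z * ((norm z)\<^sup>2 / (4 * s\<^sup>2) - real DIM('a) / (2 * s))) has_field_derivative
    heat_kernel_dt t z * ((norm z)\<^sup>2 / (4 * t\<^sup>2) - real DIM('a) / (2 * t)) +
     heat_kernel t z * (- ((norm z)\<^sup>2 / (2 * t^3)) + real DIM('a) / (2 * t\<^sup>2))) (at t)"
    using assms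
    by (auto intro!: derivative_eq_intros has_field_derivative_heat_kernel
        simp: field_simps power2_eq_square power3_eq_cube)
  then show ?thesis
    unfolding heat_kernel_dt_def heat_kernel_dtt_def by (simp add: algebra_simps power2_eq_square)
qed

lemma borel_measurable_heat_kernel [measurable (raw)]:
  assumes [measurable]: "g \<in> borel_measurable M" "h \<in> borel_measurable M"
  shows "(\<lambda>w. heat_kernel (g w) (h w :: 'a::euclidean_space)) \<in> borel_measurable M"
    "(\<lambda>w. heat_kernel_dt (g w) (h w)) \<in> borel_measurable M"
    "(\<lambda>w. heat_kernel_dtt (g w) (h w)) \<in> borel_measurable M"
  unfolding heat_kernel_def heat_kernel_dt_def heat_kernel_dtt_def by measurable

text \<open>The exponential of a sum of squares factors over the coordinates, each with variance
  \<open>2 * t\<close>; total mass 1 then reduces to the one-dimensional normal density.\<close>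

lemma heat_kernel_eq_prod:
  fixes z :: "'a::euclidean_space"
  assumes "t > 0"
  shows "heat_kernel t z = (\<Prod>b\<in>Basis. normal_density 0 (sqrt (2 * t)) (z \<bullet> b))"
proof -
  have "(norm z)\<^sup>2 = (\<Sum>b\<in>Basis. (z \<bullet> b)\<^sup>2)"
    unfolding power2_norm_eq_inner by (subst euclidean_inner) (simp add: power2_eq_square)
  then have "exp (- (norm z)\<^sup>2 / (4 * t)) = (\<Prod>b\<in>(Basis::'a set). exp (- (z \<bullet> b)\<^sup>2 / (4 * t)))"
    by (simp add: exp_sum[symmetric] sum_negf sum_divide_distrib)
  moreover have "(4 * pi * t) powr (- (real DIM('a) / 2)) = (1 / sqrt (4 * pi * t)) ^ DIM('a)"
    using assms by (simp add: powr_minus powr_half_sqrt[symmetric] powr_powr powr_realpow[symmetric]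
        power_one_over field_simps)
  ultimately show ?thesis
    using assms by (simp add: heat_kernel_def normal_density_def prod.distrib power_one_over
       prod_dividef ac_simps)
qed

lemma nn_integral_heat_kernel_0:
  assumes "t > 0"
  shows "(\<integral>\<^sup>+z. heat_kernel t (z::'a::euclidean_space) \<partial>lborel) = 1"
proof -
  interpret prob_space "density lborel (\<lambda>x. ennreal (normal_density 0 (sqrt (2 * t)) x))"
    using assms by (intro prob_space_normal_density) auto
  have "(\<integral>\<^sup>+x. ennreal (normal_density 0 (sqrt (2 * t)) x) \<partial>lborel) = 1"
    using emeasure_space_1 by (simp add: emeasure_density)
  then show ?thesis
    using assms by (simp add: heat_kernel_eq_prod prod_ennreal[symmetric]
        nn_integral_lborel_prod[where f="\<lambda>b x. ennreal (normal_density 0 (sqrt (2 * t)) x)"])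
qed

lemma nn_integral_translate:
  fixes x :: "'a::euclidean_space"
  assumes [measurable]: "f \<in> borel_measurable borel"
  shows "(\<integral>\<^sup>+y. f (x + y) \<partial>lborel) = (\<integral>\<^sup>+y. f y \<partial>lborel)"
  by (subst (2) lborel_distr_plus[of x, symmetric]) (simp add: nn_integral_distr)

lemma nn_integral_reflect:
  fixes x :: "'a::euclidean_space"
  assumes [measurable]: "f \<in> borel_measurable borel"
  shows "(\<integral>\<^sup>+y. f (x - y) \<partial>lborel) = (\<integral>\<^sup>+y. f y \<partial>lborel)"
  by (subst (2) lborel_affine[of "-1" x]) (simp_all add: nn_integral_density nn_integral_distr)

lemma nn_integral_heat_kernel [simp]:
  assumes "t > 0"
  shows "(\<integral>\<^sup>+y. heat_kernel t (x - y::'a::euclidean_space) \<partial>lborel) = 1"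
    "(\<integral>\<^sup>+y. heat_kernel t (y - x::'a::euclidean_space) \<partial>lborel) = 1"
proof -
  show "(\<integral>\<^sup>+y. heat_kernel t (x - y::'a::euclidean_space) \<partial>lborel) = 1"
    using nn_integral_reflect[of "\<lambda>z. ennreal (heat_kernel t z)" x] nn_integral_heat_kernel_0[OF assms, where 'a='a] by simp
  then show "(\<integral>\<^sup>+y. heat_kernel t (y - x::'a::euclidean_space) \<partial>lborel) = 1"
    by (simp add: heat_kernel_commute(1)[of t x])
qed

lemma integrable_heat_kernel:
  assumes "t > 0"
  shows "integrable lborel (\<lambda>y. heat_kernel t (x - y::'a::euclidean_space))"
    "(LINT y|lborel. heat_kernel t (x - y::'a::euclidean_space)) = 1"
proof -
  show 1: "integrable lborel (\<lambda>y. heat_kernel t (x - y::'a::euclidean_space))"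
    using assms by (intro integrableI_bounded) auto
  show "(LINT y|lborel. heat_kernel t (x - y::'a::euclidean_space)) = 1"
    using nn_integral_eq_integral[OF 1] assms by simp
qed

text \<open>Completing the square in \<open>y\<close>: the product of two Gaussians is a Gaussian in
  \<open>y\<close> around a weighted mean of \<open>x\<close> and \<open>z\<close>, times a factor
  free of \<open>y\<close>. Integrating over \<open>y\<close> then yields the semigroup law without
  further computation.\<close>

lemma heat_kernel_mult:
  fixes x y z :: "'a::euclidean_space"
  assumes "t > 0" "s > 0"
  shows "heat_kernel t (x - y) * heat_kernel s (y - z) =
    heat_kernel (t + s) (x - z) * heat_kernel (t * s / (t + s)) ((1 / (t + s)) *\<^sub>R (s *\<^sub>R x + t *\<^sub>R z) - y)"
proof -
  define u v where "u = x - y" and "v = y - z"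
  have 1: "(1 / (t + s)) *\<^sub>R (s *\<^sub>R x + t *\<^sub>R z) - y = (1 / (t + s)) *\<^sub>R (s *\<^sub>R u - t *\<^sub>R v)"
  proof -
    have "(1 / (t + s)) *\<^sub>R (s *\<^sub>R u - t *\<^sub>R v) = (1 / (t + s)) *\<^sub>R (s *\<^sub>R x + t *\<^sub>R z - (t + s) *\<^sub>R y)"
      unfolding u_def v_def by (simp add: algebra_simps)
    also have "\<dots> = (1 / (t + s)) *\<^sub>R (s *\<^sub>R x + t *\<^sub>R z) - y"
      using assms by (simp add: scaleR_diff_right)
    finally show ?thesis by simp
  qed
  have 2: "x - z = u + v" by (simp add: u_def v_def)
  have 3: "(norm ((1 / (t + s)) *\<^sub>R (s *\<^sub>R u - t *\<^sub>R v)))\<^sup>2 = (norm (s *\<^sub>R u - t *\<^sub>R v))\<^sup>2 / (t + s)\<^sup>2"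
    using assms by (simp add: power_divide)
  have "(norm u)\<^sup>2 / t + (norm v)\<^sup>2 / s = (norm (u + v))\<^sup>2 / (t + s) + (norm (s *\<^sub>R u - t *\<^sub>R v))\<^sup>2 / (t + s)\<^sup>2 * ((t + s) / (t * s))"
    (is "?L = ?R")
  proof -
    have "?L - ?R = 0"
      using assms by (simp add: power2_norm_eq_inner inner_simps inner_commute[of v u] divide_simps) algebra
    then show ?thesis by simp
  qed
  then have e: "(norm u)\<^sup>2 / (4 * t) + (norm v)\<^sup>2 / (4 * s) = (norm (u + v))\<^sup>2 / (4 * (t + s)) + (norm (s *\<^sub>R u - t *\<^sub>R v))\<^sup>2 / (t + s)\<^sup>2 / (4 * (t * s / (t + s)))"
  proof -
    assume L: "?L = ?R"
    have m: "(a / (t + s) + b * ((t + s) / (t * s))) / 4 = a / (4 * (t + s)) + b / (4 * (t * s / (t + s)))" for a b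
      using assms by (simp add: divide_simps) algebra
    have l: "(norm u)\<^sup>2 / (4 * t) + (norm v)\<^sup>2 / (4 * s) = ?L / 4"
      by (simp add: add_divide_distrib)
    show ?thesis unfolding l L by (rule m)
  qed
  have "(4 * pi * t) * (4 * pi * s) = (4 * pi * (t + s)) * (4 * pi * (t * s / (t + s)))"
    using assms by (simp add: field_simps)
  then have p: "(4 * pi * t) powr a * (4 * pi * s) powr a = (4 * pi * (t + s)) powr a * (4 * pi * (t * s / (t + s))) powr a" for a
    using assms by (simp add: powr_mult[symmetric] ac_simps)
  have e': "exp (- (norm u)\<^sup>2 / (4 * t)) * exp (- (norm v)\<^sup>2 / (4 * s)) = exp (- (norm (u + v))\<^sup>2 / (4 * (t + s))) * exp (- ((norm (s *\<^sub>R u - t *\<^sub>R v))\<^sup>2 / (t + s)\<^sup>2) / (4 * (t * s / (t + s))))"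
    using e by (simp add: exp_add[symmetric] del: times_divide_eq_right)
  have "heat_kernel t u * heat_kernel s v = ((4 * pi * t) powr (- (real DIM('a) / 2)) * (4 * pi * s) powr (- (real DIM('a) / 2)))
     * (exp (- (norm u)\<^sup>2 / (4 * t)) * exp (- (norm v)\<^sup>2 / (4 * s)))"
    unfolding heat_kernel_def by (simp only: ac_simps)
  also have "\<dots> = heat_kernel (t + s) (u + v) * heat_kernel (t * s / (t + s)) ((1 / (t + s)) *\<^sub>R (s *\<^sub>R u - t *\<^sub>R v))"
    unfolding p e' heat_kernel_def 3 by (simp only: ac_simps)
  finally show ?thesis unfolding 1 2 by (simp add: u_def v_def)
qed

lemma nn_integral_heat_kernel_mult:
  fixes x z :: "'a::euclidean_space"
  assumes "t > 0" "s > 0"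
  shows "(\<integral>\<^sup>+y. ennreal (heat_kernel t (x - y)) * ennreal (heat_kernel s (y - z)) \<partial>lborel) = heat_kernel (t + s) (x - z)"
proof -
  have "(\<integral>\<^sup>+y. ennreal (heat_kernel t (x - y)) * ennreal (heat_kernel s (y - z)) \<partial>lborel) =
    (\<integral>\<^sup>+y. ennreal (heat_kernel (t + s) (x - z)) * ennreal (heat_kernel (t * s / (t + s)) ((1 / (t + s)) *\<^sub>R (s *\<^sub>R x + t *\<^sub>R z) - y)) \<partial>lborel)"
    using assms by (simp add: ennreal_mult'[symmetric] heat_kernel_mult)
  also have "\<dots> = heat_kernel (t + s) (x - z)"
    using assms by (subst nn_integral_cmult) auto
  finally show ?thesis .
qed

text \<open>For \<open>c > 1\<close> the leftover exponential is decay gained by passing to the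
  larger time \<open>c * t\<close>. It absorbs polynomial factors when \<open>c = 2\<close> and
  produces smallness off the diagonal when \<open>c\<close> is large.\<close>

lemma heat_kernel_rescale:
  fixes z :: "'a::euclidean_space"
  assumes "t > 0" "c > 0"
  shows "heat_kernel t z = c powr (real DIM('a) / 2) * heat_kernel (c * t) z * exp (- ((norm z)\<^sup>2 / (4 * t) * (1 - 1 / c)))"
proof -
  have "exp (- (norm z)\<^sup>2 / (4 * t)) = exp (- (norm z)\<^sup>2 / (4 * (c * t))) * exp (- ((norm z)\<^sup>2 / (4 * t) * (1 - 1 / c)))"
    using assms by (simp add: exp_add[symmetric] field_simps)
  moreover have "(4 * pi * t) powr a = c powr (-a) * (4 * pi * (c * t)) powr a" for a
    using assms by (simp add: powr_mult powr_minus)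
  ultimately show ?thesis by (simp add: heat_kernel_def)
qed

lemma heat_kernel_le:
  fixes z :: "'a::euclidean_space"
  assumes "t > 0" "c \<ge> 1"
  shows "heat_kernel t z \<le> c powr (real DIM('a) / 2) * heat_kernel (c * t) z"
proof -
  have "exp (- ((norm z)\<^sup>2 / (4 * t) * (1 - 1 / c))) \<le> 1"
    using assms by simp
  then show ?thesis
    using assms by (subst heat_kernel_rescale[of t c]) (auto intro!: mult_left_le)
qed

lemma heat_kernel_mono_time:
  fixes z :: "'a::euclidean_space"
  assumes "0 < s" "s \<le> t"
  shows "heat_kernel s z \<le> (t / s) powr (real DIM('a) / 2) * heat_kernel t z"
  using heat_kernel_le[of s "t / s" z] assms by (simp add: field_simps)

section \<open>Pointwise bounds for the kernel and its time derivatives\<close>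

lemma power_le_fact_mult_exp:
  fixes x :: real
  assumes "x \<ge> 0"
  shows "x ^ m \<le> fact m * exp x"
proof -
  have "(\<Sum>k\<in>{m}. x ^ k /\<^sub>R fact k) \<le> (\<Sum>k. x ^ k /\<^sub>R fact k)"
    using assms by (intro sum_le_suminf summable_exp_generic) auto
  then show ?thesis
    by (simp add: exp_def field_simps)
qed

lemma power_mult_exp_minus_le:
  fixes x :: real
  assumes "x \<ge> 0"
  shows "x ^ m * exp (- x) \<le> fact m"
  using power_le_fact_mult_exp[OF assms, of m] by (simp add: exp_minus field_simps)

text \<open>In the variable \<open>a = |z|^2 / (4 t)\<close>, with \<open>n\<close> half the
  dimension, the derivative is the kernel times \<open>(a - n) / t\<close>. Doubling the time frees
  a factor \<open>exp (- (a / 2))\<close>, which absorbs the polynomial in \<open>a\<close>.\<close>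

lemma abs_heat_kernel_dt_le:
  fixes z :: "'a::euclidean_space"
  assumes "t > 0"
  shows "\<bar>heat_kernel_dt t z\<bar> \<le> (2 + real DIM('a) / 2) * 2 powr (real DIM('a) / 2) / t * heat_kernel (2 * t) z"
proof -
  define a n where "a = (norm z)\<^sup>2 / (4 * t)" and "n = real DIM('a) / 2"
  have a: "a \<ge> 0" "n \<ge> 0" using assms by (auto simp: a_def n_def)
  have "\<bar>a - n\<bar> * exp (- (a / 2)) \<le> (a + n) * exp (- (a / 2))"
    using a by (intro mult_right_mono) auto
  also have "\<dots> = 2 * ((a / 2) ^ 1 * exp (- (a / 2))) + n * exp (- (a / 2))"
    by (simp add: algebra_simps)
  also have "\<dots> \<le> 2 * fact 1 + n * 1"
    using a by (intro add_mono mult_left_mono power_mult_exp_minus_le) auto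
  finally have 1: "\<bar>a - n\<bar> * exp (- (a / 2)) \<le> 2 + n" by simp
  have "heat_kernel_dt t z = heat_kernel t z * ((a - n) / t)"
    using assms by (simp add: heat_kernel_dt_def a_def n_def field_simps power2_eq_square)
  then have "\<bar>heat_kernel_dt t z\<bar> = heat_kernel t z * \<bar>a - n\<bar> / t"
    using assms by (simp add: abs_mult)
  also have "\<dots> = 2 powr n * heat_kernel (2 * t) z / t * (\<bar>a - n\<bar> * exp (- (a / 2)))"
    using assms by (subst heat_kernel_rescale[of t 2]) (simp_all add: a_def n_def field_simps)
  also have "\<dots> \<le> 2 powr n * heat_kernel (2 * t) z / t * (2 + n)"
    using assms 1 by (intro mult_left_mono) auto
  finally show ?thesis by (simp add: n_def field_simps)
qed

lemma abs_heat_kernel_dtt_le: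
  fixes z :: "'a::euclidean_space"
  assumes "t > 0"
  shows "\<bar>heat_kernel_dtt t z\<bar> \<le>
    (12 + (real DIM('a) / 2)\<^sup>2 + real DIM('a) / 2) * 2 powr (real DIM('a) / 2) / t\<^sup>2 * heat_kernel (2 * t) z"
proof -
  define a n where "a = (norm z)\<^sup>2 / (4 * t)" and "n = real DIM('a) / 2"
  have a: "a \<ge> 0" "n \<ge> 0" using assms by (auto simp: a_def n_def)
  have "\<bar>(a - n)\<^sup>2 - 2 * a + n\<bar> \<le> a\<^sup>2 + 2 * a + n\<^sup>2 + n"
    using a mult_nonneg_nonneg[OF a] power2_diff[of a n] zero_le_power2[of "a - n"] zero_le_power2[of a]
      zero_le_power2[of n] unfolding abs_le_iff by (intro conjI) linarith+
  then have "\<bar>(a - n)\<^sup>2 - 2 * a + n\<bar> * exp (- (a / 2)) \<le> (a\<^sup>2 + 2 * a + n\<^sup>2 + n) * exp (- (a / 2))"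
    by (intro mult_right_mono) auto
  also have "\<dots> = 4 * ((a / 2) ^ 2 * exp (- (a / 2))) + 4 * ((a / 2) ^ 1 * exp (- (a / 2))) + (n\<^sup>2 + n) * exp (- (a / 2))"
    by (simp add: algebra_simps power2_eq_square)
  also have "\<dots> \<le> 4 * fact 2 + 4 * fact 1 + (n\<^sup>2 + n) * 1"
    using a by (intro add_mono mult_left_mono power_mult_exp_minus_le) auto
  finally have 1: "\<bar>(a - n)\<^sup>2 - 2 * a + n\<bar> * exp (- (a / 2)) \<le> 12 + n\<^sup>2 + n" by simp
  have "heat_kernel_dtt t z = heat_kernel t z * (((a - n)\<^sup>2 - 2 * a + n) / t\<^sup>2)"
    using assms by (simp add: heat_kernel_dtt_def a_def n_def divide_simps power2_eq_square power3_eq_cube)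
  then have "\<bar>heat_kernel_dtt t z\<bar> = heat_kernel t z * \<bar>(a - n)\<^sup>2 - 2 * a + n\<bar> / t\<^sup>2"
    using assms by (simp add: abs_mult)
  also have "\<dots> = 2 powr n * heat_kernel (2 * t) z / t\<^sup>2 * (\<bar>(a - n)\<^sup>2 - 2 * a + n\<bar> * exp (- (a / 2)))"
    using assms by (subst heat_kernel_rescale[of t 2]) (simp_all add: a_def n_def field_simps)
  also have "\<dots> \<le> 2 powr n * heat_kernel (2 * t) z / t\<^sup>2 * (12 + n\<^sup>2 + n)"
    using assms 1 by (intro mult_left_mono) auto
  finally show ?thesis by (simp add: n_def field_simps)
qed

text \<open>Passing from time \<open>2 * t\<close> to the fixed time \<open>4 * r^2\<close> leaves
  \<open>exp (- (u / 16))\<close> with \<open>u = r^2 / t\<close>, which beats every power of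
  \<open>u\<close>. The gain \<open>sqrt t / r\<close> is spent later: with the factor
  \<open>1 / t\<close> of the derivative bound it makes the exterior of a ball contribute a function
  of \<open>t\<close> that is square integrable against \<open>t dt\<close> down to 0.\<close>

lemma heat_kernel_off_diagonal:
  fixes z :: "'a::euclidean_space"
  assumes "0 < t" "t \<le> r\<^sup>2" "0 < r" "r \<le> norm z"
  shows "heat_kernel (2 * t) z \<le> 32 ^ (DIM('a) + 1) * fact (DIM('a) + 1) * (sqrt t / r) * heat_kernel (4 * r\<^sup>2) z"
proof -
  define u where "u = r\<^sup>2 / t"
  have u: "u \<ge> 1" "u > 0" using assms by (auto simp: u_def)
  have su: "sqrt u = r / sqrt t" using assms by (simp add: u_def real_sqrt_divide)
  have "u / 16 = r\<^sup>2 / (8 * t) * (1 / 2)" by (simp add: u_def)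
  also have "\<dots> \<le> (norm z)\<^sup>2 / (8 * t) * (1 - 1 / (2 * u))"
    using assms u by (intro mult_mono divide_right_mono power_mono) (auto simp: field_simps)
  finally have e: "u / 16 \<le> (norm z)\<^sup>2 / (4 * (2 * t)) * (1 - 1 / (2 * u))" by simp
  have "heat_kernel (2 * t) z = (2 * u) powr (real DIM('a) / 2) * heat_kernel (4 * r\<^sup>2) z * exp (- ((norm z)\<^sup>2 / (4 * (2 * t)) * (1 - 1 / (2 * u))))"
    using assms u by (subst heat_kernel_rescale[of "2 * t" "2 * u"]) (simp_all add: u_def)
  also have "\<dots> \<le> (2 * u) powr (real DIM('a)) * heat_kernel (4 * r\<^sup>2) z * exp (- (u / 16))"
    using u e by (intro mult_mono powr_mono) auto
  also have "(2 * u) powr (real DIM('a)) = (2 * u) ^ DIM('a)"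
    using u by (simp add: powr_realpow)
  \<comment> \<open>The inserted factor is at least 1: its \<open>2 * u\<close> completes the power
    to \<open>DIM('a) + 1\<close>, and its \<open>1 / sqrt u\<close> is the desired
    \<open>sqrt t / r\<close>.\<close>
  also have "\<dots> * heat_kernel (4 * r\<^sup>2) z * exp (- (u / 16)) \<le> (2 * u) ^ DIM('a) * heat_kernel (4 * r\<^sup>2) z * exp (- (u / 16)) * (2 * u / sqrt u)"
  proof -
    have "sqrt u \<le> 2 * u" using u by (intro real_le_lsqrt) (auto simp: power2_eq_square)
    then have "1 \<le> 2 * u / sqrt u" using u by simp
    then have "X * 1 \<le> X * (2 * u / sqrt u)" if "X \<ge> 0" for X
      using that by (rule mult_left_mono)
    then show ?thesis
      using u by simp
  qed
  also have "\<dots> = (2 * u) ^ (DIM('a) + 1) * exp (- (u / 16)) * (sqrt t / r) * heat_kernel (4 * r\<^sup>2) z"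
    by (simp add: su)
  also have "(2 * u) ^ (DIM('a) + 1) = 32 ^ (DIM('a) + 1) * (u / 16) ^ (DIM('a) + 1)"
    by (subst power_mult_distrib[symmetric]) simp
  also have "32 ^ (DIM('a) + 1) * (u / 16) ^ (DIM('a) + 1) * exp (- (u / 16)) * (sqrt t / r) * heat_kernel (4 * r\<^sup>2) z
     \<le> 32 ^ (DIM('a) + 1) * fact (DIM('a) + 1) * (sqrt t / r) * heat_kernel (4 * r\<^sup>2) z"
    using assms power_mult_exp_minus_le[of "u / 16" "DIM('a) + 1"] u
    by (intro mult_right_mono) (auto simp del: power_Suc fact_Suc simp: mult.assoc)
  finally show ?thesis .
qed

text \<open>Origin of the factors: the power of 4 turns the normalisation at time \<open>t\<close>
  into that at time \<open>4 * t\<close>, \<open>exp (1 / 2)\<close> pays for moving the radius by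
  \<open>2 * sqrt t\<close>, and the last factor bounds the cubic polynomial of the radial
  derivative against a Gaussian.\<close>

definition heat_kernel_smooth_const :: "'a::euclidean_space itself \<Rightarrow> real" where
  "heat_kernel_smooth_const _ = 4 powr (real DIM('a) / 2) * exp (1 / 2) * ((1 / 2 + real DIM('a) / 4) * 9 + 129 / 8)"

text \<open>The kernel is radial, so the mean value theorem is applied on a half-line of radii.
  Every radius in it is at least \<open>norm z - 2 * sqrt t\<close>, and at the larger time
  \<open>4 * t\<close> the kernel at the single point \<open>z\<close> dominates the radial
  derivative at all of them.\<close>

lemma abs_heat_kernel_dt_diff_le:
  fixes z z' :: "'a::euclidean_space"
  assumes t: "t > 0" and zz: "norm (z - z') \<le> 2 * sqrt t"
  shows "\<bar>heat_kernel_dt t z - heat_kernel_dt t z'\<bar> \<le>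
    heat_kernel_smooth_const TYPE('a) * norm (z - z') / (t * sqrt t) * heat_kernel (4 * t) z"
proof -
  define n where "n = real DIM('a)"
  define k where "k = (4 * pi * t) powr (- (n / 2))"
  define \<psi> where "\<psi> s = k * exp (- s\<^sup>2 / (4 * t)) * (s\<^sup>2 / (4 * t\<^sup>2) - n / (2 * t))" for s
  define \<psi>' where "\<psi>' s = k * exp (- s\<^sup>2 / (4 * t)) * (s / (2 * t\<^sup>2) - (s / (2 * t)) * (s\<^sup>2 / (4 * t\<^sup>2) - n / (2 * t)))" for s
  define S where "S = {max 0 (norm z - 2 * sqrt t)..}"
  define M where "M = (1 / 2 + n / 4) * 9 + 129 / 8"
  define B where "B = heat_kernel_smooth_const TYPE('a) / (t * sqrt t) * heat_kernel (4 * t) z"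
  have n: "n \<ge> 0" and k: "k \<ge> 0" by (auto simp: n_def k_def)
  have dt: "heat_kernel_dt t w = \<psi> (norm w)" for w :: 'a
    by (simp add: heat_kernel_dt_def heat_kernel_def \<psi>_def n_def k_def)
  have der: "(\<psi> has_field_derivative \<psi>' s) (at s within S)" for s
    unfolding \<psi>_def \<psi>'_def using t
    by (auto intro!: derivative_eq_intros simp: field_simps power2_eq_square)
  have bound: "norm (\<psi>' s) \<le> B" if "s \<in> S" for s
  proof -
    \<comment> \<open>Half of the Gaussian exponent, \<open>b = s^2 / (8 t)\<close>, absorbs the
      polynomial in the scaled radius. The other half dominates the Gaussian of \<open>z\<close> at
      time \<open>4 * t\<close>, since the square of \<open>norm z\<close> is at most
      \<open>2 s^2 + 8 t\<close>.\<close>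
    define \<sigma> where "\<sigma> = s / sqrt t"
    define b where "b = \<sigma>\<^sup>2 / 8"
    have s: "s \<ge> 0" "norm z \<le> s + 2 * sqrt t" using that by (auto simp: S_def)
    have \<sigma>: "\<sigma> \<ge> 0" "s = \<sigma> * sqrt t" using s t by (auto simp: \<sigma>_def)
    have b: "b \<ge> 0" by (simp add: b_def)
    have tt: "sqrt t * sqrt t = t" using t by simp
    have "(norm z)\<^sup>2 \<le> (s + 2 * sqrt t)\<^sup>2" using s by (intro power_mono) auto
    also have "\<dots> \<le> 2 * s\<^sup>2 + 8 * t"
      using t zero_le_power2[of "s - 2 * sqrt t"] by (simp add: power2_sum power2_diff power_mult_distrib)
    finally have "(norm z)\<^sup>2 \<le> 2 * s\<^sup>2 + 8 * t" .
    moreover have "s\<^sup>2 = 8 * b * t" using t by (simp add: b_def \<sigma>_def field_simps)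
    ultimately have zb: "(norm z)\<^sup>2 / (4 * (4 * t)) - 1 / 2 \<le> b" using t by (simp add: field_simps)
    have e1: "exp (- s\<^sup>2 / (4 * t)) = exp (- b) * exp (- b)"
      using t \<open>s\<^sup>2 = _\<close> by (simp add: exp_add[symmetric])
    have e2: "exp (- b) \<le> exp (1 / 2) * exp (- (norm z)\<^sup>2 / (4 * (4 * t)))"
      unfolding exp_add[symmetric] using zb by simp
    have s3: "\<sigma> \<le> 1 + 8 * b" "\<sigma> ^ 3 \<le> 1 + 64 * b\<^sup>2"
    proof -
      show "\<sigma> \<le> 1 + 8 * b" using \<sigma>(1) zero_le_square[of "\<sigma> - 1"] by (simp add: b_def power2_eq_square algebra_simps)
      have "\<sigma> ^ 3 \<le> 1 + \<sigma> ^ 4"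
      proof (cases "\<sigma> \<le> 1")
        case True then show ?thesis using \<sigma> power_le_one[of \<sigma> 3] zero_le_power[of \<sigma> 4] by linarith
      next
        case False
        then have "\<sigma> ^ 3 \<le> \<sigma> ^ 4" by (intro power_increasing) auto
        then show ?thesis by simp
      qed
      then show "\<sigma> ^ 3 \<le> 1 + 64 * b\<^sup>2" by (simp add: b_def power_divide flip: power_mult)
    qed
    have "\<bar>s / (2 * t\<^sup>2) - (s / (2 * t)) * (s\<^sup>2 / (4 * t\<^sup>2) - n / (2 * t))\<bar> \<le> ((1 / 2 + n / 4) * \<sigma> + \<sigma> ^ 3 / 8) / (t * sqrt t)"
    proof -
      \<comment> \<open>With \<open>w\<close> for \<open>sqrt t\<close> and \<open>w * w\<close> for
        \<open>t\<close> the identity becomes rational in \<open>w\<close>.\<close>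
      have "s / (2 * t\<^sup>2) - (s / (2 * t)) * (s\<^sup>2 / (4 * t\<^sup>2) - n / (2 * t)) = ((1 / 2 + n / 4) * \<sigma> - \<sigma> ^ 3 / 8) / (t * sqrt t)"
        if "w > 0" "t = w * w" "sqrt t = w" for w
        unfolding \<sigma>(2) that(2,3) using that(1) by (simp add: field_simps power2_eq_square power3_eq_cube)
      from this[of "sqrt t"] have "s / (2 * t\<^sup>2) - (s / (2 * t)) * (s\<^sup>2 / (4 * t\<^sup>2) - n / (2 * t)) = ((1 / 2 + n / 4) * \<sigma> - \<sigma> ^ 3 / 8) / (t * sqrt t)"
        using t by simp
      moreover have "\<bar>(1 / 2 + n / 4) * \<sigma> - \<sigma> ^ 3 / 8\<bar> \<le> (1 / 2 + n / 4) * \<sigma> + \<sigma> ^ 3 / 8"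
        using n \<sigma> by (intro order_trans[OF abs_triangle_ineq4]) auto
      ultimately show ?thesis using t by (simp add: divide_right_mono)
    qed
    also have "\<dots> \<le> ((1 / 2 + n / 4) * (1 + 8 * b) + (1 + 64 * b\<^sup>2) / 8) / (t * sqrt t)"
      using t n s3 by (intro divide_right_mono add_mono mult_left_mono) auto
    finally have p: "\<bar>s / (2 * t\<^sup>2) - (s / (2 * t)) * (s\<^sup>2 / (4 * t\<^sup>2) - n / (2 * t))\<bar> \<le> \<dots>" .
    have "((1 / 2 + n / 4) * (1 + 8 * b) + (1 + 64 * b\<^sup>2) / 8) * exp (- b) =
        (1 / 2 + n / 4 + 1 / 8) * exp (- b) + (1 / 2 + n / 4) * 8 * (b ^ 1 * exp (- b)) + 8 * (b ^ 2 * exp (- b))"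
      by (simp add: field_simps)
    also have "\<dots> \<le> (1 / 2 + n / 4 + 1 / 8) * 1 + (1 / 2 + n / 4) * 8 * fact 1 + 8 * fact 2"
      using n b by (intro add_mono mult_left_mono power_mult_exp_minus_le) auto
    also have "\<dots> = M" by (simp add: M_def)
    finally have q: "((1 / 2 + n / 4) * (1 + 8 * b) + (1 + 64 * b\<^sup>2) / 8) * exp (- b) \<le> M" .
    have "norm (\<psi>' s) = k * exp (- b) * exp (- b) * \<bar>s / (2 * t\<^sup>2) - (s / (2 * t)) * (s\<^sup>2 / (4 * t\<^sup>2) - n / (2 * t))\<bar>"
      using k unfolding \<psi>'_def e1 by (simp add: abs_mult)
    also have "\<dots> \<le> k * exp (- b) * exp (- b) * (((1 / 2 + n / 4) * (1 + 8 * b) + (1 + 64 * b\<^sup>2) / 8) / (t * sqrt t))"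
      using k by (intro mult_left_mono p) auto
    also have "\<dots> = k * exp (- b) / (t * sqrt t) * (((1 / 2 + n / 4) * (1 + 8 * b) + (1 + 64 * b\<^sup>2) / 8) * exp (- b))"
      by simp
    also have "\<dots> \<le> k * (exp (1 / 2) * exp (- (norm z)\<^sup>2 / (4 * (4 * t)))) / (t * sqrt t) * M"
      using k t n e2 q b by (intro mult_mono divide_right_mono mult_left_mono) auto
    also have "\<dots> = B"
    proof -
      have "k = 4 powr (n / 2) * (4 * pi * (4 * t)) powr (- (n / 2))"
      proof -
        have "w powr (- a) = 4 powr a * (4 * w) powr (- a)" if "w > 0" for w a :: real
          using that by (subst powr_mult) (simp_all add: powr_minus)
        from this[of "4 * pi * t" "n / 2"] show ?thesis
          using t by (simp add: k_def ac_simps)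
      qed
      then show ?thesis
        by (simp add: B_def heat_kernel_smooth_const_def heat_kernel_def M_def n_def)
    qed
    finally show ?thesis .
  qed
  have z': "norm z' \<in> S" "norm z \<in> S"
    using zz t norm_triangle_ineq2[of z z'] by (auto simp: S_def)
  have B: "B \<ge> 0" using bound[OF z'(1)] norm_ge_zero[of "\<psi>' (norm z')"] by linarith
  have "norm (\<psi> (norm z) - \<psi> (norm z')) \<le> B * norm (norm z - norm z')"
    using z' der bound by (intro field_differentiable_bound[of S \<psi> \<psi>']) (auto simp: S_def)
  also have "\<dots> \<le> B * norm (z - z')"
    using B norm_triangle_ineq3[of z z'] by (intro mult_left_mono) auto
  finally show ?thesis by (simp add: dt B_def ac_simps)
qed

section \<open>Differentiation of the heat semigroup\<close>

lemma has_vector_derivative_iff_tendsto: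
  "(f has_vector_derivative D) (at x) \<longleftrightarrow> ((\<lambda>y. (f y - f x) /\<^sub>R (y - x)) \<longlongrightarrow> D) (at x)"
proof -
  have "norm (f y - f x - (y - x) *\<^sub>R D) / norm (y - x) = norm ((f y - f x) /\<^sub>R (y - x) - D)" if "y \<noteq> x" for y
  proof -
    have "(f y - f x) /\<^sub>R (y - x) - D = (f y - f x - (y - x) *\<^sub>R D) /\<^sub>R (y - x)"
      using that by (simp add: scaleR_diff_right)
    then show ?thesis by (simp add: divide_inverse_commute)
  qed
  then have "((\<lambda>y. norm (f y - f x - (y - x) *\<^sub>R D) / norm (y - x)) \<longlongrightarrow> 0) (at x) \<longleftrightarrow>
    ((\<lambda>y. norm ((f y - f x) /\<^sub>R (y - x) - D)) \<longlongrightarrow> 0) (at x)"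
    by (intro filterlim_cong) (auto simp: eventually_at_filter)
  then show ?thesis
    unfolding has_vector_derivative_def has_derivative_iff_norm
    by (simp add: bounded_linear_scaleR_left tendsto_norm_zero_iff LIM_zero_iff)
qed

text \<open>The mean value theorem turns the bound \<open>G\<close> on \<open>k'\<close> into a
  bound on the difference quotients, uniform near \<open>t\<close>; dominated convergence along
  arbitrary sequences then gives the derivative. It serves both the heat semigroup and the energy
  functional.\<close>

lemma has_vector_derivative_kernel_integral:
  fixes k k' :: "real \<Rightarrow> 'y \<Rightarrow> real" and f :: "'y \<Rightarrow> 'b::{banach, second_countable_topology}"
  assumes d: "d > 0"
    and int: "\<And>s. \<bar>s - t\<bar> < d \<Longrightarrow> integrable M (\<lambda>y. k s y *\<^sub>R f y)"
    and der: "\<And>s y. \<bar>s - t\<bar> < d \<Longrightarrow> ((\<lambda>s. k s y) has_field_derivative k' s y) (at s)"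
    and bound: "\<And>s y. \<bar>s - t\<bar> < d \<Longrightarrow> \<bar>k' s y\<bar> \<le> G y"
    and G: "integrable M (\<lambda>y. G y *\<^sub>R f y)"
    and meas: "(\<lambda>y. k' t y *\<^sub>R f y) \<in> borel_measurable M"
  shows "((\<lambda>s. LINT y|M. k s y *\<^sub>R f y) has_vector_derivative (LINT y|M. k' t y *\<^sub>R f y)) (at t)"
  unfolding has_vector_derivative_iff_tendsto tendsto_at_iff_sequentially comp_def
proof (intro allI impI)
  fix X :: "nat \<Rightarrow> real"
  assume X: "\<forall>i. X i \<in> UNIV - {t}" "X \<longlonglongrightarrow> t"
  obtain N where N: "\<And>i. i \<ge> N \<Longrightarrow> \<bar>X i - t\<bar> < d"
    using X(2) d unfolding LIMSEQ_iff by (metis real_norm_def)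
  have [measurable]: "(\<lambda>y. ((k (X (i + N)) y - k t y) / (X (i + N) - t)) *\<^sub>R f y) \<in> borel_measurable M" for i
  proof -
    have "(\<lambda>y. (k (X (i + N)) y *\<^sub>R f y - k t y *\<^sub>R f y) /\<^sub>R (X (i + N) - t)) \<in> borel_measurable M"
      using int[of t] int[OF N, of "i + N"] d by (intro borel_measurable_integrable integrable_scaleR_right Bochner_Integration.integrable_diff) auto
    then show ?thesis by (simp add: scaleR_diff_left[symmetric] divide_inverse_commute)
  qed
  have "(\<lambda>i. LINT y|M. ((k (X (i + N)) y - k t y) / (X (i + N) - t)) *\<^sub>R f y) \<longlonglongrightarrow> (LINT y|M. k' t y *\<^sub>R f y)"
  proof (rule integral_dominated_convergence[where w="\<lambda>y. norm (G y *\<^sub>R f y)"])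
    show "AE y in M. (\<lambda>i. ((k (X (i + N)) y - k t y) / (X (i + N) - t)) *\<^sub>R f y) \<longlonglongrightarrow> k' t y *\<^sub>R f y"
    proof (rule AE_I2, rule tendsto_scaleR[OF _ tendsto_const])
      fix y
      have "((\<lambda>s. (k s y - k t y) / (s - t)) \<longlongrightarrow> k' t y) (at t)"
        using der[of t y] d by (simp add: has_field_derivative_iff)
      then have "(\<lambda>i. (k (X i) y - k t y) / (X i - t)) \<longlonglongrightarrow> k' t y"
        using X unfolding tendsto_at_iff_sequentially comp_def by blast
      then show "(\<lambda>i. (k (X (i + N)) y - k t y) / (X (i + N) - t)) \<longlonglongrightarrow> k' t y"
        by (rule LIMSEQ_ignore_initial_segment)
    qed
    show "AE y in M. norm (((k (X (i + N)) y - k t y) / (X (i + N) - t)) *\<^sub>R f y) \<le> norm (G y *\<^sub>R f y)" for i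
    proof (rule AE_I2)
      fix y
      have "norm (k (X (i + N)) y - k t y) \<le> G y * norm (X (i + N) - t)"
        using N[of "i + N"] d
        by (intro field_differentiable_bound[of "ball t d" "\<lambda>s. k s y" "\<lambda>s. k' s y"])
          (auto simp: dist_real_def abs_minus_commute intro!: DERIV_subset[OF der] bound)
      also have "G y * norm (X (i + N) - t) \<le> \<bar>G y\<bar> * \<bar>X (i + N) - t\<bar>"
        by (simp only: real_norm_def mult_right_mono abs_ge_self abs_ge_zero)
      finally have "\<bar>k (X (i + N)) y - k t y\<bar> \<le> \<bar>G y\<bar> * \<bar>X (i + N) - t\<bar>" by simp
      moreover have "\<bar>X (i + N) - t\<bar> > 0" using X(1) by auto
      ultimately have "\<bar>(k (X (i + N)) y - k t y) / (X (i + N) - t)\<bar> \<le> \<bar>G y\<bar>"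
        by (simp add: pos_divide_le_eq)
      then show "norm (((k (X (i + N)) y - k t y) / (X (i + N) - t)) *\<^sub>R f y) \<le> norm (G y *\<^sub>R f y)"
        by (simp only: norm_scaleR mult_right_mono norm_ge_zero)
    qed
    show "integrable M (\<lambda>y. norm (G y *\<^sub>R f y))" using G by (rule integrable_norm)
  qed (use meas in auto)
  moreover have "(LINT y|M. ((k (X (i + N)) y - k t y) / (X (i + N) - t)) *\<^sub>R f y) =
      ((LINT y|M. k (X (i + N)) y *\<^sub>R f y) - (LINT y|M. k t y *\<^sub>R f y)) /\<^sub>R (X (i + N) - t)" for i
    using int[of t] int[OF N, of "i + N"] d
    by (subst Bochner_Integration.integral_diff[symmetric])
      (auto simp: divide_inverse_commute scaleR_diff_left[symmetric] simp flip: integral_scaleR_right)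
  ultimately have "(\<lambda>i. ((LINT y|M. k (X (i + N)) y *\<^sub>R f y) - (LINT y|M. k t y *\<^sub>R f y)) /\<^sub>R (X (i + N) - t)) \<longlonglongrightarrow> (LINT y|M. k' t y *\<^sub>R f y)"
    by simp
  then show "(\<lambda>i. ((LINT y|M. k (X i) y *\<^sub>R f y) - (LINT y|M. k t y *\<^sub>R f y)) /\<^sub>R (X i - t)) \<longlonglongrightarrow> (LINT y|M. k' t y *\<^sub>R f y)"
    by (rule LIMSEQ_offset)
qed

text \<open>The class on which the semigroup and its time derivative are absolutely convergent
  integrals at every point and time. Borel rather than Lebesgue measurability is demanded so that
  integrands are measurable on products and Tonelli applies over \<open>lborel\<close>.\<close>

definition gauss_integrable :: "('a::euclidean_space \<Rightarrow> 'b::{banach, second_countable_topology}) \<Rightarrow> bool" where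
  "gauss_integrable f \<longleftrightarrow> f \<in> borel_measurable borel \<and>
     (\<forall>t>0. \<forall>x. integrable lborel (\<lambda>y. heat_kernel t (x - y) *\<^sub>R f y))"

definition heat_dt :: "real \<Rightarrow> ('a::euclidean_space \<Rightarrow> 'b::{banach, second_countable_topology}) \<Rightarrow> 'a \<Rightarrow> 'b" where
  "heat_dt t f x = (LINT y|lborel. heat_kernel_dt t (x - y) *\<^sub>R f y)"

text \<open>The integrand \<open>|t D|^2 / t\<close> of the squared g-function, \<open>D\<close>
  being the time derivative, with one power of \<open>t\<close> cancelled.\<close>

abbreviation heat_sq :: "('a::euclidean_space \<Rightarrow> 'b::{banach, second_countable_topology}) \<Rightarrow> real \<Rightarrow> 'a \<Rightarrow> ennreal" where
  "heat_sq f t y \<equiv> ennreal (t * (norm (heat_dt t f y))\<^sup>2)"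

abbreviation abs_heat :: "('a::euclidean_space \<Rightarrow> 'b::real_normed_vector) \<Rightarrow> real \<Rightarrow> 'a \<Rightarrow> ennreal" where
  "abs_heat f t x \<equiv> (\<integral>\<^sup>+y. ennreal (heat_kernel t (x - y)) * ennreal (norm (f y)) \<partial>lborel)"

abbreviation abs_dev :: "('a::euclidean_space \<Rightarrow> 'b::real_normed_vector) \<Rightarrow> 'a set \<Rightarrow> 'b \<Rightarrow> ennreal" where
  "abs_dev f S c \<equiv> (\<integral>\<^sup>+y\<in>S. ennreal (norm (f y - c)) \<partial>lborel)"

abbreviation sq_dev :: "('a::euclidean_space \<Rightarrow> 'b::real_normed_vector) \<Rightarrow> 'a set \<Rightarrow> 'b \<Rightarrow> ennreal" where
  "sq_dev f S c \<equiv> (\<integral>\<^sup>+y\<in>S. ennreal ((norm (f y - c))\<^sup>2) \<partial>lborel)"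

lemma gauss_integrable_measurable: "gauss_integrable f \<Longrightarrow> f \<in> borel_measurable borel"
  by (simp add: gauss_integrable_def)

lemma gauss_integrableI:
  assumes [measurable]: "f \<in> borel_measurable borel"
    and "\<And>t x. t > 0 \<Longrightarrow> (abs_heat f t x) < \<infinity>"
  shows "gauss_integrable f"
  unfolding gauss_integrable_def
  using assms by (auto intro!: integrableI_bounded simp: ennreal_mult)

lemma gauss_integrable_nn_finite:
  assumes "gauss_integrable f" "t > 0"
  shows "(abs_heat f t x) < \<infinity>"
  using assms by (auto simp: gauss_integrable_def integrable_iff_bounded ennreal_mult)

lemma gauss_integrable_bound:
  assumes "gauss_integrable f" "t > 0" "k \<in> borel_measurable borel"
    and "\<And>y. \<bar>k y\<bar> \<le> C * heat_kernel t (x - y)"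
  shows "integrable lborel (\<lambda>y. k y *\<^sub>R f y)"
proof (rule Bochner_Integration.integrable_bound)
  show "integrable lborel (\<lambda>y. C *\<^sub>R (heat_kernel t (x - y) *\<^sub>R f y))"
    using assms by (intro integrable_scaleR_right) (simp add: gauss_integrable_def)
  show "(\<lambda>y. k y *\<^sub>R f y) \<in> borel_measurable lborel"
    using assms by (auto simp: gauss_integrable_def)
  show "AE y in lborel. norm (k y *\<^sub>R f y) \<le> norm (C *\<^sub>R (heat_kernel t (x - y) *\<^sub>R f y))"
  proof (rule AE_I2)
    fix y
    have "\<bar>k y\<bar> * norm (f y) \<le> \<bar>C * heat_kernel t (x - y)\<bar> * norm (f y)"
      using assms(4)[of y] by (intro mult_right_mono) auto
    then show "norm (k y *\<^sub>R f y) \<le> norm (C *\<^sub>R (heat_kernel t (x - y) *\<^sub>R f y))"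
      by (simp add: abs_mult mult.assoc)
  qed
qed

text \<open>One kernel, at time \<open>3 * t\<close>, dominates the derivative for all
  \<open>s\<close> within \<open>t / 2\<close> of \<open>t\<close>: then
  \<open>2 * s < 3 * t\<close>, and \<open>s > t / 2\<close> keeps \<open>1 / s\<close> bounded.
  This is the majorant for differentiating under the integral.\<close>

lemma abs_heat_kernel_dt_le_near:
  fixes z :: "'a::euclidean_space"
  assumes "t > 0" "\<bar>s - t\<bar> < t / 2"
  shows "\<bar>heat_kernel_dt s z\<bar> \<le>
    (2 + real DIM('a) / 2) * 2 powr (real DIM('a) / 2) / (t / 2) * (3 powr (real DIM('a) / 2) * heat_kernel (3 * t) z)"
proof -
  have s: "s > t / 2" "s < 3 * t / 2" using assms by linarith+
  have "\<bar>heat_kernel_dt s z\<bar> \<le> (2 + real DIM('a) / 2) * 2 powr (real DIM('a) / 2) / s * heat_kernel (2 * s) z"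
    using s assms by (intro abs_heat_kernel_dt_le) auto
  also have "\<dots> \<le> (2 + real DIM('a) / 2) * 2 powr (real DIM('a) / 2) / (t / 2) * (3 powr (real DIM('a) / 2) * heat_kernel (3 * t) z)"
  proof (intro mult_mono divide_left_mono)
    have "heat_kernel (2 * s) z \<le> (3 * t / (2 * s)) powr (real DIM('a) / 2) * heat_kernel (3 * t) z"
      using s assms by (intro heat_kernel_mono_time) auto
    also have "\<dots> \<le> 3 powr (real DIM('a) / 2) * heat_kernel (3 * t) z"
      using s assms by (intro mult_right_mono powr_mono2) (auto simp: field_simps)
    finally show "heat_kernel (2 * s) z \<le> 3 powr (real DIM('a) / 2) * heat_kernel (3 * t) z" .
  qed (use s assms in auto)
  finally show ?thesis .
qed

lemma heat_semigroup_eq_lborel: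
  assumes "f \<in> borel_measurable borel"
  shows "heat_semigroup t f x = (LINT y|lborel. heat_kernel t (x - y) *\<^sub>R f y)"
  unfolding heat_semigroup_def using assms by (intro integral_completion) auto

lemma integrable_heat_kernel_dt:
  assumes "gauss_integrable f" "t > 0"
  shows "integrable lborel (\<lambda>y. heat_kernel_dt t (x - y) *\<^sub>R f y)"
  using assms by (intro gauss_integrable_bound[where t="2 * t" and x=x, OF _ _ _ abs_heat_kernel_dt_le]) auto

lemma has_vector_derivative_heat_semigroup:
  assumes f: "gauss_integrable f" and t: "t > 0"
  shows "((\<lambda>s. heat_semigroup s f x) has_vector_derivative heat_dt t f x) (at t)"
proof -
  let ?C = "(2 + real DIM('a) / 2) * 2 powr (real DIM('a) / 2) / (t / 2) * (3 powr (real DIM('a) / 2))"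
  note [measurable] = gauss_integrable_measurable[OF f]
  show ?thesis
    unfolding heat_semigroup_eq_lborel[OF gauss_integrable_measurable[OF f]] heat_dt_def
  proof (rule has_vector_derivative_kernel_integral[where d="t / 2" and G="\<lambda>y. ?C * heat_kernel (3 * t) (x - y)"])
    have "s > 0" if "\<bar>s - t\<bar> < t / 2" for s using that t by linarith
    then show "\<bar>s - t\<bar> < t / 2 \<Longrightarrow> integrable lborel (\<lambda>y. heat_kernel s (x - y) *\<^sub>R f y)"
        "\<bar>s - t\<bar> < t / 2 \<Longrightarrow> ((\<lambda>s. heat_kernel s (x - y)) has_field_derivative heat_kernel_dt s (x - y)) (at s)" for s y
      using f by (auto simp: gauss_integrable_def intro!: has_field_derivative_heat_kernel)
    show "integrable lborel (\<lambda>y. (?C * heat_kernel (3 * t) (x - y)) *\<^sub>R f y)"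
      using f t by (intro gauss_integrable_bound[where t="3 * t" and x=x and C="?C"]) (auto simp: abs_mult)
    show "\<bar>s - t\<bar> < t / 2 \<Longrightarrow> \<bar>heat_kernel_dt s (x - y)\<bar> \<le> ?C * heat_kernel (3 * t) (x - y)" for s y
      using abs_heat_kernel_dt_le_near[OF t] by (simp add: mult.assoc)
  qed (use t in auto)
qed

lemma gauss_integrable_heat_kernel:
  assumes "s > 0"
  shows "gauss_integrable (\<lambda>y. heat_kernel s (y - z))"
  using assms nn_integral_heat_kernel_mult[of _ s _ z] by (intro gauss_integrableI) auto

lemma gauss_integrable_heat_kernel_dt:
  assumes "s > 0"
  shows "gauss_integrable (\<lambda>y. heat_kernel_dt s (x - y))"
proof (rule gauss_integrableI)
  fix t :: real and x' :: 'a
  let ?C = "(2 + real DIM('a) / 2) * 2 powr (real DIM('a) / 2) / s"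
  assume "t > 0"
  have "(\<integral>\<^sup>+y. ennreal (heat_kernel t (x' - y)) * ennreal (norm (heat_kernel_dt s (x - y))) \<partial>lborel) \<le>
    (\<integral>\<^sup>+y. ennreal (heat_kernel t (x' - y)) * (ennreal ?C * ennreal (heat_kernel (2 * s) (y - x))) \<partial>lborel)"
    using assms abs_heat_kernel_dt_le[OF assms]
    by (intro nn_integral_mono mult_left_mono) (auto simp: ennreal_mult[symmetric] heat_kernel_commute(1)[of _ _ x])
  also have "\<dots> = ennreal ?C * (\<integral>\<^sup>+y. ennreal (heat_kernel t (x' - y)) * ennreal (heat_kernel (2 * s) (y - x)) \<partial>lborel)"
    by (subst nn_integral_cmult[symmetric]) (auto simp: ac_simps)
  also have "\<dots> < \<infinity>"
    using assms \<open>t > 0\<close> by (simp add: nn_integral_heat_kernel_mult ennreal_mult_less_top)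
  finally show "(\<integral>\<^sup>+y. ennreal (heat_kernel t (x' - y)) * ennreal (norm (heat_kernel_dt s (x - y))) \<partial>lborel) < \<infinity>" .
qed auto

section \<open>Convolution identities for the kernel and its time derivative\<close>

lemma integral_heat_kernel_mult:
  fixes x z :: "'a::euclidean_space"
  assumes "t > 0" "s > 0"
  shows "(LINT y|lborel. heat_kernel t (x - y) * heat_kernel s (y - z)) = heat_kernel (t + s) (x - z)"
  using assms nn_integral_heat_kernel_mult[OF assms, of x z]
  by (subst integral_eq_nn_integral) (auto simp: ennreal_mult)

text \<open>Differentiating the semigroup law in \<open>t\<close> under the integral replaces a
  computation with Gaussian moments. The product of two derivatives is treated likewise, by
  differentiating the present identity in \<open>s\<close>.\<close>

lemma integral_heat_kernel_dt_mult:
  fixes x z :: "'a::euclidean_space"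
  assumes "t > 0" "s > 0"
  shows "(LINT y|lborel. heat_kernel_dt t (x - y) * heat_kernel s (y - z)) = heat_kernel_dt (t + s) (x - z)"
proof -
  have eq: "heat_semigroup r (\<lambda>y. heat_kernel s (y - z)) x = heat_kernel (r + s) (x - z)" if "r > 0" for r
    using that assms by (simp add: heat_semigroup_eq_lborel integral_heat_kernel_mult)
  have "((\<lambda>r. heat_semigroup r (\<lambda>y. heat_kernel s (y - z)) x) has_vector_derivative heat_dt t (\<lambda>y. heat_kernel s (y - z)) x) (at t)"
    using assms by (intro has_vector_derivative_heat_semigroup gauss_integrable_heat_kernel)
  then have "((\<lambda>r. heat_kernel (r + s) (x - z)) has_vector_derivative heat_dt t (\<lambda>y. heat_kernel s (y - z)) x) (at t)"
    by (rule has_vector_derivative_transform_within_open[of _ _ _ "{0<..}"]) (use assms eq in auto)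
  moreover have "((\<lambda>r. heat_kernel (r + s) (x - z)) has_vector_derivative heat_kernel_dt (t + s) (x - z)) (at t)"
    using has_field_derivative_heat_kernel[of "t + s" "x - z"] assms
    by (simp add: has_real_derivative_iff_has_vector_derivative[symmetric] DERIV_shift)
  ultimately show ?thesis
    by (simp add: heat_dt_def vector_derivative_unique_at)
qed

lemma integral_heat_kernel_dt_mult_dt:
  fixes x z :: "'a::euclidean_space"
  assumes "t > 0" "s > 0"
  shows "(LINT y|lborel. heat_kernel_dt t (x - y) * heat_kernel_dt s (y - z)) = heat_kernel_dtt (t + s) (x - z)"
proof -
  have eq: "heat_semigroup r (\<lambda>y. heat_kernel_dt t (x - y)) z = heat_kernel_dt (t + r) (x - z)" if "r > 0" for r
    using that assms integral_heat_kernel_dt_mult[of t r x z]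
    by (simp add: heat_semigroup_eq_lborel heat_kernel_commute(1)[of r z] mult.commute)
  have "((\<lambda>r. heat_semigroup r (\<lambda>y. heat_kernel_dt t (x - y)) z) has_vector_derivative heat_dt s (\<lambda>y. heat_kernel_dt t (x - y)) z) (at s)"
    using assms by (intro has_vector_derivative_heat_semigroup gauss_integrable_heat_kernel_dt)
  then have "((\<lambda>r. heat_kernel_dt (t + r) (x - z)) has_vector_derivative heat_dt s (\<lambda>y. heat_kernel_dt t (x - y)) z) (at s)"
    by (rule has_vector_derivative_transform_within_open[of _ _ _ "{0<..}"]) (use assms eq in auto)
  moreover have "((\<lambda>r. heat_kernel_dt (t + r) (x - z)) has_vector_derivative heat_kernel_dtt (t + s) (x - z)) (at s)"
    using has_field_derivative_heat_kernel_dt[of "s + t" "x - z"] assms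
    by (simp add: has_real_derivative_iff_has_vector_derivative[symmetric] DERIV_shift add.commute[of t])
  ultimately have "heat_dt s (\<lambda>y. heat_kernel_dt t (x - y)) z = heat_kernel_dtt (t + s) (x - z)"
    by (simp add: vector_derivative_unique_at)
  then show ?thesis
    by (simp add: heat_dt_def heat_kernel_commute(2)[of s z] mult.commute)
qed

text \<open>A shift by at most \<open>sqrt t\<close> costs no more than a doubled time, because the
  square of \<open>norm z'\<close> is at most \<open>2 * (norm z)^2 + 2 * t\<close>. This provides
  the majorant for continuity of the semigroup and recentres the exterior estimate at the centre of
  a ball.\<close>

lemma heat_kernel_shift:
  fixes z z' :: "'a::euclidean_space"
  assumes "t > 0" "(norm (z - z'))\<^sup>2 \<le> t"
  shows "heat_kernel t z \<le> 2 powr (real DIM('a) / 2) * exp (1 / 4) * heat_kernel (2 * t) z'"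
proof -
  have "norm z' \<le> norm z + norm (z - z')"
    using norm_triangle_sub[of z' z] by (simp add: norm_minus_commute)
  then have "(norm z')\<^sup>2 \<le> (norm z + norm (z - z'))\<^sup>2"
    by (intro power_mono) auto
  also have "\<dots> \<le> 2 * (norm z)\<^sup>2 + 2 * (norm (z - z'))\<^sup>2"
    using zero_le_power2[of "norm z - norm (z - z')"] by (simp add: power2_sum power2_diff)
  finally have "(norm z')\<^sup>2 \<le> 2 * (norm z)\<^sup>2 + 2 * t" using assms by linarith
  then have "- (norm z)\<^sup>2 / (4 * t) \<le> 1 / 4 + (- (norm z')\<^sup>2 / (4 * (2 * t)))"
    using assms by (simp add: field_simps)
  then have "exp (- (norm z)\<^sup>2 / (4 * t)) \<le> exp (1 / 4) * exp (- (norm z')\<^sup>2 / (4 * (2 * t)))"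
    by (simp add: exp_add[symmetric])
  moreover have "(4 * pi * t) powr (- (real DIM('a) / 2)) = 2 powr (real DIM('a) / 2) * (4 * pi * (2 * t)) powr (- (real DIM('a) / 2))"
  proof -
    have "w powr (- a) = 2 powr a * (2 * w) powr (- a)" if "w > 0" for w a :: real
      using that by (subst powr_mult) (simp_all add: powr_minus)
    from this[of "4 * pi * t" "real DIM('a) / 2"] show ?thesis
      using assms by (simp add: ac_simps)
  qed
  ultimately have "heat_kernel t z \<le> (2 powr (real DIM('a) / 2) * (4 * pi * (2 * t)) powr (- (real DIM('a) / 2))) *
      (exp (1 / 4) * exp (- (norm z')\<^sup>2 / (4 * (2 * t))))"
    unfolding heat_kernel_def by (metis mult_left_mono powr_ge_zero)
  also have "\<dots> = 2 powr (real DIM('a) / 2) * exp (1 / 4) * heat_kernel (2 * t) z'"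
    by (simp add: heat_kernel_def)
  finally show ?thesis .
qed

lemma heat_semigroup_measurable [measurable (raw)]:
  assumes [measurable]: "f \<in> borel_measurable borel"
  shows "heat_semigroup t f \<in> borel_measurable borel"
proof -
  have "(\<lambda>x. LINT y|lborel. heat_kernel t (x - y) *\<^sub>R f y) \<in> borel_measurable borel"
    by measurable
  then show ?thesis
    by (simp add: heat_semigroup_eq_lborel[OF assms, abs_def])
qed

lemma heat_dt_measurable [measurable (raw)]:
  fixes f :: "'a::euclidean_space \<Rightarrow> 'b::{banach, second_countable_topology}"
  assumes [measurable]: "f \<in> borel_measurable borel" "g \<in> borel_measurable M" "h \<in> borel_measurable M"
  shows "(\<lambda>w. heat_dt (g w) f (h w)) \<in> borel_measurable M"
  unfolding heat_dt_def by measurable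

lemma nn_integral_abs_kernels:
  fixes x :: "'a::euclidean_space"
  assumes [measurable]: "f \<in> borel_measurable borel" and "t > 0" "s > 0"
  shows "(\<integral>\<^sup>+y. ennreal (heat_kernel t (x - y)) * (abs_heat f s y) \<partial>lborel) =
    (abs_heat f (t + s) x)"
proof -
  have "(\<integral>\<^sup>+y. ennreal (heat_kernel t (x - y)) * (abs_heat f s y) \<partial>lborel) =
    (\<integral>\<^sup>+y. \<integral>\<^sup>+z. ennreal (heat_kernel t (x - y)) * (ennreal (heat_kernel s (y - z)) * ennreal (norm (f z))) \<partial>lborel \<partial>lborel)"
    by (intro nn_integral_cong nn_integral_cmult[symmetric]) auto
  also have "\<dots> = (\<integral>\<^sup>+z. \<integral>\<^sup>+y. ennreal (heat_kernel t (x - y)) * (ennreal (heat_kernel s (y - z)) * ennreal (norm (f z))) \<partial>lborel \<partial>lborel)"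
    by (rule lborel_pair.Fubini') auto
  also have "\<dots> = (\<integral>\<^sup>+z. (\<integral>\<^sup>+y. ennreal (heat_kernel t (x - y)) * ennreal (heat_kernel s (y - z)) \<partial>lborel) * ennreal (norm (f z)) \<partial>lborel)"
    by (intro nn_integral_cong) (simp add: nn_integral_multc[symmetric] mult.assoc)
  finally show ?thesis
    using assms by (simp add: nn_integral_heat_kernel_mult)
qed

text \<open>Fubini for the product of the kernels, with absolute convergence from
  \<open>nn_integral_abs_kernels\<close>. It allows a positive amount \<open>s\<close> of the time
  to be spent on smoothing \<open>f\<close> before the square function is estimated.\<close>

lemma heat_dt_heat_semigroup:
  assumes f: "gauss_integrable f" and t: "t > 0" and s: "s > 0"
  shows "heat_dt t (heat_semigroup s f) x = heat_dt (t + s) f x"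
proof -
  note [measurable] = gauss_integrable_measurable[OF f]
  define F where "F y z = (heat_kernel_dt t (x - y) * heat_kernel s (y - z)) *\<^sub>R f z" for y z
  define C where "C = (2 + real DIM('a) / 2) * 2 powr (real DIM('a) / 2) / t"
  have C: "C \<ge> 0" using t by (simp add: C_def)
  have F[measurable]: "(\<lambda>(y, z). F y z) \<in> borel_measurable (borel \<Otimes>\<^sub>M borel)" unfolding F_def by measurable
  have "(\<integral>\<^sup>+y. \<integral>\<^sup>+z. norm (F y z) \<partial>lborel \<partial>lborel) \<le>
    (\<integral>\<^sup>+y. ennreal C * (ennreal (heat_kernel (2 * t) (x - y)) * (abs_heat f s y)) \<partial>lborel)"
  proof (intro nn_integral_mono)
    fix y
    have "(\<integral>\<^sup>+z. norm (F y z) \<partial>lborel) = ennreal \<bar>heat_kernel_dt t (x - y)\<bar> * (abs_heat f s y)"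
      by (subst nn_integral_cmult[symmetric]) (auto simp: F_def ennreal_mult[symmetric] abs_mult mult.assoc intro!: nn_integral_cong)
    also have "\<dots> \<le> ennreal (C * heat_kernel (2 * t) (x - y)) * (abs_heat f s y)"
      using abs_heat_kernel_dt_le[OF t] by (intro mult_right_mono ennreal_leI) (auto simp: C_def)
    finally show "(\<integral>\<^sup>+z. norm (F y z) \<partial>lborel) \<le> ennreal C * (ennreal (heat_kernel (2 * t) (x - y)) * (abs_heat f s y))"
      using C by (simp add: ennreal_mult mult.assoc)
  qed
  also have "\<dots> = ennreal C * (abs_heat f (2 * t + s) x)"
    using t s by (subst nn_integral_cmult) (auto simp: nn_integral_abs_kernels)
  also have "\<dots> < \<infinity>"
    using gauss_integrable_nn_finite[OF f, of "2 * t + s" x] t s by (auto simp: ennreal_mult_less_top)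
  finally have fin: "(\<integral>\<^sup>+y. \<integral>\<^sup>+z. norm (F y z) \<partial>lborel \<partial>lborel) < \<infinity>" .
  have "(\<integral>\<^sup>+w. norm (case w of (y, z) \<Rightarrow> F y z) \<partial>(lborel \<Otimes>\<^sub>M lborel)) = (\<integral>\<^sup>+y. \<integral>\<^sup>+z. norm (F y z) \<partial>lborel \<partial>lborel)"
    by (subst lborel.nn_integral_fst[symmetric]) auto
  with fin have int: "integrable (lborel \<Otimes>\<^sub>M lborel) (\<lambda>(y, z). F y z)"
    by (intro integrableI_bounded) auto
  have "(LINT z|lborel. F y z) = heat_kernel_dt t (x - y) *\<^sub>R heat_semigroup s f y" for y
    unfolding F_def scaleR_scaleR[symmetric] heat_semigroup_eq_lborel[OF gauss_integrable_measurable[OF f]]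
    by (rule integral_scaleR_right)
  then have "heat_dt t (heat_semigroup s f) x = (LINT y|lborel. LINT z|lborel. F y z)"
    by (simp add: heat_dt_def)
  also have "\<dots> = (LINT z|lborel. LINT y|lborel. F y z)"
    by (rule lborel_pair.Fubini_integral[OF int, symmetric])
  also have "\<dots> = (LINT z|lborel. heat_kernel_dt (t + s) (x - z) *\<^sub>R f z)"
  proof (rule Bochner_Integration.integral_cong)
    fix z
    have "integrable lborel (\<lambda>y. heat_kernel_dt t (x - y) * heat_kernel s (y - z))"
      using integrable_heat_kernel_dt[OF gauss_integrable_heat_kernel[OF s, of z] t, of x] by simp
    then show "(LINT y|lborel. F y z) = heat_kernel_dt (t + s) (x - z) *\<^sub>R f z"
      using t s by (simp add: F_def integral_heat_kernel_dt_mult)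
  qed simp
  finally show ?thesis by (simp add: heat_dt_def)
qed

lemma continuous_on_heat_semigroup:
  fixes f :: "'a::euclidean_space \<Rightarrow> 'b::{banach, second_countable_topology}"
  assumes f: "gauss_integrable f" and t: "t > 0"
  shows "continuous_on S (heat_semigroup t f)"
proof (rule continuous_on_subset[OF _ subset_UNIV], unfold continuous_on_sequentially comp_def, intro allI impI ballI, elim conjE)
  fix X :: "nat \<Rightarrow> 'a" and x assume X: "X \<longlonglongrightarrow> x"
  note [measurable] = gauss_integrable_measurable[OF f]
  let ?C = "2 powr (real DIM('a) / 2) * exp (1 / 4)"
  obtain N where N: "\<And>i. i \<ge> N \<Longrightarrow> norm (X i - x) < sqrt t"
    using X t unfolding LIMSEQ_iff by (metis real_sqrt_gt_zero)
  have "(\<lambda>i. heat_semigroup t f (X (i + N))) \<longlonglongrightarrow> heat_semigroup t f x"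
    unfolding heat_semigroup_eq_lborel[OF gauss_integrable_measurable[OF f]]
  proof (rule integral_dominated_convergence[where w="\<lambda>y. norm ((?C * heat_kernel (2 * t) (x - y)) *\<^sub>R f y)"])
    show "integrable lborel (\<lambda>y. norm ((?C * heat_kernel (2 * t) (x - y)) *\<^sub>R f y))"
      using f t by (intro integrable_norm gauss_integrable_bound[where t="2 * t" and x=x and C="?C"]) (auto simp: abs_mult)
    show "AE y in lborel. (\<lambda>i. heat_kernel t (X (i + N) - y) *\<^sub>R f y) \<longlonglongrightarrow> heat_kernel t (x - y) *\<^sub>R f y"
      unfolding heat_kernel_def using t
      by (intro AE_I2 tendsto_intros LIMSEQ_ignore_initial_segment[OF X]) auto
    show "AE y in lborel. norm (heat_kernel t (X (i + N) - y) *\<^sub>R f y) \<le> norm ((?C * heat_kernel (2 * t) (x - y)) *\<^sub>R f y)" for i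
    proof (rule AE_I2)
      fix y
      have "(norm (X (i + N) - x))\<^sup>2 \<le> (sqrt t)\<^sup>2"
        using N[of "i + N"] by (intro power_mono) auto
      then have "heat_kernel t (X (i + N) - y) \<le> ?C * heat_kernel (2 * t) (x - y)"
        using t by (intro heat_kernel_shift) auto
      then show "norm (heat_kernel t (X (i + N) - y) *\<^sub>R f y) \<le> norm ((?C * heat_kernel (2 * t) (x - y)) *\<^sub>R f y)"
        by (simp add: abs_mult mult_right_mono)
    qed
  qed auto
  then show "(\<lambda>n. heat_semigroup t f (X n)) \<longlonglongrightarrow> heat_semigroup t f x"
    by (rule LIMSEQ_offset)
qed

lemma gauss_integrable_const: "gauss_integrable (\<lambda>_. c)"
  by (rule gauss_integrableI) (auto simp: nn_integral_multc)

lemma gauss_integrable_diff: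
  "gauss_integrable f \<Longrightarrow> gauss_integrable g \<Longrightarrow> gauss_integrable (\<lambda>x. f x - g x)"
  unfolding gauss_integrable_def by (auto simp: scaleR_diff_right)

lemma gauss_integrable_restrict:
  assumes f: "gauss_integrable f" and [measurable]: "S \<in> sets borel"
  shows "gauss_integrable (\<lambda>x. indicator S x *\<^sub>R f x)"
  unfolding gauss_integrable_def
proof (intro conjI allI impI)
  note [measurable] = gauss_integrable_measurable[OF f]
  show "(\<lambda>x. indicator S x *\<^sub>R f x) \<in> borel_measurable borel" by measurable
  fix t :: real and x assume "t > 0"
  then have "integrable lborel (\<lambda>y. (indicator S y * heat_kernel t (x - y)) *\<^sub>R f y)"
    using f by (intro gauss_integrable_bound[where t=t and x=x and C=1]) (auto simp: indicator_def)
  then show "integrable lborel (\<lambda>y. heat_kernel t (x - y) *\<^sub>R indicator S y *\<^sub>R f y)"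
    by (simp add: mult.commute)
qed

text \<open>The semigroup fixes constants, so their time derivative vanishes. By this cancellation
  only the deviation of \<open>f\<close> from a constant, freely chosen for each ball, has to be
  estimated.\<close>

lemma heat_dt_const:
  assumes "t > 0"
  shows "heat_dt t (\<lambda>_. c) x = 0"
proof -
  have eq: "heat_semigroup s (\<lambda>_. c) x = c" if "s > 0" for s
    using that by (simp add: heat_semigroup_eq_lborel integrable_heat_kernel)
  have "((\<lambda>s. heat_semigroup s (\<lambda>_. c) x) has_vector_derivative 0) (at t)"
    by (rule has_vector_derivative_transform_within_open[of "\<lambda>_. c" 0 t "{0<..}"]) (use assms eq in auto)
  then show ?thesis
    using has_vector_derivative_heat_semigroup[OF gauss_integrable_const assms, of c x] vector_derivative_unique_at by blast
qed

lemma heat_dt_add: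
  assumes "gauss_integrable f" "gauss_integrable g" "t > 0"
  shows "heat_dt t (\<lambda>x. f x + g x) x = heat_dt t f x + heat_dt t g x"
  using assms by (simp add: heat_dt_def scaleR_add_right integrable_heat_kernel_dt)

lemma heat_dt_diff_const:
  assumes "gauss_integrable f" "t > 0"
  shows "heat_dt t (\<lambda>x. f x - c) x = heat_dt t f x"
  using heat_dt_add[OF assms(1) gauss_integrable_const[of "- c"] assms(2), of x] assms heat_dt_const[of t "-c" x] by simp

section \<open>Mean oscillation against the heat kernel\<close>

text \<open>The two-point form contains no average: it makes sense for every Borel function, is
  invariant under translation, and by Tonelli passes to averages of translates with the same
  \<open>N\<close>.\<close>

definition mean_osc_le :: "('a::euclidean_space \<Rightarrow> 'b::real_normed_vector) \<Rightarrow> real \<Rightarrow> bool" where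
  "mean_osc_le f N \<longleftrightarrow> f \<in> borel_measurable borel \<and>
     (\<forall>x. \<forall>r>0. (\<integral>\<^sup>+y\<in>ball x r. (\<integral>\<^sup>+z\<in>ball x r. ennreal (norm (f y - f z)) \<partial>lborel) \<partial>lborel)
        \<le> ennreal N * (emeasure lborel (ball x r))\<^sup>2)"

lemma mean_osc_le_measurable: "mean_osc_le f N \<Longrightarrow> f \<in> borel_measurable borel"
  by (simp add: mean_osc_le_def)

lemma emeasure_lborel_ball_eq_measure:
  "emeasure lborel (ball (x::'a::euclidean_space) r) = ennreal (measure lborel (ball x r))"
  using emeasure_lborel_ball_finite[of x r] by (subst emeasure_eq_ennreal_measure) auto

lemma emeasure_ball_eq:
  fixes x :: "'a::euclidean_space"
  assumes "r \<ge> 0"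
  shows "emeasure lborel (ball x r) = ennreal (measure lborel (ball (0::'a) 1) * r ^ DIM('a))"
  using content_ball_conv_unit_ball[OF assms, of x]
  by (simp only: emeasure_lborel_ball_eq_measure mult.commute)

lemma measure_unit_ball_pos: "measure lborel (ball (0::'a::euclidean_space) 1) > 0"
  using content_ball_pos[of 1 "0::'a"] by simp

lemma emeasure_ball_pos: "r > 0 \<Longrightarrow> emeasure lborel (ball (x::'a::euclidean_space) r) > 0"
  using measure_unit_ball_pos[where 'a='a] by (simp add: emeasure_ball_eq)

text \<open>The inner integral has mean at most \<open>N\<close> times the volume, so at some
  \<open>y\<close> it is at most twice that, and \<open>f y\<close> serves as centre. The factor 2
  leaves a strict gap for the contradiction, since integration only preserves the weak
  inequality.\<close>

lemma mean_osc_le_center: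
  fixes f :: "'a::euclidean_space \<Rightarrow> 'b::euclidean_space"
  assumes f: "mean_osc_le f N" and N: "N > 0" and r: "r > 0"
  obtains c where "(abs_dev f (ball x r) c) \<le> ennreal (2 * N) * emeasure lborel (ball x r)"
proof -
  note [measurable] = mean_osc_le_measurable[OF f]
  let ?B = "ball x r"
  define b where "b = measure lborel ?B"
  have b: "b > 0" "emeasure lborel ?B = ennreal b"
    using content_ball_pos[OF r, of x] emeasure_lborel_ball_eq_measure[of x r] by (simp_all add: b_def)
  have "\<exists>y. (\<integral>\<^sup>+z\<in>?B. ennreal (norm (f y - f z)) \<partial>lborel) \<le> ennreal (2 * N) * ennreal b"
  proof (rule ccontr)
    assume "\<not> ?thesis"
    then have "ennreal (2 * N) * ennreal b \<le> (\<integral>\<^sup>+z\<in>?B. ennreal (norm (f y - f z)) \<partial>lborel)" for y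
      by (auto simp: not_le less_imp_le)
    then have "(\<integral>\<^sup>+y\<in>?B. ennreal (2 * N) * ennreal b \<partial>lborel) \<le> (\<integral>\<^sup>+y\<in>?B. (\<integral>\<^sup>+z\<in>?B. ennreal (norm (f y - f z)) \<partial>lborel) \<partial>lborel)"
      by (intro nn_integral_mono mult_right_mono) auto
    also have "\<dots> \<le> ennreal N * (ennreal b)\<^sup>2"
      using f r unfolding mean_osc_le_def b(2)[symmetric] by blast
    also have "\<dots> = ennreal (N * b\<^sup>2)"
      using b(1) N by (simp add: ennreal_mult ennreal_power)
    also have "(\<integral>\<^sup>+y\<in>?B. ennreal (2 * N) * ennreal b \<partial>lborel) = ennreal (2 * N) * ennreal b * ennreal b"
      by (subst nn_integral_cmult_indicator) (auto simp: b(2))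
    also have "\<dots> = ennreal (2 * N * b * b)"
      using b(1) N by (simp only: ennreal_mult[symmetric] mult_nonneg_nonneg less_imp_le zero_le_numeral)
    finally have "ennreal (2 * N * b * b) \<le> ennreal (N * b\<^sup>2)" .
    then have "2 * (N * b\<^sup>2) \<le> N * b\<^sup>2"
      using N b(1) by (subst (asm) ennreal_le_iff) (auto simp: power2_eq_square mult.assoc)
    moreover have "N * b\<^sup>2 > 0" using N b(1) by simp
    ultimately show False by linarith
  qed
  then obtain y where "(\<integral>\<^sup>+z\<in>?B. ennreal (norm (f y - f z)) \<partial>lborel) \<le> ennreal (2 * N) * ennreal b" by blast
  then show ?thesis
    using that[of "f y"] b by (simp add: norm_minus_commute)
qed

lemma norm_center_diff_le:
  fixes f :: "'a::euclidean_space \<Rightarrow> 'b::euclidean_space"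
  assumes [measurable]: "f \<in> borel_measurable borel" "S \<in> sets borel"
  shows "ennreal (norm (c - d)) * emeasure lborel S \<le>
    (abs_dev f S c) + (abs_dev f S d)"
proof -
  have "ennreal (norm (c - d)) * emeasure lborel S = (\<integral>\<^sup>+y\<in>S. ennreal (norm (c - d)) \<partial>lborel)"
    by (simp add: nn_integral_cmult_indicator)
  also have "\<dots> \<le> (\<integral>\<^sup>+y. ennreal (norm (f y - c)) * indicator S y + ennreal (norm (f y - d)) * indicator S y \<partial>lborel)"
    using norm_triangle_ineq4[of "f y - d" "f y - c" for y]
    by (intro nn_integral_mono) (auto simp: indicator_def ennreal_plus[symmetric] add.commute simp del: ennreal_plus)
  also have "\<dots> = (abs_dev f S c) + (abs_dev f S d)"
    by (rule nn_integral_add) auto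
  finally show ?thesis .
qed

lemma nn_integral_recenter:
  fixes f :: "'a::euclidean_space \<Rightarrow> 'b::euclidean_space"
  assumes [measurable]: "f \<in> borel_measurable borel" "S \<in> sets borel"
  shows "(abs_dev f S c) \<le>
    (abs_dev f S d) + ennreal (norm (d - c)) * emeasure lborel S"
proof -
  have "(abs_dev f S c) \<le> (\<integral>\<^sup>+y. ennreal (norm (f y - d)) * indicator S y + ennreal (norm (d - c)) * indicator S y \<partial>lborel)"
    using norm_triangle_ineq[of "f y - d" "d - c" for y]
    by (intro nn_integral_mono) (auto simp: indicator_def ennreal_plus[symmetric] simp del: ennreal_plus)
  also have "\<dots> = (abs_dev f S d) + ennreal (norm (d - c)) * emeasure lborel S"
    by (subst nn_integral_add) (auto simp: nn_integral_cmult_indicator)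
  finally show ?thesis .
qed

text \<open>Centres for consecutive dyadic balls differ by at most
  \<open>2 * N * (1 + 2 ^ DIM('a))\<close>, because the smaller ball fills the fraction
  \<open>1 / 2 ^ DIM('a)\<close> of the larger. Telescoping gives growth linear in \<open>k\<close>,
  and \<open>k + 1\<close> includes the oscillation on the last ball itself.\<close>

lemma mean_osc_le_dyadic_balls:
  fixes f :: "'a::euclidean_space \<Rightarrow> 'b::euclidean_space"
  assumes f: "mean_osc_le f N" and N: "N > 0" and r: "r > 0"
    and c: "(abs_dev f (ball x r) c) \<le> ennreal (2 * N) * emeasure lborel (ball x r)"
  shows "(\<integral>\<^sup>+y\<in>ball x (2 ^ k * r). ennreal (norm (f y - c)) \<partial>lborel)
     \<le> ennreal (real (k + 1) * (2 * N * (1 + 2 ^ DIM('a)))) * emeasure lborel (ball x (2 ^ k * r))"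
proof -
  note [measurable] = mean_osc_le_measurable[OF f]
  define M where "M = 2 * N * (1 + 2 ^ DIM('a))"
  have M1: "2 * N \<le> M" using N by (simp add: M_def)
  have M: "2 * N \<le> M" "M > 0" using M1 N by linarith+
  define B where "B k = ball x (2 ^ k * r)" for k :: nat
  have Bm[measurable]: "B k \<in> sets borel" for k by (simp add: B_def)
  define b where "b k = measure lborel (B k)" for k
  have eb: "emeasure lborel (B k) = ennreal (b k)" for k
    by (simp add: b_def B_def emeasure_lborel_ball_eq_measure)
  have bp: "b k > 0" for k
    using content_ball_pos[of "2 ^ k * r" x] r by (simp add: b_def B_def)
  have bS: "b (Suc k) = 2 ^ DIM('a) * b k" for k
    using content_ball_conv_unit_ball[of "2 ^ Suc k * r" x] content_ball_conv_unit_ball[of "2 ^ k * r" x] r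
    by (simp add: b_def B_def power_mult_distrib)
  have "\<exists>d. (\<integral>\<^sup>+y\<in>B k. ennreal (norm (f y - d)) \<partial>lborel) \<le> ennreal (2 * N) * ennreal (b k)
     \<and> norm (d - c) \<le> real k * M" for k
  proof (induction k)
    case 0
    then show ?case using c eb[of 0] by (intro exI[of _ c]) (auto simp: B_def)
  next
    case (Suc k)
    then obtain d where d: "(\<integral>\<^sup>+y\<in>B k. ennreal (norm (f y - d)) \<partial>lborel) \<le> ennreal (2 * N) * ennreal (b k)"
      "norm (d - c) \<le> real k * M" by blast
    obtain d' where d': "(\<integral>\<^sup>+y\<in>B (Suc k). ennreal (norm (f y - d')) \<partial>lborel) \<le> ennreal (2 * N) * ennreal (b (Suc k))"
      using mean_osc_le_center[OF f N, of "2 ^ Suc k * r" x] r unfolding B_def[symmetric] eb by auto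
    have "ennreal (norm (d' - d)) * ennreal (b k) \<le>
       (\<integral>\<^sup>+y\<in>B k. ennreal (norm (f y - d')) \<partial>lborel) + (\<integral>\<^sup>+y\<in>B k. ennreal (norm (f y - d)) \<partial>lborel)"
      using norm_center_diff_le[of f "B k" d' d] by (simp add: eb)
    also have "(\<integral>\<^sup>+y\<in>B k. ennreal (norm (f y - d')) \<partial>lborel) \<le> (\<integral>\<^sup>+y\<in>B (Suc k). ennreal (norm (f y - d')) \<partial>lborel)"
      using r by (intro nn_set_integral_set_mono) (auto simp: B_def intro!: subset_ball)
    also note d'
    also note d(1)
    finally have "ennreal (norm (d' - d)) * ennreal (b k) \<le> ennreal (2 * N) * ennreal (b (Suc k)) + ennreal (2 * N) * ennreal (b k)"
      by (simp add: add_mono)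
    also have "\<dots> = ennreal (M * b k)"
      using N less_imp_le[OF bp] by (simp add: M_def bS ennreal_mult[symmetric] ennreal_plus[symmetric] algebra_simps del: ennreal_plus)
    finally have "norm (d' - d) * b k \<le> M * b k"
      using bp[of k] M by (simp add: ennreal_mult[symmetric])
    then have "norm (d' - d) \<le> M" using bp[of k] by simp
    then have "norm (d' - c) \<le> real (Suc k) * M"
      using d(2) norm_triangle_ineq[of "d' - d" "d - c"] by (simp add: algebra_simps)
    with d' show ?case by blast
  qed
  then obtain d where d: "(\<integral>\<^sup>+y\<in>B k. ennreal (norm (f y - d)) \<partial>lborel) \<le> ennreal (2 * N) * ennreal (b k)"
      "norm (d - c) \<le> real k * M" by blast
  have "(\<integral>\<^sup>+y\<in>B k. ennreal (norm (f y - c)) \<partial>lborel) \<le> (\<integral>\<^sup>+y\<in>B k. ennreal (norm (f y - d)) \<partial>lborel) + ennreal (norm (d - c)) * ennreal (b k)"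
    using nn_integral_recenter[of f "B k" c d] by (simp add: eb)
  also have "\<dots> \<le> ennreal (2 * N) * ennreal (b k) + ennreal (real k * M) * ennreal (b k)"
    by (intro add_mono d mult_right_mono ennreal_leI) auto
  also have "\<dots> \<le> ennreal (real (k + 1) * M) * ennreal (b k)"
  proof -
    have "2 * N * b k + real k * M * b k \<le> real (k + 1) * M * b k"
      using M bp[of k] by (simp add: algebra_simps)
    then show ?thesis
      using N M bp[of k] less_imp_le[OF bp[of k]]
      by (simp add: ennreal_mult[symmetric] ennreal_plus[symmetric] del: ennreal_plus)
  qed
  finally show ?thesis by (simp add: eb[symmetric] B_def M_def)
qed

lemma four_power_eq: "(4::real) ^ k = (2 ^ k)\<^sup>2"
proof -
  have "(4::real) ^ k = (2 * 2) ^ k" by simp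
  also have "\<dots> = 2 ^ k * 2 ^ k" by (rule power_mult_distrib)
  finally show ?thesis by (simp add: power2_eq_square)
qed

text \<open>The term with the least \<open>k\<close> such that \<open>z\<close> lies in the ball of
  radius \<open>2 ^ k * r\<close> already suffices. For \<open>k > 0\<close> the norm of
  \<open>z\<close> is at least \<open>2 ^ (k - 1) * r\<close>, which gives the exponent
  \<open>- 4 ^ k / 16\<close>; the summand 1 in the exponent covers \<open>k = 0\<close>, where no
  lower bound on the norm is available.\<close>

lemma heat_kernel_le_dyadic_sum:
  fixes z :: "'a::euclidean_space"
  assumes r: "r > 0"
  shows "ennreal (heat_kernel (r\<^sup>2) z) \<le>
    (\<Sum>k. ennreal (exp (1 - 4 ^ k / 16) / r ^ DIM('a)) * indicator (ball 0 (2 ^ k * r)) z)"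
proof -
  have ex: "\<exists>k. norm z < 2 ^ k * r"
  proof -
    obtain k where "norm z / r < 2 ^ k" using real_arch_pow[of 2 "norm z / r"] by auto
    then show ?thesis using r by (auto simp: field_simps)
  qed
  define k where "k = (LEAST k. norm z < 2 ^ k * r)"
  have k: "norm z < 2 ^ k * r" unfolding k_def using ex by (rule LeastI_ex)
  have e: "exp (- (norm z)\<^sup>2 / (4 * r\<^sup>2)) \<le> exp (1 - 4 ^ k / 16)"
  proof (cases k)
    case 0
    have "- (norm z)\<^sup>2 / (4 * r\<^sup>2) \<le> 0" by (simp add: divide_nonpos_nonneg)
    also have "0 \<le> 1 - 4 ^ k / (16::real)" using 0 by simp
    finally show ?thesis by (simp only: exp_le_cancel_iff)
  next
    case (Suc j)
    have "2 ^ j * r \<le> norm z"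
      using not_less_Least[of j "\<lambda>k. norm z < 2 ^ k * r"] Suc unfolding k_def by (simp add: not_less)
    then have "(2 ^ j * r)\<^sup>2 \<le> (norm z)\<^sup>2" using r by (intro power_mono) auto
    then have "4 ^ j * r\<^sup>2 \<le> (norm z)\<^sup>2" by (simp only: power_mult_distrib four_power_eq)
    then have "4 ^ j \<le> (norm z)\<^sup>2 / r\<^sup>2" using r by (simp only: pos_le_divide_eq zero_less_power)
    moreover have "(4::real) ^ k = 4 * 4 ^ j" using Suc by simp
    moreover have "- (norm z)\<^sup>2 / (4 * r\<^sup>2) = - ((norm z)\<^sup>2 / r\<^sup>2 / 4)" by simp
    ultimately show ?thesis unfolding exp_le_cancel_iff by linarith
  qed
  have "(4 * pi * r\<^sup>2) powr (- (real DIM('a) / 2)) \<le> (r\<^sup>2) powr (- (real DIM('a) / 2))"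
    using r pi_gt3 by (intro powr_mono2') (auto simp: mult_le_cancel_right1)
  also have "\<dots> = 1 / r ^ DIM('a)"
  proof -
    have "(r\<^sup>2) powr (- (real DIM('a) / 2)) = r powr (- real DIM('a))"
    proof -
      have "(r\<^sup>2) powr a = r powr (2 * a)" for a
        by (subst powr_powr[symmetric]) (use r in simp)
      from this[of "- (real DIM('a) / 2)"] show ?thesis by simp
    qed
    then show ?thesis by (simp only: powr_minus powr_realpow[OF r] inverse_eq_divide)
  qed
  finally have "heat_kernel (r\<^sup>2) z \<le> 1 / r ^ DIM('a) * exp (1 - 4 ^ k / 16)"
    unfolding heat_kernel_def by (intro mult_mono e) (use r in auto)
  then have "ennreal (heat_kernel (r\<^sup>2) z) \<le> (\<Sum>k\<in>{k}. ennreal (exp (1 - 4 ^ k / 16) / r ^ DIM('a)) * indicator (ball 0 (2 ^ k * r)) z)"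
    using k by (auto intro!: ennreal_leI)
  also have "\<dots> \<le> (\<Sum>k. ennreal (exp (1 - 4 ^ k / 16) / r ^ DIM('a)) * indicator (ball 0 (2 ^ k * r)) z)"
    by (rule sum_le_suminf) auto
  finally show ?thesis .
qed

text \<open>With \<open>w = 2 ^ k\<close> and \<open>k + 1 \<le> w\<close> the polynomial part is at
  most \<open>w ^ (n + 1)\<close>. The Gaussian in \<open>w\<close> absorbs
  \<open>w ^ (2 * (n + 2))\<close>, which leaves at least one spare factor \<open>1 / w\<close>, and
  that is the geometric decay.\<close>

lemma exp_dyadic_le:
  "exp (1 - 4 ^ k / 16) * (real (k + 1) * (2 ^ k) ^ n) \<le> exp 1 * fact (n + 2) * 16 ^ (n + 2) * (1 / 2) ^ k"
proof -
  define w :: real where "w = 2 ^ k"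
  have w: "w \<ge> 1" "w > 0" by (auto simp: w_def)
  have w4: "(4::real) ^ k = w\<^sup>2" by (simp only: w_def four_power_eq)
  have kw: "real (k + 1) \<le> w"
    unfolding w_def using less_exp[of k] by (metis Suc_eq_plus1 Suc_leI of_nat_le_iff of_nat_numeral of_nat_power)
  define P S F e where "P = w ^ (2 * (n + 2))" and "S = (16::real) ^ (n + 2)" and "F = (fact (n + 2) :: real)"
    and "e = exp (- (w\<^sup>2 / 16))"
  have S: "S > 0" by (simp add: S_def)
  have a: "(w\<^sup>2 / 16) ^ (n + 2) = P / S"
    by (simp only: power_divide power_mult P_def S_def)
  have "P / S * e \<le> F"
    unfolding e_def F_def a[symmetric] by (rule power_mult_exp_minus_le) auto
  then have 1: "P * e \<le> F * S"
    using S by (simp add: pos_divide_le_eq)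
  have "w * w ^ n * w = w ^ (n + 2)" by simp
  also have "\<dots> \<le> P" unfolding P_def using w by (intro power_increasing) auto
  finally have 2: "w * w ^ n \<le> P / w" using w by (simp only: pos_le_divide_eq)
  have "exp (1 - 4 ^ k / 16) = exp 1 * e"
    unfolding w4 e_def exp_add[symmetric] by (simp only: diff_conv_add_uminus)
  then have "exp (1 - 4 ^ k / 16) * (real (k + 1) * (2 ^ k) ^ n) = exp 1 * (e * (real (k + 1) * w ^ n))"
    by (simp only: w_def mult.assoc)
  also have "\<dots> \<le> exp 1 * (e * (w * w ^ n))"
    using w by (intro mult_left_mono mult_right_mono kw) (auto simp: e_def)
  also have "\<dots> \<le> exp 1 * (e * (P / w))"
    by (intro mult_left_mono 2) (auto simp: e_def)
  also have "e * (P / w) = (P * e) / w" by simp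
  also have "exp 1 * \<dots> \<le> exp 1 * (F * S / w)"
    using w by (intro mult_left_mono divide_right_mono 1) auto
  also have "\<dots> = exp 1 * F * S * (1 / 2) ^ k"
    by (simp add: w_def power_one_over)
  finally show ?thesis unfolding F_def S_def .
qed

text \<open>The first 2 is the sum of the geometric series, the next bracket is the constant of
  \<open>exp_dyadic_le\<close>, and the last one combines the growth of centres over dyadic balls
  with the volume of the unit ball.\<close>

definition heat_osc_const :: "'a::euclidean_space itself \<Rightarrow> real" where
  "heat_osc_const _ = 2 * (exp 1 * fact (DIM('a) + 2) * 16 ^ (DIM('a) + 2)) *
     (2 * (1 + 2 ^ DIM('a)) * measure lborel (ball (0::'a) 1))"

lemma heat_osc_const_pos: "heat_osc_const TYPE('a::euclidean_space) > 0"
  using measure_unit_ball_pos[where 'a='a] by (auto simp: heat_osc_const_def intro!: mult_pos_pos add_pos_pos)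

text \<open>Summed over dyadic balls, the weights of the kernel at time \<open>r^2\<close> decay
  faster than the volumes times the linearly growing oscillation can grow. The power of
  \<open>r\<close> in the volumes cancels the normalisation of the kernel, so the bound is
  independent of scale.\<close>

lemma heat_kernel_osc_le:
  fixes f :: "'a::euclidean_space \<Rightarrow> 'b::euclidean_space"
  assumes f: "mean_osc_le f N" and N: "N > 0" and r: "r > 0"
    and c: "(abs_dev f (ball x r) c) \<le> ennreal (2 * N) * emeasure lborel (ball x r)"
  shows "(abs_heat (\<lambda>y. f y - c) (r\<^sup>2) x)
     \<le> ennreal (heat_osc_const TYPE('a) * N)"
proof -
  note [measurable] = mean_osc_le_measurable[OF f]
  have [measurable]: "ball x R \<in> sets borel" for R by simp
  define E where "E = exp 1 * fact (DIM('a) + 2) * (16::real) ^ (DIM('a) + 2)"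
  define v where "v = measure lborel (ball (0::'a) 1)"
  define M where "M = 2 * N * (1 + 2 ^ DIM('a))"
  have "2 * N \<le> M" using N by (simp add: M_def)
  then have pos: "E \<ge> 0" "v > 0" "M > 0"
    using measure_unit_ball_pos[where 'a='a] N by (auto simp: E_def v_def)
  have "(abs_heat (\<lambda>y. f y - c) (r\<^sup>2) x) \<le>
     (\<integral>\<^sup>+y. (\<Sum>k. ennreal (exp (1 - 4 ^ k / 16) / r ^ DIM('a)) * indicator (ball 0 (2 ^ k * r)) (x - y)) * ennreal (norm (f y - c)) \<partial>lborel)"
    by (intro nn_integral_mono mult_right_mono heat_kernel_le_dyadic_sum r) auto
  also have "\<dots> = (\<integral>\<^sup>+y. (\<Sum>k. ennreal (exp (1 - 4 ^ k / 16) / r ^ DIM('a)) * (ennreal (norm (f y - c)) * indicator (ball x (2 ^ k * r)) y)) \<partial>lborel)"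
  proof (intro nn_integral_cong)
    fix y
    have "indicator (ball 0 (2 ^ k * r)) (x - y) = (indicator (ball x (2 ^ k * r)) y :: ennreal)" for k
      by (simp add: indicator_def dist_norm norm_minus_commute)
    then show "(\<Sum>k. ennreal (exp (1 - 4 ^ k / 16) / r ^ DIM('a)) * indicator (ball 0 (2 ^ k * r)) (x - y)) * ennreal (norm (f y - c)) =
      (\<Sum>k. ennreal (exp (1 - 4 ^ k / 16) / r ^ DIM('a)) * (ennreal (norm (f y - c)) * indicator (ball x (2 ^ k * r)) y))"
      by (simp only: ennreal_suminf_multc[symmetric] mult.assoc mult.commute[of "ennreal (norm (f y - c))"])
  qed
  also have "\<dots> = (\<Sum>k. ennreal (exp (1 - 4 ^ k / 16) / r ^ DIM('a)) * (\<integral>\<^sup>+y\<in>ball x (2 ^ k * r). ennreal (norm (f y - c)) \<partial>lborel))"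
    by (subst nn_integral_suminf) (auto simp: nn_integral_cmult)
  also have "\<dots> \<le> (\<Sum>k. ennreal (v * M * (E * (1 / 2) ^ k)))"
  proof (intro suminf_le allI)
    fix k
    have "ennreal (exp (1 - 4 ^ k / 16) / r ^ DIM('a)) * (\<integral>\<^sup>+y\<in>ball x (2 ^ k * r). ennreal (norm (f y - c)) \<partial>lborel)
      \<le> ennreal (exp (1 - 4 ^ k / 16) / r ^ DIM('a)) * (ennreal (real (k + 1) * M) * ennreal (v * (2 ^ k * r) ^ DIM('a)))"
      using mean_osc_le_dyadic_balls[OF f N r c, of k] r
      by (intro mult_left_mono) (auto simp: M_def v_def emeasure_ball_eq)
    also have "\<dots> = ennreal (v * M * (exp (1 - 4 ^ k / 16) * (real (k + 1) * (2 ^ k) ^ DIM('a))))"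
      using pos r by (simp add: ennreal_mult[symmetric] power_mult_distrib)
    also have "\<dots> \<le> ennreal (v * M * (E * (1 / 2) ^ k))"
      unfolding E_def using pos by (intro ennreal_leI mult_left_mono exp_dyadic_le) auto
    finally show "ennreal (exp (1 - 4 ^ k / 16) / r ^ DIM('a)) * (\<integral>\<^sup>+y\<in>ball x (2 ^ k * r). ennreal (norm (f y - c)) \<partial>lborel)
      \<le> ennreal (v * M * (E * (1 / 2) ^ k))" .
  qed auto
  also have "\<dots> = ennreal (v * M * (E * 2))"
  proof -
    have "(\<lambda>k. v * M * (E * (1 / 2) ^ k)) sums (v * M * (E * 2))"
      using geometric_sums[of "1/2::real"] by (intro sums_mult) simp
    then show ?thesis
      using pos by (intro suminf_ennreal_eq) auto
  qed
  also have "v * M * (E * 2) = heat_osc_const TYPE('a) * N"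
    by (simp add: heat_osc_const_def v_def M_def E_def)
  finally show ?thesis .
qed

section \<open>The John--Nirenberg inequality for continuous functions\<close>

text \<open>Half-open, so that bisecting all sides partitions a cube exactly and integrals add up
  without boundary corrections.\<close>

definition cube :: "'a::euclidean_space \<Rightarrow> real \<Rightarrow> 'a set" where
  "cube a s = {x. \<forall>i\<in>Basis. a \<bullet> i \<le> x \<bullet> i \<and> x \<bullet> i < a \<bullet> i + s}"

lemma cube_measurable [measurable]: "cube a s \<in> sets borel"
  unfolding cube_def by measurable

lemma emeasure_cube:
  assumes "s \<ge> 0"
  shows "emeasure lborel (cube (a::'a::euclidean_space) s) = ennreal (s ^ DIM('a))"
proof -
  have b: "(\<Prod>i\<in>Basis. (a + s *\<^sub>R One - a) \<bullet> i) = s ^ DIM('a)"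
    by (simp add: inner_simps)
  have le: "\<And>i. i \<in> Basis \<Longrightarrow> a \<bullet> i \<le> (a + s *\<^sub>R One) \<bullet> i"
    using assms by (simp add: inner_simps)
  have "emeasure lborel (box a (a + s *\<^sub>R One)) \<le> emeasure lborel (cube a s)"
    by (rule emeasure_mono) (auto simp: cube_def box_def inner_simps less_imp_le)
  moreover have "emeasure lborel (cube a s) \<le> emeasure lborel (cbox a (a + s *\<^sub>R One))"
    by (rule emeasure_mono) (auto simp: cube_def cbox_def inner_simps less_imp_le)
  ultimately show ?thesis
    using emeasure_lborel_box[OF le] emeasure_lborel_cbox[OF le] unfolding b by (simp add: antisym)
qed

text \<open>Children are indexed by subsets of the basis: \<open>S\<close> collects the coordinates
  in which the upper half is chosen, so each point determines its child.\<close>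

definition subcube_corner :: "'a::euclidean_space \<Rightarrow> real \<Rightarrow> 'a set \<Rightarrow> 'a" where
  "subcube_corner a s S = a + (\<Sum>i\<in>S. (s / 2) *\<^sub>R i)"

lemma mem_subcube_iff:
  fixes a :: "'a::euclidean_space"
  assumes S: "S \<subseteq> Basis" and s: "s > 0"
  shows "y \<in> cube (subcube_corner a s S) (s / 2) \<longleftrightarrow> y \<in> cube a s \<and> S = {i\<in>Basis. a \<bullet> i + s / 2 \<le> y \<bullet> i}"
proof -
  have c: "subcube_corner a s S \<bullet> i = a \<bullet> i + (if i \<in> S then s / 2 else 0)" if "i \<in> Basis" for i
  proof -
    have "finite S" using S by (rule finite_subset) simp
    then have "(\<Sum>j\<in>S. (s / 2) * (j \<bullet> i)) = (if i \<in> S then s / 2 else 0)"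
      using that S by (subst sum.cong[OF refl, of S _ "\<lambda>j. if i = j then s / 2 else 0"])
        (auto simp: inner_Basis subset_iff)
    then show ?thesis by (simp add: subcube_corner_def inner_simps inner_sum_left)
  qed
  have "y \<in> cube (subcube_corner a s S) (s / 2) \<longleftrightarrow>
    (\<forall>i\<in>Basis. a \<bullet> i \<le> y \<bullet> i \<and> y \<bullet> i < a \<bullet> i + s \<and> (i \<in> S \<longleftrightarrow> a \<bullet> i + s / 2 \<le> y \<bullet> i))"
  proof -
    have "(subcube_corner a s S \<bullet> i \<le> y \<bullet> i \<and> y \<bullet> i < subcube_corner a s S \<bullet> i + s / 2) \<longleftrightarrow>
      (a \<bullet> i \<le> y \<bullet> i \<and> y \<bullet> i < a \<bullet> i + s \<and> (i \<in> S \<longleftrightarrow> a \<bullet> i + s / 2 \<le> y \<bullet> i))" if "i \<in> Basis" for i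
      unfolding c[OF that] using s by (cases "i \<in> S") auto
    then show ?thesis unfolding cube_def by simp
  qed
  also have "\<dots> \<longleftrightarrow> y \<in> cube a s \<and> S = {i\<in>Basis. a \<bullet> i + s / 2 \<le> y \<bullet> i}"
    unfolding cube_def using S by auto
  finally show ?thesis .
qed

lemma nn_integral_subcubes:
  fixes a :: "'a::euclidean_space"
  assumes s: "s > 0" and [measurable]: "g \<in> borel_measurable borel"
  shows "(\<integral>\<^sup>+y\<in>cube a s. g y \<partial>lborel) = (\<Sum>S\<in>Pow Basis. (\<integral>\<^sup>+y\<in>cube (subcube_corner a s S) (s / 2). g y \<partial>lborel))"
proof -
  have "g y * indicator (cube a s) y = (\<Sum>S\<in>Pow Basis. g y * indicator (cube (subcube_corner a s S) (s / 2)) y)" for y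
  proof -
    have "(\<Sum>S\<in>Pow Basis. g y * indicator (cube (subcube_corner a s S) (s / 2)) y) =
      (\<Sum>S\<in>Pow (Basis::'a set). if {i\<in>Basis. a \<bullet> i + s / 2 \<le> y \<bullet> i} = S then g y * indicator (cube a s) y else 0)"
      using s by (intro sum.cong) (auto simp: mem_subcube_iff indicator_def)
    then show ?thesis by (simp add: sum.delta')
  qed
  then have "(\<integral>\<^sup>+y\<in>cube a s. g y \<partial>lborel) = (\<integral>\<^sup>+y. (\<Sum>S\<in>Pow Basis. g y * indicator (cube (subcube_corner a s S) (s / 2)) y) \<partial>lborel)"
    by (intro nn_integral_cong)
  also have "\<dots> = (\<Sum>S\<in>Pow Basis. (\<integral>\<^sup>+y\<in>cube (subcube_corner a s S) (s / 2). g y \<partial>lborel))"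
    by (rule nn_integral_sum) auto
  finally show ?thesis .
qed

lemma subcube_subset:
  fixes a :: "'a::euclidean_space"
  assumes "s > 0" "S \<subseteq> Basis"
  shows "cube (subcube_corner a s S) (s / 2) \<subseteq> cube a s"
  using assms by (auto simp: mem_subcube_iff)

lemma cube_subset_ball:
  fixes a :: "'a::euclidean_space"
  assumes "s > 0"
  shows "cube a s \<subseteq> ball a ((real DIM('a) + 1) * s)"
proof
  fix y assume y: "y \<in> cube a s"
  have "norm (y - a) \<le> (\<Sum>i\<in>Basis. \<bar>(y - a) \<bullet> i\<bar>)" by (rule norm_le_l1)
  also have "\<dots> \<le> (\<Sum>i\<in>(Basis::'a set). s)"
    using y by (intro sum_mono) (auto simp: cube_def inner_simps)
  also have "\<dots> < (real DIM('a) + 1) * s" using assms by (simp add: algebra_simps)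
  finally show "y \<in> ball a ((real DIM('a) + 1) * s)" by (simp add: dist_norm norm_minus_commute)
qed

lemma ball_subset_cube:
  fixes x :: "'a::euclidean_space"
  assumes "r > 0"
  shows "ball x r \<subseteq> cube (x - r *\<^sub>R One) (2 * r)"
proof
  fix y assume "y \<in> ball x r"
  then have "\<bar>(y - x) \<bullet> i\<bar> < r" if "i \<in> Basis" for i
    using Basis_le_norm[OF that, of "y - x"] by (simp add: dist_norm norm_minus_commute)
  then show "y \<in> cube (x - r *\<^sub>R One) (2 * r)"
    by (fastforce simp: cube_def inner_simps abs_less_iff)
qed

lemma nn_integral_recenter_sq:
  fixes f :: "'a::euclidean_space \<Rightarrow> 'b::euclidean_space"
  assumes [measurable]: "f \<in> borel_measurable borel" "S \<in> sets borel"
  shows "(sq_dev f S c) \<le>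
    2 * (sq_dev f S d) + ennreal (2 * (norm (d - c))\<^sup>2) * emeasure lborel S"
proof -
  have le: "(norm (f y - c))\<^sup>2 \<le> 2 * (norm (f y - d))\<^sup>2 + 2 * (norm (d - c))\<^sup>2" for y
  proof -
    have "(norm (f y - c))\<^sup>2 \<le> (norm (f y - d) + norm (d - c))\<^sup>2"
      using norm_triangle_ineq[of "f y - d" "d - c"] by (intro power_mono) auto
    also have "\<dots> \<le> 2 * (norm (f y - d))\<^sup>2 + 2 * (norm (d - c))\<^sup>2"
      using zero_le_power2[of "norm (f y - d) - norm (d - c)"] by (simp add: power2_sum power2_diff)
    finally show ?thesis .
  qed
  have "(sq_dev f S c) \<le>
    (\<integral>\<^sup>+y. 2 * (ennreal ((norm (f y - d))\<^sup>2) * indicator S y) + ennreal (2 * (norm (d - c))\<^sup>2) * indicator S y \<partial>lborel)"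
  proof (intro nn_integral_mono)
    fix y
    have "ennreal ((norm (f y - c))\<^sup>2) \<le> 2 * ennreal ((norm (f y - d))\<^sup>2) + ennreal (2 * (norm (d - c))\<^sup>2)"
      using ennreal_leI[OF le[of y]] by (simp add: ennreal_mult)
    then show "ennreal ((norm (f y - c))\<^sup>2) * indicator S y \<le>
      2 * (ennreal ((norm (f y - d))\<^sup>2) * indicator S y) + ennreal (2 * (norm (d - c))\<^sup>2) * indicator S y"
      by (simp add: indicator_def)
  qed
  also have "\<dots> = 2 * (sq_dev f S d) + ennreal (2 * (norm (d - c))\<^sup>2) * emeasure lborel S"
    by (subst nn_integral_add) (auto simp: nn_integral_cmult nn_integral_cmult_indicator)
  finally show ?thesis .
qed

lemma norm_center_diff_real_le:
  fixes f :: "'a::euclidean_space \<Rightarrow> 'b::euclidean_space"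
  assumes [measurable]: "f \<in> borel_measurable borel" "S \<in> sets borel"
    and b: "emeasure lborel S = ennreal b" "b > 0" and uv: "u \<ge> 0" "v \<ge> 0"
    and c: "(abs_dev f S c) \<le> ennreal (u * b)"
    and d: "(abs_dev f S d) \<le> ennreal (v * b)"
  shows "norm (c - d) \<le> u + v"
proof -
  have "ennreal (norm (c - d) * b) \<le> ennreal (u * b) + ennreal (v * b)"
    using order_trans[OF norm_center_diff_le[of f S c d] add_mono[OF c d]] b
    by (simp add: ennreal_mult)
  also have "\<dots> = ennreal ((u + v) * b)"
    using b uv by (simp add: ennreal_plus[symmetric] distrib_right del: ennreal_plus)
  finally have "norm (c - d) * b \<le> (u + v) * b"
    using b uv by (simp add: ennreal_le_iff)
  then show ?thesis using b by simp
qed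

text \<open>The Calderon--Zygmund stopping argument as an induction on the number of bisections: a subcube on which
  the mean of \<open>|f - c|\<close> exceeds \<open>h\<close> for the first time is not subdivided further.\<close>

lemma stopping_cubes:
  fixes f :: "'a::euclidean_space \<Rightarrow> 'b::euclidean_space"
  assumes [measurable]: "f \<in> borel_measurable borel"
    and pos: "h > 0" "\<delta> > 0" "N > 0" "A \<ge> 0"
    and osc: "\<And>a s. 0 < s \<Longrightarrow> s \<le> \<eta> \<Longrightarrow> cube a s \<subseteq> D \<Longrightarrow> \<forall>x\<in>cube a s. \<forall>y\<in>cube a s. norm (f x - f y) \<le> \<delta>"
    and center: "\<And>a s. 0 < s \<Longrightarrow> cube a s \<subseteq> D \<Longrightarrow> \<exists>c. (abs_dev f (cube a s) c) \<le> ennreal (N * s ^ DIM('a))"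
    and A: "\<And>a s c. 0 < s \<Longrightarrow> cube a s \<subseteq> D \<Longrightarrow> (abs_dev f (cube a s) c) \<le> ennreal (N * s ^ DIM('a)) \<Longrightarrow>
       (sq_dev f (cube a s) c) \<le> ennreal (A * s ^ DIM('a))"
    and s: "0 < s" "s \<le> \<eta> * 2 ^ k" "cube a s \<subseteq> D"
    and c: "(abs_dev f (cube a s) c) \<le> ennreal (h * s ^ DIM('a))"
  shows "(sq_dev f (cube a s) c) \<le> ennreal ((h + \<delta>)\<^sup>2 * s ^ DIM('a)) +
    ennreal ((2 * A + 2 * (2 ^ DIM('a) * h + N)\<^sup>2) / h) * (abs_dev f (cube a s) c)"
  using s c
proof (induction k arbitrary: a s)
  case 0
  then have s: "s > 0" and sub: "cube a s \<subseteq> D" and "s \<le> \<eta>" by auto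
  have eb: "emeasure lborel (cube a s) = ennreal (s ^ DIM('a))" using s by (simp add: emeasure_cube)
  \<comment> \<open>At this scale all values on the cube agree up to \<open>\<delta>\<close>, so the
    bound \<open>h\<close> on the mean becomes a pointwise one.\<close>
  have "norm (f x - c) \<le> h + \<delta>" if x: "x \<in> cube a s" for x
  proof -
    have "norm (c - f x) \<le> h + \<delta>"
    proof (rule norm_center_diff_real_le[OF _ _ eb])
      have "(abs_dev f (cube a s) (f x)) \<le> (\<integral>\<^sup>+y\<in>cube a s. ennreal \<delta> \<partial>lborel)"
        using osc[OF s \<open>s \<le> \<eta>\<close> sub] x by (intro nn_integral_mono) (auto simp: indicator_def intro!: ennreal_leI)
      also have "\<dots> = ennreal (\<delta> * s ^ DIM('a))"
        using pos s by (simp add: nn_integral_cmult_indicator eb ennreal_mult)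
      finally show "(abs_dev f (cube a s) (f x)) \<le> ennreal (\<delta> * s ^ DIM('a))" .
    qed (use pos s 0 in auto)
    then show ?thesis by (simp add: norm_minus_commute)
  qed
  then have "(sq_dev f (cube a s) c) \<le> (\<integral>\<^sup>+y\<in>cube a s. ennreal ((h + \<delta>)\<^sup>2) \<partial>lborel)"
    by (intro nn_integral_mono) (auto simp: indicator_def intro!: ennreal_leI power_mono)
  also have "\<dots> = ennreal ((h + \<delta>)\<^sup>2 * s ^ DIM('a))"
    using s by (simp add: nn_integral_cmult_indicator eb ennreal_mult)
  finally show ?case by (rule order_trans) simp
next
  case (Suc k)
  then have s: "s > 0" and sub: "cube a s \<subseteq> D" by auto
  define K where "K = (2 * A + 2 * (2 ^ DIM('a) * h + N)\<^sup>2) / h"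
  define t where "t = s / 2"
  define Q where "Q S = cube (subcube_corner a s S) t" for S
  have t: "t > 0" "t \<le> \<eta> * 2 ^ k" using s Suc.prems by (auto simp: t_def)
  have tn: "s ^ DIM('a) = 2 ^ DIM('a) * t ^ DIM('a)" by (simp add: t_def power_divide)
  have Qs: "Q S \<subseteq> cube a s" if "S \<in> Pow Basis" for S
    using subcube_subset[OF s, of S a] that by (simp add: Q_def t_def)
  have split: "(\<integral>\<^sup>+y\<in>cube a s. g y \<partial>lborel) = (\<Sum>S\<in>Pow Basis. (\<integral>\<^sup>+y\<in>Q S. g y \<partial>lborel))"
    if "g \<in> borel_measurable borel" for g
    using nn_integral_subcubes[OF s that, of a] by (simp add: Q_def t_def)
  have child: "(sq_dev f (Q S) c) \<le> ennreal ((h + \<delta>)\<^sup>2 * t ^ DIM('a)) +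
      ennreal K * (abs_dev f (Q S) c)" if S: "S \<in> Pow Basis" for S
  proof (cases "(abs_dev f (Q S) c) \<le> ennreal (h * t ^ DIM('a))")
    case True
    then show ?thesis
      unfolding K_def Q_def using t Qs[OF S] sub
      by (intro Suc.IH) (auto simp: Q_def)
  next
    case False
    \<comment> \<open>A stopped child: comparison with the parent bounds the mean of
      \<open>norm (f y - c)\<close> over it by \<open>2 ^ DIM('a) * h\<close>. Replacing
      \<open>c\<close> by a centre of the child is therefore a bounded move, and the a priori bound
      \<open>A\<close> applies to that centre.\<close>
    have sub': "Q S \<subseteq> D" using Qs[OF S] sub by blast
    have [measurable]: "Q S \<in> sets borel" by (simp add: Q_def)
    have eb: "emeasure lborel (Q S) = ennreal (t ^ DIM('a))" using t by (simp add: emeasure_cube Q_def)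
    obtain c' where c': "(abs_dev f (Q S) c') \<le> ennreal (N * t ^ DIM('a))"
      using center[of t] t sub' unfolding Q_def by blast
    have "(abs_dev f (Q S) c) \<le> (abs_dev f (cube a s) c)"
      using Qs[OF S] by (intro nn_set_integral_set_mono)
    also have "\<dots> \<le> ennreal (2 ^ DIM('a) * h * t ^ DIM('a))"
      using Suc.prems(4) by (simp add: tn ac_simps)
    finally have "norm (c' - c) \<le> N + 2 ^ DIM('a) * h"
      using t pos by (intro norm_center_diff_real_le[OF _ _ eb _ _ _ c']) auto
    then have cc: "(norm (c' - c))\<^sup>2 \<le> (2 ^ DIM('a) * h + N)\<^sup>2"
      by (intro power_mono) auto
    have "(sq_dev f (Q S) c) \<le>
      2 * (sq_dev f (Q S) c') + ennreal (2 * (norm (c' - c))\<^sup>2) * ennreal (t ^ DIM('a))"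
      using nn_integral_recenter_sq[of f "Q S" c c'] by (simp add: eb)
    also have "\<dots> \<le> 2 * ennreal (A * t ^ DIM('a)) + ennreal (2 * (2 ^ DIM('a) * h + N)\<^sup>2) * ennreal (t ^ DIM('a))"
      using A[of t "subcube_corner a s S" c'] t sub' c' cc
      by (intro add_mono mult_left_mono mult_right_mono ennreal_leI) (auto simp: Q_def)
    also have "\<dots> = ennreal (2 * (A * t ^ DIM('a)) + 2 * (2 ^ DIM('a) * h + N)\<^sup>2 * t ^ DIM('a))"
      using pos t by (simp add: ennreal_mult ennreal_plus)
    also have "2 * (A * t ^ DIM('a)) + 2 * (2 ^ DIM('a) * h + N)\<^sup>2 * t ^ DIM('a) = K * (h * t ^ DIM('a))"
    proof -
      have "K * h = 2 * A + 2 * (2 ^ DIM('a) * h + N)\<^sup>2" using pos by (simp add: K_def)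
      then have "K * h * t ^ DIM('a) = (2 * A + 2 * (2 ^ DIM('a) * h + N)\<^sup>2) * t ^ DIM('a)" by simp
      then show ?thesis by (simp only: distrib_right mult.assoc)
    qed
    also have "ennreal (K * (h * t ^ DIM('a))) = ennreal K * ennreal (h * t ^ DIM('a))"
      using pos t by (intro ennreal_mult) (auto simp: K_def)
    \<comment> \<open>The stopping condition: the mean over the child exceeds \<open>h\<close>, so
      \<open>h\<close> times its volume is paid for by its share of the deviation integral. These
      shares add up to the integral over the parent.\<close>
    also have "\<dots> \<le> ennreal K * (abs_dev f (Q S) c)"
      using False by (intro mult_left_mono) auto
    finally show ?thesis by (rule order_trans) simp
  qed
  have "(sq_dev f (cube a s) c) = (\<Sum>S\<in>Pow Basis. (sq_dev f (Q S) c))"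
    by (rule split) measurable
  also have "\<dots> \<le> (\<Sum>S\<in>Pow (Basis::'a set). ennreal ((h + \<delta>)\<^sup>2 * t ^ DIM('a)) + ennreal K * (abs_dev f (Q S) c))"
    by (intro sum_mono child)
  also have "\<dots> = ennreal ((h + \<delta>)\<^sup>2 * s ^ DIM('a)) + ennreal K * (abs_dev f (cube a s) c)"
  proof -
    have "(\<Sum>S\<in>Pow (Basis::'a set). ennreal ((h + \<delta>)\<^sup>2 * t ^ DIM('a))) = ennreal (\<Sum>S\<in>Pow (Basis::'a set). (h + \<delta>)\<^sup>2 * t ^ DIM('a))"
      using t by (intro sum_ennreal) auto
    also have "(\<Sum>S\<in>Pow (Basis::'a set). (h + \<delta>)\<^sup>2 * t ^ DIM('a)) = (h + \<delta>)\<^sup>2 * s ^ DIM('a)"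
      by (simp add: card_Pow tn)
    finally show ?thesis
      by (subst split) (simp_all add: sum.distrib sum_distrib_left)
  qed
  finally show ?case by (simp add: K_def)
qed

text \<open>The threshold \<open>h = 4 * N\<close> makes the contribution of \<open>A\<close> equal
  to \<open>2 * A * N / h = A / 2\<close>. With \<open>\<delta> = N\<close> the cubes that are never
  stopped give \<open>(4 * N + N)^2 = 25 * N^2\<close>.\<close>

lemma cube_sq_bound_improve:
  fixes f :: "'a::euclidean_space \<Rightarrow> 'b::euclidean_space"
  assumes [measurable]: "f \<in> borel_measurable borel"
    and pos: "N > 0" "A \<ge> 0" "\<eta> > 0"
    and osc: "\<And>a s. 0 < s \<Longrightarrow> s \<le> \<eta> \<Longrightarrow> cube a s \<subseteq> D \<Longrightarrow> \<forall>x\<in>cube a s. \<forall>y\<in>cube a s. norm (f x - f y) \<le> N"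
    and center: "\<And>a s. 0 < s \<Longrightarrow> cube a s \<subseteq> D \<Longrightarrow> \<exists>c. (abs_dev f (cube a s) c) \<le> ennreal (N * s ^ DIM('a))"
    and A: "\<And>a s c. 0 < s \<Longrightarrow> cube a s \<subseteq> D \<Longrightarrow> (abs_dev f (cube a s) c) \<le> ennreal (N * s ^ DIM('a)) \<Longrightarrow>
       (sq_dev f (cube a s) c) \<le> ennreal (A * s ^ DIM('a))"
    and s: "0 < s" "cube a s \<subseteq> D"
    and c: "(abs_dev f (cube a s) c) \<le> ennreal (N * s ^ DIM('a))"
  shows "(sq_dev f (cube a s) c) \<le>
    ennreal ((A / 2 + (25 + (4 * 2 ^ DIM('a) + 1)\<^sup>2 / 2) * N\<^sup>2) * s ^ DIM('a))"
proof -
  define K where "K = (2 * A + 2 * (2 ^ DIM('a) * (4 * N) + N)\<^sup>2) / (4 * N)"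
  have K: "K \<ge> 0" using pos by (simp add: K_def)
  obtain k where "s / \<eta> < 2 ^ k" using real_arch_pow[of 2 "s / \<eta>"] by auto
  then have k: "s \<le> \<eta> * 2 ^ k" using pos by (simp add: pos_divide_less_eq mult.commute)
  have c4: "(abs_dev f (cube a s) c) \<le> ennreal (4 * N * s ^ DIM('a))"
    using s pos by (intro order_trans[OF c] ennreal_leI mult_right_mono) auto
  have "(sq_dev f (cube a s) c) \<le> ennreal ((4 * N + N)\<^sup>2 * s ^ DIM('a)) +
    ennreal K * (abs_dev f (cube a s) c)"
    unfolding K_def
    by (rule stopping_cubes[where \<eta>=\<eta> and k=k and D=D and N=N, OF assms(1) _ _ _ _ osc center A s(1) k s(2) c4])
      (use pos in auto)
  also have "\<dots> \<le> ennreal ((4 * N + N)\<^sup>2 * s ^ DIM('a)) + ennreal K * ennreal (N * s ^ DIM('a))"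
    by (intro add_left_mono mult_left_mono c) auto
  also have "\<dots> = ennreal ((4 * N + N)\<^sup>2 * s ^ DIM('a) + K * (N * s ^ DIM('a)))"
    using K s pos by (simp add: ennreal_mult ennreal_plus)
  also have "(4 * N + N)\<^sup>2 * s ^ DIM('a) + K * (N * s ^ DIM('a)) = (A / 2 + (25 + (4 * 2 ^ DIM('a) + 1)\<^sup>2 / 2) * N\<^sup>2) * s ^ DIM('a)"
  proof -
    have "K * N = A / 2 + (2 ^ DIM('a) * (4 * N) + N)\<^sup>2 / 2"
      using pos by (simp add: K_def add_divide_distrib distrib_right)
    moreover have "(2 ^ DIM('a) * (4 * N) + N)\<^sup>2 = (4 * 2 ^ DIM('a) + 1)\<^sup>2 * N\<^sup>2"
      by (simp only: power_mult_distrib[symmetric]) (simp add: algebra_simps)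
    ultimately have "K * N = A / 2 + (4 * 2 ^ DIM('a) + 1)\<^sup>2 / 2 * N\<^sup>2" by simp
    moreover have "(4 * N + N)\<^sup>2 * v + K * (N * v) = (25 * N\<^sup>2 + K * N) * v" for v
      by (simp add: power2_eq_square algebra_simps)
    ultimately show ?thesis by (simp add: distrib_right)
  qed
  finally show ?thesis .
qed

text \<open>Boundedness of \<open>f\<close> supplies some finite starting value \<open>A0\<close>,
  and iterating the passage from \<open>A\<close> to \<open>A / 2 + L\<close> leaves
  \<open>A0 / 2 ^ j + 2 * L\<close>. For large \<open>j\<close> the first term is below
  \<open>L\<close>, so \<open>M\<close> and \<open>\<eta>\<close> disappear from the bound.\<close>

lemma cube_sq_bound:
  fixes f :: "'a::euclidean_space \<Rightarrow> 'b::euclidean_space"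
  assumes [measurable]: "f \<in> borel_measurable borel"
    and N: "N > 0" and \<eta>: "\<eta> > 0"
    and bounded: "\<And>x. x \<in> D \<Longrightarrow> norm (f x) \<le> M"
    and osc: "\<And>a s. 0 < s \<Longrightarrow> s \<le> \<eta> \<Longrightarrow> cube a s \<subseteq> D \<Longrightarrow> \<forall>x\<in>cube a s. \<forall>y\<in>cube a s. norm (f x - f y) \<le> N"
    and center: "\<And>a s. 0 < s \<Longrightarrow> cube a s \<subseteq> D \<Longrightarrow> \<exists>c. (abs_dev f (cube a s) c) \<le> ennreal (N * s ^ DIM('a))"
    and s: "0 < s" "cube a s \<subseteq> D"
    and c: "(abs_dev f (cube a s) c) \<le> ennreal (N * s ^ DIM('a))"
  shows "(sq_dev f (cube a s) c) \<le>
    ennreal (3 * (25 + (4 * 2 ^ DIM('a) + 1)\<^sup>2 / 2) * N\<^sup>2 * s ^ DIM('a))"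
proof -
  define L where "L = (25 + (4 * 2 ^ DIM('a) + 1)\<^sup>2 / 2) * N\<^sup>2"
  have L: "L > 0" using N by (auto simp: L_def intro!: mult_pos_pos add_pos_nonneg)
  have M: "M \<ge> 0"
  proof -
    have "a \<in> cube a s" using s by (simp add: cube_def)
    then have "norm (f a) \<le> M" using s bounded by blast
    then show ?thesis using norm_ge_zero[of "f a"] by linarith
  qed
  define A0 where "A0 = (2 * M + N)\<^sup>2"
  define P where "P A \<longleftrightarrow> (\<forall>a s c. 0 < s \<longrightarrow> cube a s \<subseteq> D \<longrightarrow> (abs_dev f (cube a s) c) \<le> ennreal (N * s ^ DIM('a)) \<longrightarrow>
       (sq_dev f (cube a s) c) \<le> ennreal (A * s ^ DIM('a)))" for A
  have P0: "P A0"
    unfolding P_def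
  proof (intro allI impI)
    fix a s c assume s: "0 < s" and sub: "cube a s \<subseteq> D"
      and c: "(abs_dev f (cube a s) c) \<le> ennreal (N * s ^ DIM('a))"
    have eb: "emeasure lborel (cube a s) = ennreal (s ^ DIM('a))" using s by (simp add: emeasure_cube)
    \<comment> \<open>On the cube 0 is also a centre, with deviation at most \<open>M\<close>;
      comparing the two centres bounds \<open>c\<close> itself.\<close>
    have "norm (c - 0) \<le> N + M"
    proof (rule norm_center_diff_real_le[OF _ _ eb _ _ _ c])
      have "(abs_dev f (cube a s) 0) \<le> (\<integral>\<^sup>+y\<in>cube a s. ennreal M \<partial>lborel)"
        using bounded sub by (intro nn_integral_mono) (auto simp: indicator_def intro!: ennreal_leI)
      also have "\<dots> = ennreal (M * s ^ DIM('a))"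
        using M s by (simp add: nn_integral_cmult_indicator eb ennreal_mult)
      finally show "(abs_dev f (cube a s) 0) \<le> ennreal (M * s ^ DIM('a))" .
    qed (use s N M in auto)
    then have "norm (f x - c) \<le> 2 * M + N" if "x \<in> cube a s" for x
      using bounded[of x] that sub norm_triangle_ineq4[of "f x" c] by auto
    then have "(sq_dev f (cube a s) c) \<le> (\<integral>\<^sup>+y\<in>cube a s. ennreal A0 \<partial>lborel)"
      unfolding A0_def by (intro nn_integral_mono) (auto simp: indicator_def intro!: ennreal_leI power_mono)
    also have "\<dots> = ennreal (A0 * s ^ DIM('a))"
      using s by (simp add: nn_integral_cmult_indicator eb ennreal_mult A0_def)
    finally show "(sq_dev f (cube a s) c) \<le> ennreal (A0 * s ^ DIM('a))" .
  qed
  have step: "P (A / 2 + L)" if "P A" "A \<ge> 0" for A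
    unfolding P_def
  proof (intro allI impI)
    fix a s c assume s: "0 < s" "cube a s \<subseteq> D"
      and c: "(abs_dev f (cube a s) c) \<le> ennreal (N * s ^ DIM('a))"
    show "(sq_dev f (cube a s) c) \<le> ennreal ((A / 2 + L) * s ^ DIM('a))"
      unfolding L_def
      by (rule cube_sq_bound_improve[OF assms(1) N that(2) \<eta> osc center _ s c]) (use that(1) in \<open>auto simp: P_def\<close>)
  qed
  have A0: "A0 \<ge> 0" by (simp add: A0_def)
  have iter: "P (A0 / 2 ^ j + 2 * L)" for j
  proof (induction j)
    case 0
    have "P A \<Longrightarrow> A \<le> A' \<Longrightarrow> P A'" for A A'
      unfolding P_def by (meson ennreal_leI mult_right_mono order_trans zero_le_power less_imp_le)
    from this[OF P0, of "A0 / 2 ^ 0 + 2 * L"] show ?case using L by simp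
  next
    case (Suc j)
    have "P ((A0 / 2 ^ j + 2 * L) / 2 + L)"
      using A0 L by (intro step Suc) auto
    then show ?case by (simp add: field_simps)
  qed
  obtain j where "A0 / L < 2 ^ j" using real_arch_pow[of 2 "A0 / L"] by auto
  then have "A0 / 2 ^ j \<le> L" using L by (simp add: field_simps)
  then have "A0 / 2 ^ j + 2 * L \<le> 3 * L" by simp
  moreover have "(sq_dev f (cube a s) c) \<le> ennreal ((A0 / 2 ^ j + 2 * L) * s ^ DIM('a))"
    using iter[of j] s c unfolding P_def by blast
  ultimately have "(sq_dev f (cube a s) c) \<le> ennreal (3 * L * s ^ DIM('a))"
    using s by (meson ennreal_leI mult_right_mono order_trans zero_le_power less_imp_le)
  then show ?thesis by (simp only: L_def mult.assoc)
qed

lemma john_nirenberg_continuous: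
  "\<exists>C>0. \<forall>(f::'a::euclidean_space \<Rightarrow> 'b::euclidean_space) N x r c. continuous_on UNIV f \<longrightarrow> mean_osc_le f N \<longrightarrow> N > 0 \<longrightarrow> r > 0 \<longrightarrow>
     (abs_dev f (ball x r) c) \<le> ennreal (2 * N) * emeasure lborel (ball x r) \<longrightarrow>
     (sq_dev f (ball x r) c) \<le> ennreal (C * N\<^sup>2) * emeasure lborel (ball x r)"
proof -
  define n where "n = DIM('a)"
  define v where "v = measure lborel (ball (0::'a) 1)"
  \<comment> \<open>\<open>\<kappa> * N\<close> bounds the mean oscillation on cubes:
    \<open>2 * N\<close> times the volume ratio between the ball of radius
    \<open>(n + 1) * s\<close> and the cube of side \<open>s\<close> inside it. In \<open>C\<close>,
    the quotient \<open>2 ^ n / v\<close> is the volume ratio between a cube and the ball it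
    encloses, and the second summand comes from moving the centre of the cube back to
    \<open>c\<close>.\<close>
  define \<kappa> where "\<kappa> = 2 * v * (real n + 1) ^ n"
  define L where "L = 3 * (25 + (4 * 2 ^ n + 1)\<^sup>2 / (2::real)) * \<kappa>\<^sup>2"
  define C where "C = 2 * (L * 2 ^ n / v) + 2 * (2 + \<kappa> * 2 ^ n / v)\<^sup>2"
  have v: "v > 0" using measure_unit_ball_pos[where 'a='a] by (simp add: v_def)
  then have \<kappa>: "\<kappa> > 0" by (auto simp: \<kappa>_def intro!: mult_pos_pos)
  have L: "L > 0" using \<kappa> by (auto simp: L_def intro!: mult_pos_pos add_pos_nonneg)
  have C: "C > 0" using L v by (auto simp: C_def intro!: add_pos_nonneg)
  have "(sq_dev f (ball x r) c) \<le> ennreal (C * N\<^sup>2) * emeasure lborel (ball x r)"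
    if cont: "continuous_on UNIV f" and f: "mean_osc_le f N" and N: "N > 0" and r: "r > 0"
     and c: "(abs_dev f (ball x r) c) \<le> ennreal (2 * N) * emeasure lborel (ball x r)"
    for f :: "'a \<Rightarrow> 'b" and N x r c
  proof -
    note fm[measurable] = mean_osc_le_measurable[OF f]
    have [measurable]: "ball x r \<in> sets borel" by simp
    define a s where "a = x - r *\<^sub>R One" and "s = 2 * r"
    define D where "D = cube a s"
    have s: "s > 0" using r by (simp add: s_def)
    define b where "b = v * r ^ n"
    have b: "emeasure lborel (ball x r) = ennreal b" "b > 0"
      using r v by (auto simp: b_def v_def n_def emeasure_ball_eq)
    have sb: "s ^ n = 2 ^ n / v * b" using v by (simp add: s_def b_def power_mult_distrib)
    have N': "\<kappa> * N > 0" using \<kappa> N by simp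
    have center: "\<exists>c. (abs_dev f (cube a s) c) \<le> ennreal (\<kappa> * N * s ^ DIM('a))" if s: "0 < s" for a s
    proof -
      let ?R = "(real DIM('a) + 1) * s"
      have R: "?R > 0" using s by (intro mult_pos_pos) auto
      obtain c where c: "(abs_dev f (ball a ?R) c) \<le> ennreal (2 * N) * emeasure lborel (ball a ?R)"
        using mean_osc_le_center[OF f N R] by blast
      have "(abs_dev f (cube a s) c) \<le> (abs_dev f (ball a ?R) c)"
        using cube_subset_ball[OF s] by (intro nn_set_integral_set_mono)
      also note c
      also have "ennreal (2 * N) * emeasure lborel (ball a ?R) = ennreal (2 * N * (v * ?R ^ n))"
        using R N v by (simp add: emeasure_ball_eq v_def n_def ennreal_mult)
      also have "2 * N * (v * ?R ^ n) = \<kappa> * N * s ^ DIM('a)"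
        by (simp add: \<kappa>_def n_def power_mult_distrib)
      finally show ?thesis by blast
    qed
    have "D \<subseteq> cball a ((real DIM('a) + 1) * s)"
      using cube_subset_ball[OF s, of a] ball_subset_cball unfolding D_def by blast
    moreover define B where "B = cball a ((real DIM('a) + 1) * s)"
    ultimately have QB: "D \<subseteq> B" "compact B" by auto
    have contB: "continuous_on B f" using cont by (rule continuous_on_subset) simp
    obtain M where M: "\<And>x. x \<in> D \<Longrightarrow> norm (f x) \<le> M"
      using compact_imp_bounded[OF compact_continuous_image[OF contB QB(2)]] QB(1)
      unfolding bounded_iff by blast
    have "uniformly_continuous_on B f" by (rule compact_uniformly_continuous[OF contB QB(2)])
    then obtain d where d: "d > 0" "\<And>x y. x \<in> B \<Longrightarrow> y \<in> B \<Longrightarrow> dist y x < d \<Longrightarrow> dist (f y) (f x) < \<kappa> * N"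
      using N' unfolding uniformly_continuous_on_def by metis
    \<comment> \<open>Two points of a cube of side \<open>s\<close> are closer than
      \<open>2 * (DIM('a) + 1) * s\<close>, so sides up to \<open>\<eta>\<close> keep them within
      the modulus \<open>d\<close> of uniform continuity.\<close>
    define \<eta> where "\<eta> = d / (2 * (real DIM('a) + 1))"
    have \<eta>: "\<eta> > 0" using d by (simp add: \<eta>_def add_nonneg_pos)
    have osc: "\<forall>x\<in>cube a s. \<forall>y\<in>cube a s. norm (f x - f y) \<le> \<kappa> * N"
      if s: "0 < s" "s \<le> \<eta>" and sub: "cube a s \<subseteq> D" for a s
    proof (intro ballI)
      fix x y assume xy: "x \<in> cube a s" "y \<in> cube a s"
      have "dist a x < (real DIM('a) + 1) * s" "dist a y < (real DIM('a) + 1) * s"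
        using xy cube_subset_ball[OF s(1), of a] by auto
      then have "dist x y < 2 * (real DIM('a) + 1) * s"
        using dist_triangle3[of x y a] by linarith
      also have "\<dots> \<le> 2 * (real DIM('a) + 1) * \<eta>" using s by (intro mult_left_mono) auto
      also have "\<dots> = d" by (simp add: \<eta>_def)
      finally have "dist (f x) (f y) < \<kappa> * N" using xy sub QB(1) by (intro d(2)) auto
      then show "norm (f x - f y) \<le> \<kappa> * N" by (simp add: dist_norm)
    qed
    obtain c' where c': "(abs_dev f (cube a s) c') \<le> ennreal (\<kappa> * N * s ^ DIM('a))"
      using center[OF s] by blast
    have sub: "ball x r \<subseteq> cube a s" unfolding a_def s_def by (rule ball_subset_cube[OF r])
    have "(sq_dev f (ball x r) c') \<le> (sq_dev f (cube a s) c')"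
      using sub by (intro nn_set_integral_set_mono)
    also have "\<dots> \<le> ennreal (3 * (25 + (4 * 2 ^ DIM('a) + 1)\<^sup>2 / 2) * (\<kappa> * N)\<^sup>2 * s ^ DIM('a))"
      by (rule cube_sq_bound[where D=D, OF fm N' \<eta> M osc center s _ c']) (auto simp: D_def)
    also have "3 * (25 + (4 * 2 ^ DIM('a) + 1)\<^sup>2 / 2) * (\<kappa> * N)\<^sup>2 * s ^ DIM('a) = (L * 2 ^ n / v) * N\<^sup>2 * b"
      using sb by (simp add: L_def n_def power_mult_distrib)
    finally have sq: "(sq_dev f (ball x r) c') \<le> ennreal ((L * 2 ^ n / v) * N\<^sup>2 * b)" .
    have "norm (c - c') \<le> 2 * N + \<kappa> * N * (2 ^ n / v)"
    proof (rule norm_center_diff_real_le[OF fm _ b])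
      show "(abs_dev f (ball x r) c) \<le> ennreal (2 * N * b)"
        using c N b by (simp add: b(1) ennreal_mult)
      have "(abs_dev f (ball x r) c') \<le> (abs_dev f (cube a s) c')"
        using sub by (intro nn_set_integral_set_mono)
      also note c'
      also have "\<kappa> * N * s ^ DIM('a) = \<kappa> * N * (2 ^ n / v) * b" using sb by (simp add: n_def)
      finally show "(abs_dev f (ball x r) c') \<le> ennreal (\<kappa> * N * (2 ^ n / v) * b)" .
    qed (use N N' v in auto)
    also have "\<dots> = (2 + \<kappa> * 2 ^ n / v) * N" by (simp add: algebra_simps)
    finally have "(norm (c' - c))\<^sup>2 \<le> ((2 + \<kappa> * 2 ^ n / v) * N)\<^sup>2"
      by (intro power_mono) (auto simp: norm_minus_commute)
    then have cc: "(norm (c' - c))\<^sup>2 \<le> (2 + \<kappa> * 2 ^ n / v)\<^sup>2 * N\<^sup>2"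
      by (simp add: power_mult_distrib)
    have "(sq_dev f (ball x r) c) \<le>
      2 * (sq_dev f (ball x r) c') + ennreal (2 * (norm (c' - c))\<^sup>2) * ennreal b"
      using nn_integral_recenter_sq[of f "ball x r" c c'] by (simp add: b)
    also have "\<dots> \<le> 2 * ennreal ((L * 2 ^ n / v) * N\<^sup>2 * b) + ennreal (2 * ((2 + \<kappa> * 2 ^ n / v)\<^sup>2 * N\<^sup>2)) * ennreal b"
      by (intro add_mono mult_left_mono mult_right_mono sq ennreal_leI cc) auto
    also have "\<dots> = ennreal (2 * ((L * 2 ^ n / v) * N\<^sup>2 * b) + 2 * ((2 + \<kappa> * 2 ^ n / v)\<^sup>2 * N\<^sup>2) * b)"
    proof -
      have "2 * ennreal p + ennreal (2 * q) * ennreal b = ennreal (2 * p + 2 * q * b)" if "p \<ge> 0" "q \<ge> 0" for p q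
        using that b(2) by (simp add: ennreal_mult ennreal_plus)
      then show ?thesis using L v b(2) by (meson less_imp_le mult_nonneg_nonneg divide_nonneg_pos zero_le_power2 zero_le_power zero_le_numeral)
    qed
    also have "2 * ((L * 2 ^ n / v) * N\<^sup>2 * b) + 2 * ((2 + \<kappa> * 2 ^ n / v)\<^sup>2 * N\<^sup>2) * b = C * N\<^sup>2 * b"
      by (simp add: C_def algebra_simps)
    also have "ennreal (C * N\<^sup>2 * b) = ennreal (C * N\<^sup>2) * emeasure lborel (ball x r)"
      using C b by (simp add: ennreal_mult)
    finally show ?thesis .
  qed
  with C show ?thesis by blast
qed

section \<open>Square integrability of the square function\<close>

text \<open>Monotone convergence along \<open>{1 / (i + 2)..i + 2}\<close>, where the shift by 2
  keeps the intervals nondegenerate. Integrals over all positive times are thus reduced to compact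
  time intervals, on which the fundamental theorem of calculus or a fixed smoothing time is
  available.\<close>

lemma nn_integral_Ioi_le:
  fixes g :: "real \<Rightarrow> ennreal"
  assumes [measurable]: "g \<in> borel_measurable borel"
    and le: "\<And>a b. 0 < a \<Longrightarrow> a < b \<Longrightarrow> (\<integral>\<^sup>+t\<in>{a..b}. g t \<partial>lborel) \<le> K"
  shows "(\<integral>\<^sup>+t\<in>{0<..}. g t \<partial>lborel) \<le> K"
proof -
  define S where "S i = {1 / (real i + 2)..real i + 2}" for i :: nat
  have inc: "incseq S"
  proof (rule incseq_SucI)
    fix i
    have "1 / (real (Suc i) + 2) \<le> 1 / (real i + 2)" by (intro divide_left_mono) auto
    then show "S i \<subseteq> S (Suc i)" by (auto simp: S_def)
  qed
  have U: "(\<Union>i. S i) = {0<..}"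
  proof (intro equalityI subsetI)
    fix t :: real assume "t \<in> {0<..}"
    then have t: "t > 0" by simp
    obtain i :: nat where i: "max t (1 / t) < real i" using reals_Archimedean2 by blast
    have "1 / t \<le> real i + 2" "t \<le> real i + 2" using i by auto
    then have "t \<in> S i" using t by (auto simp: S_def field_simps)
    then show "t \<in> (\<Union>i. S i)" by blast
  next
    fix t assume "t \<in> (\<Union>i. S i)"
    then obtain i where "1 / (real i + 2) \<le> t" by (auto simp: S_def)
    moreover have "0 < 1 / (real i + 2)" by simp
    ultimately have "0 < t" by linarith
    then show "t \<in> {0<..}" by simp
  qed
  have "(SUP i. emeasure (density lborel g) (S i)) = emeasure (density lborel g) (\<Union>i. S i)"
    by (rule SUP_emeasure_incseq[OF _ inc]) (auto simp: S_def)
  moreover have "emeasure (density lborel g) (S i) \<le> K" for i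
  proof -
    have "1 / (real i + 2) < 1" "1 < real i + 2" by auto
    then have "1 / (real i + 2) < real i + 2" by linarith
    then have "(\<integral>\<^sup>+t\<in>S i. g t \<partial>lborel) \<le> K" unfolding S_def by (intro le) auto
    then show ?thesis by (subst emeasure_density) (auto simp: S_def)
  qed
  ultimately have "emeasure (density lborel g) {0<..} \<le> K"
    by (simp add: U[symmetric]) (metis SUP_least)
  then show ?thesis by (subst (asm) emeasure_density) auto
qed

lemma heat_kernel_le_diag:
  fixes z :: "'a::euclidean_space"
  assumes "t > 0"
  shows "heat_kernel t z \<le> (4 * pi * t) powr (- (real DIM('a) / 2))"
  unfolding heat_kernel_def using assms by (intro mult_left_le) auto

definition heat_energy_kernel :: "real \<Rightarrow> 'a::euclidean_space \<Rightarrow> real" where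
  "heat_energy_kernel t z = t * heat_kernel_dt (2 * t) z / 2 - heat_kernel (2 * t) z / 4"

lemma has_field_derivative_heat_energy_kernel:
  assumes "t > 0"
  shows "((\<lambda>t. heat_energy_kernel t z) has_field_derivative t * heat_kernel_dtt (2 * t) z) (at t)"
proof -
  have 1: "((\<lambda>t. heat_kernel (2 * t) z) has_field_derivative heat_kernel_dt (2 * t) z * 2) (at t)"
    using assms by (intro DERIV_chain2[OF has_field_derivative_heat_kernel]) (auto intro!: derivative_eq_intros)
  have 2: "((\<lambda>t. heat_kernel_dt (2 * t) z) has_field_derivative heat_kernel_dtt (2 * t) z * 2) (at t)"
    using assms by (intro DERIV_chain2[OF has_field_derivative_heat_kernel_dt]) (auto intro!: derivative_eq_intros)
  show ?thesis
    unfolding heat_energy_kernel_def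
    by (rule DERIV_cong[OF DERIV_diff[OF DERIV_cdivide[OF DERIV_mult[OF DERIV_ident 2]] DERIV_cdivide[OF 1]]])
      (simp add: field_simps)
qed

lemma nn_integral_abs_heat_kernel_dt_le:
  assumes "t > 0"
  shows "(\<integral>\<^sup>+y. ennreal \<bar>heat_kernel_dt t (x - y::'a::euclidean_space)\<bar> \<partial>lborel)
    \<le> ennreal ((2 + real DIM('a) / 2) * 2 powr (real DIM('a) / 2) / t)"
proof -
  define c where "c = (2 + real DIM('a) / 2) * 2 powr (real DIM('a) / 2) / t"
  have c: "c \<ge> 0" using assms by (simp add: c_def)
  have "\<bar>heat_kernel_dt t (x - y)\<bar> \<le> c * heat_kernel (2 * t) (x - y)" for y
    unfolding c_def by (rule abs_heat_kernel_dt_le[OF assms])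
  then have "(\<integral>\<^sup>+y. ennreal \<bar>heat_kernel_dt t (x - y)\<bar> \<partial>lborel) \<le>
    (\<integral>\<^sup>+y. ennreal c * ennreal (heat_kernel (2 * t) (x - y)) \<partial>lborel)"
    using c by (intro nn_integral_mono) (simp add: ennreal_mult[symmetric] ennreal_leI)
  also have "\<dots> = ennreal c"
    using assms by (subst nn_integral_cmult) auto
  finally show ?thesis by (simp add: c_def)
qed

lemma nn_integral_abs_heat_energy_kernel_le:
  assumes t: "t > 0"
  shows "(\<integral>\<^sup>+y. ennreal \<bar>heat_energy_kernel t (x - y::'a::euclidean_space)\<bar> \<partial>lborel)
    \<le> ennreal ((2 + real DIM('a) / 2) * 2 powr (real DIM('a) / 2) + 1)"
proof -
  define c where "c = (2 + real DIM('a) / 2) * 2 powr (real DIM('a) / 2)"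
  have c: "c \<ge> 0" by (simp add: c_def)
  have "(\<integral>\<^sup>+y. ennreal \<bar>heat_energy_kernel t (x - y)\<bar> \<partial>lborel) \<le>
    (\<integral>\<^sup>+y. ennreal t * ennreal \<bar>heat_kernel_dt (2 * t) (x - y)\<bar> + ennreal (heat_kernel (2 * t) (x - y)) \<partial>lborel)"
  proof (intro nn_integral_mono)
    fix y :: 'a
    have "\<bar>heat_energy_kernel t (x - y)\<bar> \<le> \<bar>t * heat_kernel_dt (2 * t) (x - y) / 2\<bar> + \<bar>heat_kernel (2 * t) (x - y) / 4\<bar>"
      unfolding heat_energy_kernel_def by (rule abs_triangle_ineq4)
    also have "\<dots> \<le> t * \<bar>heat_kernel_dt (2 * t) (x - y)\<bar> + heat_kernel (2 * t) (x - y)"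
      using t by (intro add_mono) (auto simp: abs_mult)
    finally show "ennreal \<bar>heat_energy_kernel t (x - y)\<bar> \<le> ennreal t * ennreal \<bar>heat_kernel_dt (2 * t) (x - y)\<bar> + ennreal (heat_kernel (2 * t) (x - y))"
      using t by (simp add: ennreal_mult[symmetric] ennreal_plus[symmetric] del: ennreal_plus)
  qed
  also have "\<dots> = ennreal t * (\<integral>\<^sup>+y. ennreal \<bar>heat_kernel_dt (2 * t) (x - y)\<bar> \<partial>lborel) + 1"
    using t by (subst nn_integral_add) (auto simp: nn_integral_cmult)
  also have "\<dots> \<le> ennreal t * ennreal (c / (2 * t)) + 1"
    using nn_integral_abs_heat_kernel_dt_le[of "2 * t" x] t by (intro add_right_mono mult_left_mono) (auto simp: c_def)
  also have "\<dots> = ennreal (c / 2) + ennreal 1"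
    using t c by (simp add: ennreal_mult[symmetric])
  also have "\<dots> = ennreal (c / 2 + 1)" using c by (subst ennreal_plus) auto
  also have "\<dots> \<le> ennreal (c + 1)" using c by (intro ennreal_leI) auto
  finally show ?thesis by (simp add: c_def)
qed

lemma integrable_lborel_pair_bounded:
  fixes g :: "'a::euclidean_space \<times> 'b::euclidean_space \<Rightarrow> real"
  assumes [measurable]: "g \<in> borel_measurable borel"
    and bound: "\<And>p. \<bar>g p\<bar> \<le> M" and supp: "\<And>p. p \<notin> S \<Longrightarrow> g p = 0" and S: "bounded S" "S \<in> sets borel"
  shows "integrable lborel g"
proof (rule Bochner_Integration.integrable_bound[where f="\<lambda>p. M * indicator S p"])
  have "emeasure lborel S < \<infinity>" using S by (intro emeasure_bounded_finite)
  then show "integrable lborel (\<lambda>p. M * indicator S p)"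
    using S by (intro integrable_mult_right integrable_real_indicator) auto
  have "M \<ge> 0" using bound[of undefined] by linarith
  then show "AE p in lborel. norm (g p) \<le> norm (M * indicator S p)"
    using bound supp by (intro AE_I2) (auto simp: indicator_def)
qed simp

lemma heat_kernel_dt_bounded:
  assumes "t > 0"
  shows "\<exists>B. \<forall>z::'a::euclidean_space. \<bar>heat_kernel_dt t z\<bar> \<le> B"
proof -
  let ?C = "(2 + real DIM('a) / 2) * 2 powr (real DIM('a) / 2) / t"
  have "\<bar>heat_kernel_dt t z\<bar> \<le> ?C * (4 * pi * (2 * t)) powr (- (real DIM('a) / 2))" for z :: 'a
  proof -
    have "?C * heat_kernel (2 * t) z \<le> ?C * (4 * pi * (2 * t)) powr (- (real DIM('a) / 2))"
      using assms by (intro mult_left_mono heat_kernel_le_diag) auto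
    then show ?thesis using abs_heat_kernel_dt_le[OF assms, of z] by linarith
  qed
  then show ?thesis by blast
qed

lemma fst_snd_measurable: "fst \<in> borel_measurable (borel :: ('a::euclidean_space \<times> 'b::euclidean_space) measure)" "snd \<in> borel_measurable (borel :: ('a \<times> 'b) measure)"
  by (simp_all add: borel_prod[symmetric])

section \<open>Energy identity for bounded functions with bounded support\<close>

context
  fixes h :: "'a::euclidean_space \<Rightarrow> 'b::euclidean_space" and M :: real and S :: "'a set"
  assumes hm[measurable]: "h \<in> borel_measurable borel"
    and hM: "\<And>y. norm (h y) \<le> M" and hS: "\<And>y. y \<notin> S \<Longrightarrow> h y = 0"
    and S: "bounded S" and Sm[measurable]: "S \<in> sets borel"
begin

text \<open>Squared norms of \<open>heat_dt\<close> become linear in this function of pairs. It is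
  bounded with bounded support, which justifies the exchanges of integrals and derivatives, while
  \<open>M\<close> and \<open>S\<close> are absent from the final estimate.\<close>

definition pair_corr :: "'a \<times> 'a \<Rightarrow> real" where
  "pair_corr p = h (fst p) \<bullet> h (snd p)"

lemma norm_bound_nonneg: "M \<ge> 0"
  using hM[of undefined] norm_ge_zero[of "h undefined"] by linarith

lemma pair_corr_measurable [measurable]: "pair_corr \<in> borel_measurable borel"
proof -
  have "pair_corr \<in> borel_measurable (borel \<Otimes>\<^sub>M borel)" unfolding pair_corr_def by measurable
  then show ?thesis by (simp add: borel_prod)
qed

lemma abs_pair_corr_le: "\<bar>pair_corr p\<bar> \<le> norm (h (fst p)) * norm (h (snd p))"
  unfolding pair_corr_def by (rule Cauchy_Schwarz_ineq2)

lemma integrable_kernel_pair_corr: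
  assumes [measurable]: "k \<in> borel_measurable borel" and k: "\<And>p. \<bar>k p\<bar> \<le> B"
  shows "integrable lborel (\<lambda>p. k p * pair_corr p)"
proof (rule integrable_lborel_pair_bounded)
  show "bounded (S \<times> S)" using S by (intro bounded_Times)
  show "S \<times> S \<in> sets borel" by (simp add: borel_prod[symmetric])
  show "p \<notin> S \<times> S \<Longrightarrow> k p * pair_corr p = 0" for p
    using hS[of "fst p"] hS[of "snd p"] by (cases p) (auto simp: pair_corr_def)
  show "\<bar>k p * pair_corr p\<bar> \<le> B * (M * M)" for p
  proof -
    have "\<bar>pair_corr p\<bar> \<le> M * M"
      using abs_pair_corr_le[of p] hM[of "fst p"] hM[of "snd p"] norm_bound_nonneg by (meson mult_mono norm_ge_zero order_trans)
    moreover have "B \<ge> 0" using k[of p] by linarith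
    ultimately show ?thesis using k[of p] unfolding abs_mult by (intro mult_mono) auto
  qed
qed simp

lemma gauss_integrable_bounded_support: "gauss_integrable h"
  unfolding gauss_integrable_def
proof (intro conjI allI impI hm)
  fix t :: real and x :: 'a assume "t > 0"
  show "integrable lborel (\<lambda>y. heat_kernel t (x - y) *\<^sub>R h y)"
  proof (rule Bochner_Integration.integrable_bound[of lborel "\<lambda>y. M * heat_kernel t (x - y)"])
    show "AE y in lborel. norm (heat_kernel t (x - y) *\<^sub>R h y) \<le> norm (M * heat_kernel t (x - y))"
    proof (rule AE_I2)
      fix y
      have "heat_kernel t (x - y) * norm (h y) \<le> heat_kernel t (x - y) * M" by (intro mult_left_mono hM) auto
      then show "norm (heat_kernel t (x - y) *\<^sub>R h y) \<le> norm (M * heat_kernel t (x - y))"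
        using norm_bound_nonneg by (simp add: mult.commute)
    qed
  qed (use \<open>t > 0\<close> in \<open>auto simp: integrable_heat_kernel\<close>)
qed

lemma norm_sq_heat_dt:
  assumes t: "t > 0"
  shows "(norm (heat_dt t h x))\<^sup>2 = (LINT p|lborel. heat_kernel_dt t (x - fst p) * heat_kernel_dt t (x - snd p) * pair_corr p)"
proof -
  define F where "F y = heat_kernel_dt t (x - y) *\<^sub>R h y" for y
  have intF: "integrable lborel F"
    unfolding F_def by (rule integrable_heat_kernel_dt[OF gauss_integrable_bounded_support t])
  obtain B where B: "\<And>z::'a. \<bar>heat_kernel_dt t z\<bar> \<le> B" using heat_kernel_dt_bounded[OF t] by blast
  have B0: "B \<ge> 0" using B[of 0] by linarith
  have int: "integrable lborel (\<lambda>p. heat_kernel_dt t (x - fst p) * heat_kernel_dt t (x - snd p) * pair_corr p)"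
  proof (rule integrable_kernel_pair_corr[where B="B * B"])
    have "(\<lambda>p. heat_kernel_dt t (x - fst p) * heat_kernel_dt t (x - snd p)) \<in> borel_measurable (borel \<Otimes>\<^sub>M borel)"
      by measurable
    then show "(\<lambda>p. heat_kernel_dt t (x - fst p) * heat_kernel_dt t (x - snd p)) \<in> borel_measurable borel"
      by (simp add: borel_prod)
    show "\<bar>heat_kernel_dt t (x - fst p) * heat_kernel_dt t (x - snd p)\<bar> \<le> B * B" for p
      unfolding abs_mult using B B0 by (intro mult_mono) auto
  qed
  have "(norm (heat_dt t h x))\<^sup>2 = (LINT y|lborel. F y) \<bullet> (LINT z|lborel. F z)"
    by (simp add: power2_norm_eq_inner heat_dt_def F_def)
  also have "\<dots> = (LINT y|lborel. F y \<bullet> (LINT z|lborel. F z))"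
    using intF by (simp add: integral_inner_left)
  also have "\<dots> = (LINT y|lborel. LINT z|lborel. F y \<bullet> F z)"
    using intF by (simp add: integral_inner_right)
  also have "\<dots> = (LINT p|(lborel \<Otimes>\<^sub>M lborel). heat_kernel_dt t (x - fst p) * heat_kernel_dt t (x - snd p) * pair_corr p)"
    using lborel_pair.integral_fst'[of "\<lambda>p. heat_kernel_dt t (x - fst p) * heat_kernel_dt t (x - snd p) * pair_corr p"] int
    by (simp add: lborel_prod F_def pair_corr_def mult.assoc mult.left_commute)
  finally show ?thesis by (simp add: lborel_prod)
qed

text \<open>After expanding the square, integrating over \<open>x\<close> first merges the two
  kernels into one second derivative at time \<open>2 * t\<close>; this takes the place of
  Plancherel's theorem. Absolute convergence holds because one kernel is bounded and the other
  integrable in \<open>x\<close>.\<close>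

lemma integral_norm_sq_heat_dt:
  assumes t: "t > 0"
  shows "integrable lborel (\<lambda>x. (norm (heat_dt t h x))\<^sup>2)"
    and "(LINT x|lborel. (norm (heat_dt t h x))\<^sup>2) = (LINT p|lborel. heat_kernel_dtt (2 * t) (fst p - snd p) * pair_corr p)"
proof -
  define G where "G x p = heat_kernel_dt t (x - fst p) * heat_kernel_dt t (x - snd p) * pair_corr p" for x :: 'a and p
  obtain B where B: "\<And>z::'a. \<bar>heat_kernel_dt t z\<bar> \<le> B" using heat_kernel_dt_bounded[OF t] by blast
  have B0: "B \<ge> 0" using B[of 0] by linarith
  define c where "c = (2 + real DIM('a) / 2) * 2 powr (real DIM('a) / 2) / t"
  have [measurable]: "fst \<in> borel_measurable (borel :: ('a \<times> 'a) measure)" "snd \<in> borel_measurable (borel :: ('a \<times> 'a) measure)"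
    by (simp_all add: borel_prod[symmetric])
  have Gm[measurable]: "(\<lambda>(x, p). G x p) \<in> borel_measurable (borel \<Otimes>\<^sub>M borel)"
    unfolding G_def by measurable
  have "(\<integral>\<^sup>+w. norm (case w of (x, p) \<Rightarrow> G x p) \<partial>(lborel \<Otimes>\<^sub>M lborel)) = (\<integral>\<^sup>+p. \<integral>\<^sup>+x. norm (G x p) \<partial>lborel \<partial>lborel)"
    by (subst lborel_pair.nn_integral_snd[symmetric]) auto
  also have "\<dots> \<le> (\<integral>\<^sup>+p. ennreal c * ennreal (norm (B * pair_corr p)) \<partial>lborel)"
  proof (intro nn_integral_mono)
    fix p :: "'a \<times> 'a"
    have "(\<integral>\<^sup>+x. norm (G x p) \<partial>lborel) \<le> (\<integral>\<^sup>+x. ennreal \<bar>heat_kernel_dt t (fst p - x)\<bar> * ennreal (norm (B * pair_corr p)) \<partial>lborel)"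
    proof (intro nn_integral_mono)
      fix x
      have "\<bar>heat_kernel_dt t (x - fst p)\<bar> * (\<bar>heat_kernel_dt t (x - snd p)\<bar> * \<bar>pair_corr p\<bar>) \<le> \<bar>heat_kernel_dt t (x - fst p)\<bar> * (B * \<bar>pair_corr p\<bar>)"
        using B by (intro mult_left_mono mult_right_mono) auto
      then show "ennreal (norm (G x p)) \<le> ennreal \<bar>heat_kernel_dt t (fst p - x)\<bar> * ennreal (norm (B * pair_corr p))"
        using B0 by (simp add: ennreal_mult[symmetric] G_def abs_mult mult.assoc heat_kernel_commute(2)[of t "fst p"] ennreal_leI)
    qed
    also have "\<dots> = (\<integral>\<^sup>+x. ennreal \<bar>heat_kernel_dt t (fst p - x)\<bar> \<partial>lborel) * ennreal (norm (B * pair_corr p))"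
      by (rule nn_integral_multc) auto
    also have "\<dots> \<le> ennreal c * ennreal (norm (B * pair_corr p))"
      unfolding c_def using t by (intro mult_right_mono nn_integral_abs_heat_kernel_dt_le) auto
    finally show "(\<integral>\<^sup>+x. norm (G x p) \<partial>lborel) \<le> ennreal c * ennreal (norm (B * pair_corr p))" .
  qed
  also have "\<dots> = ennreal c * (\<integral>\<^sup>+p. ennreal (norm (B * pair_corr p)) \<partial>lborel)"
    by (rule nn_integral_cmult) auto
  also have "\<dots> < \<infinity>"
    using integrable_kernel_pair_corr[of "\<lambda>_. B" B] B0 unfolding integrable_iff_bounded by (simp add: ennreal_mult_less_top)
  finally have int: "integrable (lborel \<Otimes>\<^sub>M lborel) (\<lambda>(x, p). G x p)"
    by (intro integrableI_bounded) auto
  have eq: "(norm (heat_dt t h x))\<^sup>2 = (LINT p|lborel. G x p)" for x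
    unfolding G_def by (rule norm_sq_heat_dt[OF t])
  show "integrable lborel (\<lambda>x. (norm (heat_dt t h x))\<^sup>2)"
    unfolding eq using lborel_pair.integrable_fst[OF int] by simp
  have "(LINT x|lborel. (norm (heat_dt t h x))\<^sup>2) = (LINT p|lborel. LINT x|lborel. G x p)"
    unfolding eq by (rule lborel_pair.Fubini_integral[OF int, symmetric])
  also have "\<dots> = (LINT p|lborel. heat_kernel_dtt (2 * t) (fst p - snd p) * pair_corr p)"
  proof (rule Bochner_Integration.integral_cong)
    fix p :: "'a \<times> 'a"
    have "(LINT x|lborel. G x p) = (LINT x|lborel. heat_kernel_dt t (fst p - x) * heat_kernel_dt t (x - snd p)) * pair_corr p"
      by (simp add: G_def heat_kernel_commute(2)[of t "fst p"])
    then show "(LINT x|lborel. G x p) = heat_kernel_dtt (2 * t) (fst p - snd p) * pair_corr p"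
      using integral_heat_kernel_dt_mult_dt[OF t t, of "fst p" "snd p"] by simp
  qed simp
  finally show "(LINT x|lborel. (norm (heat_dt t h x))\<^sup>2) = (LINT p|lborel. heat_kernel_dtt (2 * t) (fst p - snd p) * pair_corr p)" .
qed

definition energy :: "real \<Rightarrow> real" where
  "energy t = (LINT p|lborel. heat_energy_kernel t (fst p - snd p) * pair_corr p)"

text \<open>The kernel of \<open>energy\<close> is a primitive in time, so the weighted squared norm
  is an exact time derivative. A uniform bound on the differentiated kernel for \<open>s\<close>
  near \<open>t\<close> is a sufficient majorant because \<open>pair_corr\<close> is
  integrable.\<close>

lemma has_real_derivative_energy:
  assumes t: "t > 0"
  shows "(energy has_real_derivative t * (LINT x|lborel. (norm (heat_dt t h x))\<^sup>2)) (at t)"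
proof -
  note [measurable] = fst_snd_measurable
  define G where "G = (12 + (real DIM('a) / 2)\<^sup>2 + real DIM('a) / 2) * 2 powr (real DIM('a) / 2) / (2 * t) * (8 * pi * t) powr (- (real DIM('a) / 2))"
  have bound: "\<bar>s * heat_kernel_dtt (2 * s) z\<bar> \<le> G" if "\<bar>s - t\<bar> < t / 2" for s and z :: 'a
  proof -
    have s: "s > t / 2" using that by linarith
    define c where "c = (12 + (real DIM('a) / 2)\<^sup>2 + real DIM('a) / 2) * 2 powr (real DIM('a) / 2)"
    have c: "c \<ge> 0" by (simp add: c_def)
    have "\<bar>s * heat_kernel_dtt (2 * s) z\<bar> \<le> s * (c / (2 * s)\<^sup>2 * heat_kernel (2 * (2 * s)) z)"
      using s t abs_heat_kernel_dtt_le[of "2 * s" z] unfolding abs_mult by (intro mult_mono) (auto simp: c_def)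
    also have "\<dots> \<le> s * (c / (2 * s)\<^sup>2 * (4 * pi * (2 * (2 * s))) powr (- (real DIM('a) / 2)))"
      using s t c by (intro mult_left_mono heat_kernel_le_diag) auto
    also have "\<dots> = c / (4 * s) * (16 * pi * s) powr (- (real DIM('a) / 2))"
      using s t by (simp add: power2_eq_square mult.assoc)
    also have "\<dots> \<le> c / (2 * t) * (8 * pi * t) powr (- (real DIM('a) / 2))"
      using s t c by (intro mult_mono[OF divide_left_mono powr_mono2']) auto
    finally show ?thesis by (simp add: G_def c_def)
  qed
  have "((\<lambda>s. LINT p|lborel. heat_energy_kernel s (fst p - snd p) *\<^sub>R pair_corr p) has_vector_derivative
      (LINT p|lborel. (t * heat_kernel_dtt (2 * t) (fst p - snd p)) *\<^sub>R pair_corr p)) (at t)"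
  proof (rule has_vector_derivative_kernel_integral[where d="t / 2" and G="\<lambda>_. G" and k'="\<lambda>s p. s * heat_kernel_dtt (2 * s) (fst p - snd p)"])
    fix s assume st: "\<bar>s - t\<bar> < t / 2"
    then have s: "s > 0" using t by linarith
    obtain B where B: "\<And>z::'a. \<bar>heat_kernel_dt (2 * s) z\<bar> \<le> B" using heat_kernel_dt_bounded[of "2 * s"] s by auto
    have "integrable lborel (\<lambda>p. heat_energy_kernel s (fst p - snd p) * pair_corr p)"
    proof (rule integrable_kernel_pair_corr)
      show "(\<lambda>p. heat_energy_kernel s (fst p - snd p::'a)) \<in> borel_measurable borel"
        unfolding heat_energy_kernel_def by measurable
      show "\<bar>heat_energy_kernel s (fst p - snd p)\<bar> \<le> s * B + (4 * pi * (2 * s)) powr (- (real DIM('a) / 2))" for p :: "'a \<times> 'a"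
      proof -
        have "\<bar>s * heat_kernel_dt (2 * s) (fst p - snd p) / 2\<bar> \<le> s * B"
          using s B[of "fst p - snd p"] mult_left_mono[OF B[of "fst p - snd p"], of s] by (simp add: abs_mult)
        moreover have "\<bar>heat_kernel (2 * s) (fst p - snd p) / 4\<bar> \<le> (4 * pi * (2 * s)) powr (- (real DIM('a) / 2))"
          using heat_kernel_le_diag[of "2 * s" "fst p - snd p"] s heat_kernel_nonneg[of "2 * s" "fst p - snd p"]
          by (simp only: abs_divide abs_of_nonneg) linarith
        ultimately show ?thesis
          unfolding heat_energy_kernel_def by linarith
      qed
    qed
    then show "integrable lborel (\<lambda>p. heat_energy_kernel s (fst p - snd p) *\<^sub>R pair_corr p)" by simp
    show "\<bar>s * heat_kernel_dtt (2 * s) (fst p - snd p)\<bar> \<le> G" for p :: "'a \<times> 'a"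
      by (rule bound[OF st])
    show "((\<lambda>s. heat_energy_kernel s (fst p - snd p)) has_real_derivative s * heat_kernel_dtt (2 * s) (fst p - snd p)) (at s)" for p :: "'a \<times> 'a"
      by (rule has_field_derivative_heat_energy_kernel[OF s])
  next
    have "G \<ge> 0" using t by (simp add: G_def)
    then show "integrable lborel (\<lambda>p. G *\<^sub>R pair_corr p)"
      using integrable_kernel_pair_corr[of "\<lambda>_. G" G] by simp
    show "(\<lambda>p. (t * heat_kernel_dtt (2 * t) (fst p - snd p)) *\<^sub>R pair_corr p) \<in> borel_measurable lborel"
      by measurable
  qed (use t in auto)
  moreover have "(LINT p|lborel. (t * heat_kernel_dtt (2 * t) (fst p - snd p)) *\<^sub>R pair_corr p) = t * (LINT x|lborel. (norm (heat_dt t h x))\<^sup>2)"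
    unfolding integral_norm_sq_heat_dt(2)[OF t] by (simp add: mult.assoc)
  ultimately show ?thesis
    by (simp add: has_real_derivative_iff_has_vector_derivative energy_def[abs_def])
qed

text \<open>Schur's test: the inner product is at most the mean of the two squared norms, the kernel
  is symmetric in the pair, and its absolute integral in either variable is bounded uniformly in
  \<open>t\<close>.\<close>

lemma abs_energy_le:
  assumes t: "t > 0"
  shows "ennreal \<bar>energy t\<bar> \<le> ennreal ((2 + real DIM('a) / 2) * 2 powr (real DIM('a) / 2) + 1) * (\<integral>\<^sup>+y. ennreal ((norm (h y))\<^sup>2) \<partial>lborel)"
proof -
  note [measurable] = fst_snd_measurable
  define C where "C = (2 + real DIM('a) / 2) * 2 powr (real DIM('a) / 2) + 1"
  define E where "E z = ennreal \<bar>heat_energy_kernel t (z::'a)\<bar>" for z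
  have [measurable]: "E \<in> borel_measurable borel" unfolding E_def heat_energy_kernel_def by measurable
  have sym: "E (y - z) = E (z - y)" for y z
    unfolding E_def heat_energy_kernel_def heat_kernel_commute[of "2 * t" y z] ..
  define H where "H y = ennreal ((norm (h y))\<^sup>2 / 2)" for y
  have [measurable]: "H \<in> borel_measurable borel" unfolding H_def by measurable
  have EC: "(\<integral>\<^sup>+z. E (y - z) \<partial>lborel) \<le> ennreal C" for y
    using nn_integral_abs_heat_energy_kernel_le[OF t, of y] by (simp add: E_def C_def)
  have C: "C \<ge> 0" by (simp add: C_def)
  have "ennreal \<bar>energy t\<bar> \<le> (\<integral>\<^sup>+p. ennreal (norm (heat_energy_kernel t (fst p - snd p) * pair_corr p)) \<partial>lborel)"
    unfolding energy_def
    \<comment> \<open>Without integrability the Bochner integral is 0 and the bound is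
      trivial.\<close>
    by (cases "integrable lborel (\<lambda>p. heat_energy_kernel t (fst p - snd p) * pair_corr p)")
      (auto simp: not_integrable_integral_eq real_norm_def[symmetric] intro!: integral_norm_bound_ennreal simp del: real_norm_def)
  also have "\<dots> \<le> (\<integral>\<^sup>+p. E (fst p - snd p) * (H (fst p) + H (snd p)) \<partial>lborel)"
  proof (intro nn_integral_mono)
    fix p :: "'a \<times> 'a"
    have "\<bar>pair_corr p\<bar> \<le> (norm (h (fst p)))\<^sup>2 / 2 + (norm (h (snd p)))\<^sup>2 / 2"
      using abs_pair_corr_le[of p] zero_le_power2[of "norm (h (fst p)) - norm (h (snd p))"] by (simp add: power2_diff)
    then have "\<bar>heat_energy_kernel t (fst p - snd p)\<bar> * \<bar>pair_corr p\<bar> \<le> \<bar>heat_energy_kernel t (fst p - snd p)\<bar> * ((norm (h (fst p)))\<^sup>2 / 2 + (norm (h (snd p)))\<^sup>2 / 2)"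
      by (rule mult_left_mono) simp
    then show "ennreal (norm (heat_energy_kernel t (fst p - snd p) * pair_corr p)) \<le> E (fst p - snd p) * (H (fst p) + H (snd p))"
      unfolding E_def H_def by (simp add: abs_mult ennreal_mult[symmetric] ennreal_plus[symmetric] ennreal_leI del: ennreal_plus)
  qed
  also have "\<dots> = (\<integral>\<^sup>+y. \<integral>\<^sup>+z. E (y - z) * (H y + H z) \<partial>lborel \<partial>lborel)"
    unfolding lborel_prod[symmetric] by (subst lborel.nn_integral_fst[symmetric]) auto
  also have "\<dots> = (\<integral>\<^sup>+y. \<integral>\<^sup>+z. E (y - z) * H y \<partial>lborel \<partial>lborel) + (\<integral>\<^sup>+y. \<integral>\<^sup>+z. E (y - z) * H z \<partial>lborel \<partial>lborel)"
    by (simp add: distrib_left nn_integral_add)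
  also have "(\<integral>\<^sup>+y. \<integral>\<^sup>+z. E (y - z) * H z \<partial>lborel \<partial>lborel) = (\<integral>\<^sup>+z. \<integral>\<^sup>+y. E (y - z) * H z \<partial>lborel \<partial>lborel)"
    by (rule lborel_pair.Fubini') auto
  also have "\<dots> = (\<integral>\<^sup>+y. \<integral>\<^sup>+z. E (y - z) * H y \<partial>lborel \<partial>lborel)"
    by (intro nn_integral_cong) (simp add: sym)
  also have "(\<integral>\<^sup>+y. \<integral>\<^sup>+z. E (y - z) * H y \<partial>lborel \<partial>lborel) \<le> (\<integral>\<^sup>+y. ennreal C * H y \<partial>lborel)"
    by (intro nn_integral_mono) (simp add: nn_integral_multc mult_right_mono EC)
  also have "\<dots> = ennreal C * (\<integral>\<^sup>+y. H y \<partial>lborel)"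
    by (rule nn_integral_cmult) auto
  finally have "ennreal \<bar>energy t\<bar> \<le> ennreal C * (\<integral>\<^sup>+y. H y \<partial>lborel) + ennreal C * (\<integral>\<^sup>+y. H y \<partial>lborel)"
    by (simp add: add_mono)
  also have "\<dots> = ennreal C * (\<integral>\<^sup>+y. H y + H y \<partial>lborel)"
    by (subst nn_integral_add) (auto simp: distrib_left)
  also have "(\<integral>\<^sup>+y. H y + H y \<partial>lborel) = (\<integral>\<^sup>+y. ennreal ((norm (h y))\<^sup>2) \<partial>lborel)"
    unfolding H_def by (simp add: ennreal_plus[symmetric] del: ennreal_plus)
  finally show ?thesis by (simp add: C_def)
qed

lemma heat_square_function_L2:
  "(\<integral>\<^sup>+t\<in>{0<..}. (\<integral>\<^sup>+x. heat_sq h t x \<partial>lborel) \<partial>lborel)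
     \<le> ennreal (2 * ((2 + real DIM('a) / 2) * 2 powr (real DIM('a) / 2) + 1)) * (\<integral>\<^sup>+y. ennreal ((norm (h y))\<^sup>2) \<partial>lborel)"
proof (rule nn_integral_Ioi_le)
  define C where "C = (2 + real DIM('a) / 2) * 2 powr (real DIM('a) / 2) + 1"
  define I where "I t = (LINT x|lborel. (norm (heat_dt t h x))\<^sup>2)" for t
  have Im[measurable]: "I \<in> borel_measurable borel" unfolding I_def by measurable
  have I0: "I t \<ge> 0" for t unfolding I_def by simp
  show "(\<lambda>t. \<integral>\<^sup>+x. heat_sq h t x \<partial>lborel) \<in> borel_measurable borel"
    by measurable
  fix a b :: real assume ab: "0 < a" "a < b"
  have "(\<integral>\<^sup>+t\<in>{a..b}. (\<integral>\<^sup>+x. heat_sq h t x \<partial>lborel) \<partial>lborel) =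
    (\<integral>\<^sup>+t. ennreal (t * I t) * indicator {a..b} t \<partial>lborel)"
  proof (intro nn_integral_cong)
    fix t
    show "(\<integral>\<^sup>+x. heat_sq h t x \<partial>lborel) * indicator {a..b} t = ennreal (t * I t) * indicator {a..b} t"
    proof (cases "t \<in> {a..b}")
      case True
      then have t: "t > 0" using ab by auto
      have "(\<integral>\<^sup>+x. heat_sq h t x \<partial>lborel) = ennreal (LINT x|lborel. t * (norm (heat_dt t h x))\<^sup>2)"
        using t integral_norm_sq_heat_dt(1)[OF t] by (intro nn_integral_eq_integral) auto
      then show ?thesis by (simp add: I_def)
    qed simp
  qed
  \<comment> \<open>The time integral telescopes; bounding the energies at both endpoints separately
    accounts for the factor 2 in the constant.\<close>
  also have "\<dots> = ennreal (energy b - energy a)"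
    by (rule nn_integral_FTC_Icc)
      (use ab I0 has_real_derivative_energy in \<open>auto simp: I_def intro!: has_real_derivative_energy[THEN has_field_derivative_at_within]\<close>)
  also have "\<dots> \<le> ennreal (\<bar>energy b\<bar> + \<bar>energy a\<bar>)" by (intro ennreal_leI) auto
  also have "\<dots> = ennreal \<bar>energy b\<bar> + ennreal \<bar>energy a\<bar>" by simp
  also have "\<dots> \<le> ennreal C * (\<integral>\<^sup>+y. ennreal ((norm (h y))\<^sup>2) \<partial>lborel) + ennreal C * (\<integral>\<^sup>+y. ennreal ((norm (h y))\<^sup>2) \<partial>lborel)"
    unfolding C_def using ab by (intro add_mono abs_energy_le) auto
  also have "\<dots> = ennreal (2 * C) * (\<integral>\<^sup>+y. ennreal ((norm (h y))\<^sup>2) \<partial>lborel)"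
  proof -
    have "C \<ge> 0" by (simp add: C_def)
    then have "ennreal (2 * C) = ennreal C + ennreal C" by (simp add: ennreal_plus[symmetric] del: ennreal_plus)
    then show ?thesis by (simp add: distrib_right)
  qed
  finally show "(\<integral>\<^sup>+t\<in>{a..b}. (\<integral>\<^sup>+x. heat_sq h t x \<partial>lborel) \<partial>lborel)
     \<le> ennreal (2 * ((2 + real DIM('a) / 2) * 2 powr (real DIM('a) / 2) + 1)) * (\<integral>\<^sup>+y. ennreal ((norm (h y))\<^sup>2) \<partial>lborel)"
    by (simp only: C_def)
qed

end

section \<open>Local and far parts of the square function\<close>

lemma lborel_distr_reflect:
  fixes x :: "'a::euclidean_space"
  shows "distr lborel borel (\<lambda>w. x - w) = lborel"
  by (subst lborel_affine[of "-1" x]) (auto simp: density_1)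

lemma heat_semigroup_convolution:
  fixes f :: "'a::euclidean_space \<Rightarrow> 'b::{banach, second_countable_topology}"
  assumes [measurable]: "f \<in> borel_measurable borel"
  shows "heat_semigroup t f x = (LINT w|lborel. heat_kernel t w *\<^sub>R f (x - w))"
  unfolding heat_semigroup_eq_lborel[OF assms]
  by (subst lborel_distr_reflect[of x, symmetric]) (simp add: integral_distr)

lemma gauss_integrable_translate:
  assumes f: "gauss_integrable f" and t: "t > 0"
  shows "integrable lborel (\<lambda>w. heat_kernel t w *\<^sub>R f (x - w))"
proof -
  note [measurable] = gauss_integrable_measurable[OF f]
  have "integrable (distr lborel borel (\<lambda>w. x - w)) (\<lambda>y. heat_kernel t (x - y) *\<^sub>R f y)"
    using f t by (simp add: lborel_distr_reflect gauss_integrable_def)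
  then show ?thesis by (subst (asm) integrable_distr_eq) auto
qed

lemma mean_osc_le_translate:
  fixes f :: "'a::euclidean_space \<Rightarrow> 'b::euclidean_space"
  assumes f: "mean_osc_le f N" and r: "r > 0"
  shows "(\<integral>\<^sup>+y\<in>ball x r. (\<integral>\<^sup>+z\<in>ball x r. ennreal (norm (f (y - w) - f (z - w))) \<partial>lborel) \<partial>lborel)
    \<le> ennreal N * (emeasure lborel (ball x r))\<^sup>2"
proof -
  note [measurable] = mean_osc_le_measurable[OF f]
  have [measurable]: "ball a r \<in> sets borel" for a :: 'a by simp
  have ind: "indicator (ball x r) y = (indicator (ball (x - w) r) (- w + y) :: ennreal)" for y
    by (simp add: indicator_def dist_norm algebra_simps)
  have inner: "(\<integral>\<^sup>+z\<in>ball x r. ennreal (norm (u - f (z - w))) \<partial>lborel) = (\<integral>\<^sup>+z\<in>ball (x - w) r. ennreal (norm (u - f z)) \<partial>lborel)" for u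
    using nn_integral_translate[of "\<lambda>z. ennreal (norm (u - f z)) * indicator (ball (x - w) r) z" "- w"]
    by (simp add: ind)
  have "(\<integral>\<^sup>+y\<in>ball x r. (\<integral>\<^sup>+z\<in>ball x r. ennreal (norm (f (y - w) - f (z - w))) \<partial>lborel) \<partial>lborel) =
    (\<integral>\<^sup>+y\<in>ball (x - w) r. (\<integral>\<^sup>+z\<in>ball (x - w) r. ennreal (norm (f y - f z)) \<partial>lborel) \<partial>lborel)"
    unfolding inner
    using nn_integral_translate[of "\<lambda>y. (\<integral>\<^sup>+z\<in>ball (x - w) r. ennreal (norm (f y - f z)) \<partial>lborel) * indicator (ball (x - w) r) y" "- w"]
    by (simp add: ind)
  also have "\<dots> \<le> ennreal N * (emeasure lborel (ball (x - w) r))\<^sup>2"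
    using f r by (simp add: mean_osc_le_def)
  finally show ?thesis using r by (simp add: emeasure_ball_eq)
qed

text \<open>A difference of two values is the average over \<open>w\<close> of the differences for
  the translates of \<open>f\<close>. Two applications of Tonelli move \<open>w\<close> outermost,
  where translation invariance applies and the total mass 1 of the kernel leaves \<open>N\<close>
  unchanged.\<close>

lemma mean_osc_le_heat_semigroup:
  fixes f :: "'a::euclidean_space \<Rightarrow> 'b::euclidean_space"
  assumes f: "mean_osc_le f N" and gf: "gauss_integrable f" and t: "t > 0"
  shows "mean_osc_le (heat_semigroup t f) N"
  unfolding mean_osc_le_def
proof (intro conjI allI impI)
  note fm[measurable] = mean_osc_le_measurable[OF f]
  show "heat_semigroup t f \<in> borel_measurable borel" by measurable
  fix x :: 'a and r :: real assume r: "r > 0"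
  have [measurable]: "ball x r \<in> sets borel" by simp
  let ?B = "ball x r"
  have le: "ennreal (norm (heat_semigroup t f y - heat_semigroup t f z)) \<le>
     (\<integral>\<^sup>+w. ennreal (heat_kernel t w) * ennreal (norm (f (y - w) - f (z - w))) \<partial>lborel)" for y z
  proof -
    have i: "integrable lborel (\<lambda>w. heat_kernel t w *\<^sub>R f (y - w))" for y by (rule gauss_integrable_translate[OF gf t])
    have "heat_semigroup t f y - heat_semigroup t f z = (LINT w|lborel. heat_kernel t w *\<^sub>R (f (y - w) - f (z - w)))"
      unfolding heat_semigroup_convolution[OF fm] using Bochner_Integration.integral_diff[OF i i, of y z]
      by (simp add: scaleR_diff_right)
    moreover have "integrable lborel (\<lambda>w. heat_kernel t w *\<^sub>R (f (y - w) - f (z - w)))"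
      using Bochner_Integration.integrable_diff[OF i i, of y z] by (simp add: scaleR_diff_right)
    ultimately show ?thesis
      using integral_norm_bound_ennreal[of lborel "\<lambda>w. heat_kernel t w *\<^sub>R (f (y - w) - f (z - w))"]
      by (simp add: ennreal_mult)
  qed
  have "(\<integral>\<^sup>+y\<in>?B. (\<integral>\<^sup>+z\<in>?B. ennreal (norm (heat_semigroup t f y - heat_semigroup t f z)) \<partial>lborel) \<partial>lborel) \<le>
    (\<integral>\<^sup>+y\<in>?B. (\<integral>\<^sup>+z\<in>?B. (\<integral>\<^sup>+w. ennreal (heat_kernel t w) * ennreal (norm (f (y - w) - f (z - w))) \<partial>lborel) \<partial>lborel) \<partial>lborel)"
    by (intro nn_integral_mono mult_right_mono le) auto
  also have "\<dots> = (\<integral>\<^sup>+y. (\<integral>\<^sup>+z. (\<integral>\<^sup>+w. ennreal (heat_kernel t w) * ennreal (norm (f (y - w) - f (z - w))) * indicator ?B z * indicator ?B y \<partial>lborel) \<partial>lborel) \<partial>lborel)"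
    by (simp add: nn_integral_multc)
  also have "\<dots> = (\<integral>\<^sup>+y. (\<integral>\<^sup>+w. (\<integral>\<^sup>+z. ennreal (heat_kernel t w) * ennreal (norm (f (y - w) - f (z - w))) * indicator ?B z * indicator ?B y \<partial>lborel) \<partial>lborel) \<partial>lborel)"
    by (intro nn_integral_cong lborel_pair.Fubini') measurable
  also have "\<dots> = (\<integral>\<^sup>+w. (\<integral>\<^sup>+y. (\<integral>\<^sup>+z. ennreal (heat_kernel t w) * ennreal (norm (f (y - w) - f (z - w))) * indicator ?B z * indicator ?B y \<partial>lborel) \<partial>lborel) \<partial>lborel)"
    by (rule lborel_pair.Fubini') measurable
  also have "\<dots> = (\<integral>\<^sup>+w. ennreal (heat_kernel t w) * (\<integral>\<^sup>+y\<in>?B. (\<integral>\<^sup>+z\<in>?B. ennreal (norm (f (y - w) - f (z - w))) \<partial>lborel) \<partial>lborel) \<partial>lborel)"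
  proof (intro nn_integral_cong)
    fix w
    let ?K = "ennreal (heat_kernel t w)" and ?F = "\<lambda>y z. ennreal (norm (f (y - w) - f (z - w)))"
    have "(\<integral>\<^sup>+z. ?K * ?F y z * indicator ?B z * indicator ?B y \<partial>lborel) = ?K * ((\<integral>\<^sup>+z\<in>?B. ?F y z \<partial>lborel) * indicator ?B y)" for y
    proof -
      have "(\<integral>\<^sup>+z. ?K * ?F y z * indicator ?B z * indicator ?B y \<partial>lborel) = (\<integral>\<^sup>+z. (?K * indicator ?B y) * (?F y z * indicator ?B z) \<partial>lborel)"
        by (intro nn_integral_cong) (simp only: ac_simps)
      also have "\<dots> = (?K * indicator ?B y) * (\<integral>\<^sup>+z\<in>?B. ?F y z \<partial>lborel)"
        by (rule nn_integral_cmult) measurable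
      finally show ?thesis by (simp only: ac_simps)
    qed
    then show "(\<integral>\<^sup>+y. (\<integral>\<^sup>+z. ?K * ?F y z * indicator ?B z * indicator ?B y \<partial>lborel) \<partial>lborel) = ?K * (\<integral>\<^sup>+y\<in>?B. (\<integral>\<^sup>+z\<in>?B. ?F y z \<partial>lborel) \<partial>lborel)"
      by (simp add: nn_integral_cmult)
  qed
  also have "\<dots> \<le> (\<integral>\<^sup>+w. ennreal (heat_kernel t (w::'a)) * (ennreal N * (emeasure lborel ?B)\<^sup>2) \<partial>lborel)"
    by (rule nn_integral_mono, rule mult_left_mono[OF mean_osc_le_translate[OF f r]]) simp
  also have "\<dots> = ennreal N * (emeasure lborel ?B)\<^sup>2"
    using t by (simp add: nn_integral_multc nn_integral_heat_kernel_0)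
  finally show "(\<integral>\<^sup>+y\<in>?B. (\<integral>\<^sup>+z\<in>?B. ennreal (norm (heat_semigroup t f y - heat_semigroup t f z)) \<partial>lborel) \<partial>lborel) \<le> ennreal N * (emeasure lborel ?B)\<^sup>2" .
qed

lemma mean_osc_le_imp_gauss_integrable:
  fixes f :: "'a::euclidean_space \<Rightarrow> 'b::euclidean_space"
  assumes f: "mean_osc_le f N" and N: "N > 0"
  shows "gauss_integrable f"
proof (rule gauss_integrableI)
  note fm[measurable] = mean_osc_le_measurable[OF f]
  fix t :: real and x :: 'a assume t: "t > 0"
  obtain c where c: "(\<integral>\<^sup>+y\<in>ball x (sqrt t). ennreal (norm (f y - c)) \<partial>lborel) \<le> ennreal (2 * N) * emeasure lborel (ball x (sqrt t))"
    using mean_osc_le_center[OF f N, of "sqrt t" x] t by auto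
  have "(abs_heat f t x) \<le>
    (\<integral>\<^sup>+y. ennreal (heat_kernel t (x - y)) * ennreal (norm (f y - c)) + ennreal (heat_kernel t (x - y)) * ennreal (norm c) \<partial>lborel)"
    unfolding distrib_left[symmetric] using norm_triangle_sub[of "f y" c for y]
    by (intro nn_integral_mono mult_left_mono) (auto simp: ennreal_plus[symmetric] add.commute intro!: ennreal_leI simp del: ennreal_plus)
  also have "\<dots> = (abs_heat (\<lambda>y. f y - c) t x) + ennreal (norm c)"
    using t by (subst nn_integral_add) (auto simp: nn_integral_multc)
  also have "\<dots> \<le> ennreal (heat_osc_const TYPE('a) * N) + ennreal (norm c)"
    using heat_kernel_osc_le[OF f N _ c] t by (intro add_right_mono) simp
  also have "\<dots> < \<infinity>" by simp
  finally show "(abs_heat f t x) < \<infinity>" .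
qed (rule mean_osc_le_measurable[OF f])

lemma norm_heat_dt_le:
  assumes f: "gauss_integrable f" and t: "t > 0"
  shows "ennreal (norm (heat_dt t f x)) \<le> (\<integral>\<^sup>+y. ennreal \<bar>heat_kernel_dt t (x - y)\<bar> * ennreal (norm (f y)) \<partial>lborel)"
  using integral_norm_bound_ennreal[OF integrable_heat_kernel_dt[OF f t, of x]]
  by (simp add: heat_dt_def ennreal_mult)

lemma local_square_function_continuous:
  "\<exists>C>0. \<forall>(v::'a::euclidean_space \<Rightarrow> 'b::euclidean_space) N x r. continuous_on UNIV v \<longrightarrow> mean_osc_le v N \<longrightarrow> N > 0 \<longrightarrow> r > 0 \<longrightarrow>
     (\<integral>\<^sup>+t\<in>{0<..r\<^sup>2}. (\<integral>\<^sup>+y\<in>ball x r. heat_sq v t y \<partial>lborel) \<partial>lborel)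
       \<le> ennreal (C * N\<^sup>2) * emeasure lborel (ball x r)"
proof -
  define n where "n = DIM('a)"
  obtain CJ where CJ: "CJ > 0" and JN: "\<And>(f::'a \<Rightarrow> 'b) N x r c. continuous_on UNIV f \<Longrightarrow> mean_osc_le f N \<Longrightarrow> N > 0 \<Longrightarrow> r > 0 \<Longrightarrow>
     (abs_dev f (ball x r) c) \<le> ennreal (2 * N) * emeasure lborel (ball x r) \<Longrightarrow>
     (sq_dev f (ball x r) c) \<le> ennreal (CJ * N\<^sup>2) * emeasure lborel (ball x r)"
    using john_nirenberg_continuous[where 'a='a and 'b='b] by blast
  \<comment> \<open>\<open>C1\<close> belongs to the derivative of the kernel, \<open>C2\<close> to
    its off-diagonal decay, \<open>C3\<close> to the shift of its centre and \<open>CK\<close> to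
    the oscillation; their product \<open>C4\<close> governs the part of \<open>v\<close> outside
    the enlarged ball. \<open>C5\<close> governs the part inside: the L2 constant, the
    John--Nirenberg constant and the volume ratio \<open>sqrt 8 ^ n\<close>.\<close>
  define C1 where "C1 = (2 + real n / 2) * 2 powr (real n / 2)"
  define C2 where "C2 = 32 ^ (n + 1) * (fact (n + 1) :: real)"
  define C3 where "C3 = 2 powr (real n / 2) * exp (1 / 4)"
  define CK where "CK = heat_osc_const TYPE('a)"
  define C4 where "C4 = C1 * C2 * C3 * CK"
  define C5 where "C5 = 2 * (C1 + 1) * CJ * sqrt 8 ^ n"
  define C where "C = 2 * C5 + 2 * C4\<^sup>2"
  have pos: "C1 > 0" "C2 > 0" "C3 > 0" "CK > 0"
    using heat_osc_const_pos[where 'a='a] by (auto simp: C1_def C2_def C3_def CK_def intro!: mult_pos_pos add_pos_nonneg)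
  have pos': "C4 > 0" "C5 > 0" using pos CJ by (auto simp: C4_def C5_def intro!: mult_pos_pos add_pos_pos)
  have C: "C > 0" using pos' by (auto simp: C_def intro!: add_pos_nonneg)
  have "(\<integral>\<^sup>+t\<in>{0<..r\<^sup>2}. (\<integral>\<^sup>+y\<in>ball x r. heat_sq v t y \<partial>lborel) \<partial>lborel)
       \<le> ennreal (C * N\<^sup>2) * emeasure lborel (ball x r)"
    if cont: "continuous_on UNIV v" and v: "mean_osc_le v N" and N: "N > 0" and r: "r > 0" for v :: "'a \<Rightarrow> 'b" and N x r
  proof -
    note vm[measurable] = mean_osc_le_measurable[OF v]
    have gv: "gauss_integrable v" by (rule mean_osc_le_imp_gauss_integrable[OF v N])
    \<comment> \<open>Two requirements fix \<open>R\<close>: \<open>2 * r \<le> R\<close> keeps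
      points outside \<open>B\<close> at distance at least \<open>r\<close> from
      \<open>ball x r\<close>, and \<open>R^2 = 8 * r^2\<close> is the doubled time that results
      from recentring the kernel at time \<open>4 * r^2\<close> at \<open>x\<close>, so the
      oscillation bound for \<open>B\<close> applies to it.\<close>
    define R where "R = sqrt 8 * r"
    have R: "R > 0" "R\<^sup>2 = 8 * r\<^sup>2" "2 * r \<le> R"
    proof -
      show "R > 0" "R\<^sup>2 = 8 * r\<^sup>2" using r by (auto simp: R_def power_mult_distrib)
      have "2 \<le> sqrt 8" by (rule real_le_rsqrt) simp
      then show "2 * r \<le> R" using r by (simp add: R_def)
    qed
    define B where "B = ball x R"
    have Bm[measurable]: "B \<in> sets borel" "ball x r \<in> sets borel" by (auto simp: B_def)
    obtain c where c: "(abs_dev v (ball x R) c) \<le> ennreal (2 * N) * emeasure lborel (ball x R)"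
      using mean_osc_le_center[OF v N R(1)] by blast
    define h where "h y = indicator B y *\<^sub>R (v y - c)" for y
    define k where "k y = indicator (- B) y *\<^sub>R (v y - c)" for y
    have gvc: "gauss_integrable (\<lambda>y. v y - c)" by (intro gauss_integrable_diff gauss_integrable_const gv)
    have gh: "gauss_integrable h" and gk: "gauss_integrable k"
      unfolding h_def k_def by (auto intro!: gauss_integrable_restrict[OF gvc])
    note [measurable] = gauss_integrable_measurable[OF gh] gauss_integrable_measurable[OF gk]
    have vhk: "(\<lambda>y. h y + k y) = (\<lambda>y. v y - c)" by (auto simp: h_def k_def indicator_def)
    have D: "heat_dt t v y = heat_dt t h y + heat_dt t k y" if "t > 0" for t y
      using heat_dt_add[OF gh gk that, of y] heat_dt_diff_const[OF gv that, of c y] by (simp add: vhk)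
    have sq: "heat_sq v t y \<le> 2 * heat_sq h t y + 2 * heat_sq k t y"
      if "t > 0" for t y
    proof -
      have "(norm (heat_dt t v y))\<^sup>2 \<le> (norm (heat_dt t h y) + norm (heat_dt t k y))\<^sup>2"
        unfolding D[OF that] by (intro power_mono norm_triangle_ineq) auto
      also have "\<dots> \<le> 2 * (norm (heat_dt t h y))\<^sup>2 + 2 * (norm (heat_dt t k y))\<^sup>2"
        using zero_le_power2[of "norm (heat_dt t h y) - norm (heat_dt t k y)"] by (simp add: power2_sum power2_diff)
      finally have "t * (norm (heat_dt t v y))\<^sup>2 \<le> t * (2 * (norm (heat_dt t h y))\<^sup>2 + 2 * (norm (heat_dt t k y))\<^sup>2)"
        using that by (intro mult_left_mono) auto
      then have "t * (norm (heat_dt t v y))\<^sup>2 \<le> 2 * (t * (norm (heat_dt t h y))\<^sup>2) + 2 * (t * (norm (heat_dt t k y))\<^sup>2)"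
        by (simp add: algebra_simps)
      from ennreal_leI[OF this] show ?thesis
        using that by (simp add: ennreal_plus ennreal_mult)
    qed
    \<comment> \<open>Squared and weighted by \<open>t\<close>, this bound becomes the constant
      \<open>C4^2 * N^2 / r^2\<close>, and integration over times up to \<open>r^2\<close> removes
      the dependence on \<open>r\<close>.\<close>
    have dk: "norm (heat_dt t k y) \<le> C4 * N / (sqrt t * r)" if t: "0 < t" "t \<le> r\<^sup>2" and y: "y \<in> ball x r" for t y
    proof -
      define A where "A = C1 * C2 * C3 / (sqrt t * r)"
      have A: "A \<ge> 0" using pos t r by (simp add: A_def)
      have le: "\<bar>heat_kernel_dt t (y - z)\<bar> * norm (k z) \<le> A * (heat_kernel (R\<^sup>2) (x - z) * norm (v z - c))" for z
      proof (cases "z \<in> B")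
        case True
        then show ?thesis using A by (simp add: k_def)
      next
        case False
        have "dist x z \<ge> R" using False by (simp add: B_def)
        then have "norm (y - z) \<ge> r"
          using y R(3) dist_triangle[of x z y] by (auto simp: dist_norm)
        then have p1: "heat_kernel (2 * t) (y - z) \<le> C2 * (sqrt t / r) * heat_kernel (4 * r\<^sup>2) (y - z)"
          using heat_kernel_off_diagonal[of t r "y - z"] t r by (simp add: C2_def n_def)
        have "(norm (y - z - (x - z)))\<^sup>2 \<le> r\<^sup>2"
          using y by (intro power_mono) (auto simp: dist_norm norm_minus_commute)
        also have "\<dots> \<le> 4 * r\<^sup>2" by simp
        finally have p2: "heat_kernel (4 * r\<^sup>2) (y - z) \<le> C3 * heat_kernel (R\<^sup>2) (x - z)"
          using heat_kernel_shift[of "4 * r\<^sup>2" "y - z" "x - z"] r R(2) by (simp add: C3_def n_def)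
        have p: "heat_kernel (2 * t) (y - z) \<le> C2 * (sqrt t / r) * (C3 * heat_kernel (R\<^sup>2) (x - z))"
          by (rule order_trans[OF p1 mult_left_mono[OF p2]]) (use pos t r in auto)
        have "\<bar>heat_kernel_dt t (y - z)\<bar> \<le> C1 / t * heat_kernel (2 * t) (y - z)"
          using abs_heat_kernel_dt_le[OF t(1), of "y - z"] by (simp only: C1_def n_def)
        also have "\<dots> \<le> C1 / t * (C2 * (sqrt t / r) * (C3 * heat_kernel (R\<^sup>2) (x - z)))"
          using pos t by (intro mult_left_mono p) auto
        also have "\<dots> = A * heat_kernel (R\<^sup>2) (x - z)"
        proof -
          have "sqrt t / t = 1 / sqrt t" using t by (simp add: field_simps)
          moreover have "a / t * (b * (u / r) * (d * p)) = a * b * d * p * (u / t) / r" for a b d u p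
            by (simp add: ac_simps)
          ultimately have "C1 / t * (C2 * (sqrt t / r) * (C3 * p)) = C1 * C2 * C3 * p * (1 / sqrt t) / r" for p
            by (simp only:)
          then show ?thesis by (simp add: A_def)
        qed
        finally have "\<bar>heat_kernel_dt t (y - z)\<bar> * norm (v z - c) \<le> A * heat_kernel (R\<^sup>2) (x - z) * norm (v z - c)"
          by (rule mult_right_mono) simp
        then show ?thesis using False by (simp add: k_def mult.assoc)
      qed
      have "ennreal (norm (heat_dt t k y)) \<le> (\<integral>\<^sup>+z. ennreal \<bar>heat_kernel_dt t (y - z)\<bar> * ennreal (norm (k z)) \<partial>lborel)"
        by (rule norm_heat_dt_le[OF gk t(1)])
      also have "\<dots> \<le> (\<integral>\<^sup>+z. ennreal A * (ennreal (heat_kernel (R\<^sup>2) (x - z)) * ennreal (norm (v z - c))) \<partial>lborel)"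
        using le A by (intro nn_integral_mono) (simp add: ennreal_mult[symmetric] ennreal_leI)
      also have "\<dots> = ennreal A * (abs_heat (\<lambda>z. v z - c) (R\<^sup>2) x)"
        by (rule nn_integral_cmult) measurable
      also have "\<dots> \<le> ennreal A * ennreal (CK * N)"
        unfolding CK_def by (intro mult_left_mono heat_kernel_osc_le[OF v N R(1) c]) auto
      also have "\<dots> = ennreal (C4 * N / (sqrt t * r))"
        using A pos N by (simp add: ennreal_mult[symmetric] A_def C4_def mult.assoc)
      finally show ?thesis
        using pos' N t r by (subst (asm) ennreal_le_iff) auto
    qed
    have K: "(\<integral>\<^sup>+t\<in>{0<..r\<^sup>2}. (\<integral>\<^sup>+y\<in>ball x r. heat_sq k t y \<partial>lborel) \<partial>lborel)
       \<le> ennreal (C4\<^sup>2 * N\<^sup>2) * emeasure lborel (ball x r)"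
    proof -
      have "(\<integral>\<^sup>+t\<in>{0<..r\<^sup>2}. (\<integral>\<^sup>+y\<in>ball x r. heat_sq k t y \<partial>lborel) \<partial>lborel)
        \<le> (\<integral>\<^sup>+t\<in>{0<..r\<^sup>2}. (\<integral>\<^sup>+y\<in>ball x r. ennreal (C4\<^sup>2 * N\<^sup>2 / r\<^sup>2) \<partial>lborel) \<partial>lborel)"
      proof (intro nn_integral_mono)
        fix t :: real
        show "(\<integral>\<^sup>+y\<in>ball x r. heat_sq k t y \<partial>lborel) * indicator {0<..r\<^sup>2} t \<le>
          (\<integral>\<^sup>+y\<in>ball x r. ennreal (C4\<^sup>2 * N\<^sup>2 / r\<^sup>2) \<partial>lborel) * indicator {0<..r\<^sup>2} t"
        proof (cases "t \<in> {0<..r\<^sup>2}")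
          case True
          then have t: "0 < t" "t \<le> r\<^sup>2" by auto
          have "t * (norm (heat_dt t k y))\<^sup>2 \<le> C4\<^sup>2 * N\<^sup>2 / r\<^sup>2" if "y \<in> ball x r" for y
          proof -
            have "t * (norm (heat_dt t k y))\<^sup>2 \<le> t * (C4 * N / (sqrt t * r))\<^sup>2"
              using dk[OF t that] t by (intro mult_left_mono power_mono) auto
            also have "\<dots> = C4\<^sup>2 * N\<^sup>2 / r\<^sup>2"
              using t r by (simp add: power_divide power_mult_distrib)
            finally show ?thesis .
          qed
          then have "(\<integral>\<^sup>+y\<in>ball x r. heat_sq k t y \<partial>lborel) \<le> (\<integral>\<^sup>+y\<in>ball x r. ennreal (C4\<^sup>2 * N\<^sup>2 / r\<^sup>2) \<partial>lborel)"
            by (intro nn_integral_mono) (auto simp: indicator_def intro!: ennreal_leI)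
          then show ?thesis by (rule mult_right_mono) simp
        qed simp
      qed
      also have "\<dots> = ennreal (C4\<^sup>2 * N\<^sup>2 / r\<^sup>2) * emeasure lborel (ball x r) * ennreal (r\<^sup>2)"
        by (simp add: nn_integral_cmult_indicator)
      also have "\<dots> = ennreal (C4\<^sup>2 * N\<^sup>2 / r\<^sup>2) * ennreal (r\<^sup>2) * emeasure lborel (ball x r)"
        by (simp only: ac_simps)
      also have "ennreal (C4\<^sup>2 * N\<^sup>2 / r\<^sup>2) * ennreal (r\<^sup>2) = ennreal (C4\<^sup>2 * N\<^sup>2)"
        using r by (subst ennreal_mult[symmetric]) auto
      finally show ?thesis .
    qed
    have H: "(\<integral>\<^sup>+t\<in>{0<..r\<^sup>2}. (\<integral>\<^sup>+y\<in>ball x r. heat_sq h t y \<partial>lborel) \<partial>lborel)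
       \<le> ennreal (C5 * N\<^sup>2) * emeasure lborel (ball x r)"
    proof -
      \<comment> \<open>Continuity of \<open>v\<close> makes \<open>h\<close> bounded, as the L2
        estimate demands; the bound \<open>M\<close> does not survive in its conclusion.\<close>
      have "compact (v ` cball x R)" by (intro compact_continuous_image continuous_on_subset[OF cont]) auto
      then obtain M where "\<forall>w\<in>v ` cball x R. norm w \<le> M"
        using compact_imp_bounded[of "v ` cball x R"] unfolding bounded_iff by auto
      then have M: "norm (v y) \<le> M" if "y \<in> cball x R" for y
        using that by blast
      have hM: "norm (h y) \<le> \<bar>M\<bar> + norm c" for y
      proof (cases "y \<in> B")
        case True
        then have "norm (v y) \<le> M" by (intro M) (simp add: B_def)
        then show ?thesis using True norm_triangle_ineq4[of "v y" c] by (simp add: h_def)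
      qed (simp add: h_def)
      have "(\<integral>\<^sup>+t\<in>{0<..r\<^sup>2}. (\<integral>\<^sup>+y\<in>ball x r. heat_sq h t y \<partial>lborel) \<partial>lborel) \<le>
        (\<integral>\<^sup>+t\<in>{0<..}. (\<integral>\<^sup>+y. heat_sq h t y \<partial>lborel) \<partial>lborel)"
        by (intro nn_integral_mono mult_mono nn_integral_mono) (auto simp: indicator_def)
      also have "\<dots> \<le> ennreal (2 * ((2 + real DIM('a) / 2) * 2 powr (real DIM('a) / 2) + 1)) * (\<integral>\<^sup>+y. ennreal ((norm (h y))\<^sup>2) \<partial>lborel)"
        by (rule heat_square_function_L2[where M="\<bar>M\<bar> + norm c" and S=B]) (auto simp: hM, auto simp: h_def B_def)
      also have "2 * ((2 + real DIM('a) / 2) * 2 powr (real DIM('a) / 2) + 1) = 2 * (C1 + 1)"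
        by (simp add: C1_def n_def)
      also have "(\<integral>\<^sup>+y. ennreal ((norm (h y))\<^sup>2) \<partial>lborel) = (sq_dev v (ball x R) c)"
        by (intro nn_integral_cong) (auto simp: h_def B_def indicator_def)
      also have "ennreal (2 * (C1 + 1)) * \<dots> \<le> ennreal (2 * (C1 + 1)) * (ennreal (CJ * N\<^sup>2) * emeasure lborel (ball x R))"
        by (intro mult_left_mono JN[OF cont v N R(1) c]) auto
      also have "emeasure lborel (ball x R) = ennreal (sqrt 8 ^ n) * emeasure lborel (ball x r)"
        using r R by (simp add: emeasure_ball_eq ennreal_mult[symmetric] R_def n_def power_mult_distrib ac_simps)
      also have "ennreal (2 * (C1 + 1)) * (ennreal (CJ * N\<^sup>2) * (ennreal (sqrt 8 ^ n) * emeasure lborel (ball x r))) =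
          ennreal (2 * (C1 + 1) * (CJ * N\<^sup>2) * sqrt 8 ^ n) * emeasure lborel (ball x r)"
        using pos CJ by (simp only: ennreal_mult mult_nonneg_nonneg add_nonneg_nonneg less_imp_le zero_le_numeral zero_le_one zero_le_power2 zero_le_power real_sqrt_ge_zero mult.assoc)
      also have "2 * (C1 + 1) * (CJ * N\<^sup>2) * sqrt 8 ^ n = C5 * N\<^sup>2"
        by (simp add: C5_def)
      finally show ?thesis .
    qed
    have "(\<integral>\<^sup>+t\<in>{0<..r\<^sup>2}. (\<integral>\<^sup>+y\<in>ball x r. heat_sq v t y \<partial>lborel) \<partial>lborel) \<le>
      (\<integral>\<^sup>+t. 2 * ((\<integral>\<^sup>+y\<in>ball x r. heat_sq h t y \<partial>lborel) * indicator {0<..r\<^sup>2} t) +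
        2 * ((\<integral>\<^sup>+y\<in>ball x r. heat_sq k t y \<partial>lborel) * indicator {0<..r\<^sup>2} t) \<partial>lborel)"
    proof (intro nn_integral_mono)
      fix t :: real
      show "(\<integral>\<^sup>+y\<in>ball x r. heat_sq v t y \<partial>lborel) * indicator {0<..r\<^sup>2} t \<le>
        2 * ((\<integral>\<^sup>+y\<in>ball x r. heat_sq h t y \<partial>lborel) * indicator {0<..r\<^sup>2} t) +
        2 * ((\<integral>\<^sup>+y\<in>ball x r. heat_sq k t y \<partial>lborel) * indicator {0<..r\<^sup>2} t)"
      proof (cases "t \<in> {0<..r\<^sup>2}")
        case True
        then have t: "t > 0" by simp
        have "(\<integral>\<^sup>+y\<in>ball x r. heat_sq v t y \<partial>lborel) \<le>
          (\<integral>\<^sup>+y. 2 * (heat_sq h t y * indicator (ball x r) y) + 2 * (heat_sq k t y * indicator (ball x r) y) \<partial>lborel)"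
          using sq[OF t] by (intro nn_integral_mono) (simp add: indicator_def)
        also have "\<dots> = 2 * (\<integral>\<^sup>+y\<in>ball x r. heat_sq h t y \<partial>lborel) + 2 * (\<integral>\<^sup>+y\<in>ball x r. heat_sq k t y \<partial>lborel)"
          by (subst nn_integral_add) (auto simp: nn_integral_cmult)
        finally show ?thesis using True by simp
      qed simp
    qed
    also have "\<dots> = 2 * (\<integral>\<^sup>+t\<in>{0<..r\<^sup>2}. (\<integral>\<^sup>+y\<in>ball x r. heat_sq h t y \<partial>lborel) \<partial>lborel) +
        2 * (\<integral>\<^sup>+t\<in>{0<..r\<^sup>2}. (\<integral>\<^sup>+y\<in>ball x r. heat_sq k t y \<partial>lborel) \<partial>lborel)"
      by (subst nn_integral_add) (auto simp: nn_integral_cmult)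
    also have "\<dots> \<le> 2 * (ennreal (C5 * N\<^sup>2) * emeasure lborel (ball x r)) + 2 * (ennreal (C4\<^sup>2 * N\<^sup>2) * emeasure lborel (ball x r))"
      by (intro add_mono mult_left_mono H K) auto
    also have "\<dots> = (2 * ennreal (C5 * N\<^sup>2) + 2 * ennreal (C4\<^sup>2 * N\<^sup>2)) * emeasure lborel (ball x r)"
      by (simp only: distrib_right mult.assoc)
    also have "2 * ennreal (C5 * N\<^sup>2) + 2 * ennreal (C4\<^sup>2 * N\<^sup>2) = ennreal (C * N\<^sup>2)"
    proof -
      have "2 * ennreal p + 2 * ennreal q = ennreal (2 * p + 2 * q)" if "p \<ge> 0" "q \<ge> 0" for p q
        using that by (simp add: ennreal_plus ennreal_mult)
      note eq = this
      have "C * N\<^sup>2 = 2 * (C5 * N\<^sup>2) + 2 * (C4\<^sup>2 * N\<^sup>2)"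
        by (simp only: C_def distrib_right mult.assoc)
      then show ?thesis
        by (simp only:) (rule eq; use pos' in simp)
    qed
    finally show ?thesis .
  qed
  with C show ?thesis by blast
qed

text \<open>On a time interval starting at \<open>a\<close>, the function is replaced by its
  smoothing at time \<open>e = a / 2\<close>. The remaining time \<open>s = t - e\<close> satisfies
  \<open>t \<le> 2 * s\<close>, so the change of weight costs a factor 2 whatever \<open>a\<close>
  is, and monotone convergence lets \<open>a\<close> tend to 0.\<close>

lemma local_square_function:
  "\<exists>C>0. \<forall>(f::'a::euclidean_space \<Rightarrow> 'b::euclidean_space) N x r. mean_osc_le f N \<longrightarrow> N > 0 \<longrightarrow> r > 0 \<longrightarrow>
     (\<integral>\<^sup>+y\<in>ball x r. (\<integral>\<^sup>+t\<in>{0<..r\<^sup>2}. heat_sq f t y \<partial>lborel) \<partial>lborel)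
       \<le> ennreal (C * N\<^sup>2) * emeasure lborel (ball x r)"
proof -
  obtain C where C: "C > 0" and smooth: "\<And>(v::'a \<Rightarrow> 'b) N x r. continuous_on UNIV v \<Longrightarrow> mean_osc_le v N \<Longrightarrow> N > 0 \<Longrightarrow> r > 0 \<Longrightarrow>
     (\<integral>\<^sup>+t\<in>{0<..r\<^sup>2}. (\<integral>\<^sup>+y\<in>ball x r. heat_sq v t y \<partial>lborel) \<partial>lborel)
       \<le> ennreal (C * N\<^sup>2) * emeasure lborel (ball x r)"
    using local_square_function_continuous[where 'a='a and 'b='b] by blast
  have "(\<integral>\<^sup>+y\<in>ball x r. (\<integral>\<^sup>+t\<in>{0<..r\<^sup>2}. heat_sq f t y \<partial>lborel) \<partial>lborel)
       \<le> ennreal (2 * C * N\<^sup>2) * emeasure lborel (ball x r)"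
    if f: "mean_osc_le f N" and N: "N > 0" and r: "r > 0" for f :: "'a \<Rightarrow> 'b" and N x r
  proof -
    note [measurable] = mean_osc_le_measurable[OF f]
    have [measurable]: "ball x r \<in> sets borel" by simp
    have gf: "gauss_integrable f" by (rule mean_osc_le_imp_gauss_integrable[OF f N])
    define K where "K = ennreal (C * N\<^sup>2) * emeasure lborel (ball x r)"
    define g where "g t = (\<integral>\<^sup>+y\<in>ball x r. heat_sq f t y \<partial>lborel) * indicator {..r\<^sup>2} t" for t
    have gm[measurable]: "g \<in> borel_measurable borel" unfolding g_def by measurable
    have "(\<integral>\<^sup>+y\<in>ball x r. (\<integral>\<^sup>+t\<in>{0<..r\<^sup>2}. heat_sq f t y \<partial>lborel) \<partial>lborel) =
      (\<integral>\<^sup>+y. (\<integral>\<^sup>+t. heat_sq f t y * indicator {0<..r\<^sup>2} t * indicator (ball x r) y \<partial>lborel) \<partial>lborel)"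
      by (intro nn_integral_cong nn_integral_multc[symmetric]) measurable
    also have "\<dots> = (\<integral>\<^sup>+t. (\<integral>\<^sup>+y. heat_sq f t y * indicator {0<..r\<^sup>2} t * indicator (ball x r) y \<partial>lborel) \<partial>lborel)"
      by (rule lborel_pair.Fubini') measurable
    also have "\<dots> = (\<integral>\<^sup>+t\<in>{0<..}. g t \<partial>lborel)"
      by (intro nn_integral_cong) (auto simp: g_def indicator_def)
    also have "\<dots> \<le> 2 * K"
    proof (rule nn_integral_Ioi_le[OF gm])
      fix a b :: real assume ab: "0 < a" "a < b"
      define e where "e = a / 2"
      have e: "e > 0" using ab by (simp add: e_def)
      define v where "v = heat_semigroup e f"
      have v: "mean_osc_le v N" "continuous_on UNIV v"
        unfolding v_def using mean_osc_le_heat_semigroup[OF f gf e] continuous_on_heat_semigroup[OF gf e] by auto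
      note [measurable] = mean_osc_le_measurable[OF v(1)]
      define w where "w t = (\<integral>\<^sup>+y\<in>ball x r. heat_sq v t y \<partial>lborel) * indicator {0<..r\<^sup>2} t" for t
      have wm[measurable]: "w \<in> borel_measurable borel" unfolding w_def by measurable
      have "g t * indicator {a..b} t \<le> 2 * w (- e + t)" for t
      proof (cases "t \<in> {a..b} \<and> t \<le> r\<^sup>2")
        case True
        define s where "s = t - e"
        have s: "s > 0" "t = s + e" "t \<le> 2 * s" "s \<le> r\<^sup>2" using True e ab by (auto simp: s_def e_def)
        have "heat_sq f t y \<le> 2 * ennreal (s * (norm (heat_dt s v y))\<^sup>2)" for y
        proof -
          have D: "heat_dt t f y = heat_dt s v y" unfolding v_def s(2) by (rule heat_dt_heat_semigroup[OF gf s(1) e, symmetric])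
          have "t * (norm (heat_dt s v y))\<^sup>2 \<le> 2 * s * (norm (heat_dt s v y))\<^sup>2"
            using s by (intro mult_right_mono) auto
          from ennreal_leI[OF this] show ?thesis
            using s(1) unfolding D by (simp add: ennreal_mult mult.assoc)
        qed
        then have "(\<integral>\<^sup>+y\<in>ball x r. heat_sq f t y \<partial>lborel) \<le>
          (\<integral>\<^sup>+y. 2 * (ennreal (s * (norm (heat_dt s v y))\<^sup>2) * indicator (ball x r) y) \<partial>lborel)"
          by (intro nn_integral_mono) (simp add: indicator_def)
        also have "\<dots> = 2 * (\<integral>\<^sup>+y\<in>ball x r. ennreal (s * (norm (heat_dt s v y))\<^sup>2) \<partial>lborel)"
          by (rule nn_integral_cmult) measurable
        finally have "(\<integral>\<^sup>+y\<in>ball x r. heat_sq f t y \<partial>lborel) \<le> 2 * w s"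
          using s by (simp add: w_def)
        moreover have "- e + t = s" by (simp add: s_def)
        ultimately show ?thesis using True by (simp add: g_def)
      qed (auto simp: g_def indicator_def)
      then have "(\<integral>\<^sup>+t\<in>{a..b}. g t \<partial>lborel) \<le> (\<integral>\<^sup>+t. 2 * w (- e + t) \<partial>lborel)"
        by (intro nn_integral_mono)
      also have "\<dots> = 2 * (\<integral>\<^sup>+t. w (- e + t) \<partial>lborel)" by (rule nn_integral_cmult) measurable
      also have "(\<integral>\<^sup>+t. w (- e + t) \<partial>lborel) = (\<integral>\<^sup>+t. w t \<partial>lborel)" by (rule nn_integral_translate) measurable
      also have "\<dots> \<le> K" unfolding w_def K_def by (rule smooth[OF v(2) v(1) N r])
      finally show "(\<integral>\<^sup>+t\<in>{a..b}. g t \<partial>lborel) \<le> 2 * K" by (simp add: mult_left_mono)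
    qed
    also have "2 * K = ennreal (2 * C * N\<^sup>2) * emeasure lborel (ball x r)"
      using C by (simp add: K_def ennreal_mult mult.assoc)
    finally show ?thesis .
  qed
  moreover have "2 * C > 0" using C by simp
  ultimately show ?thesis by blast
qed

section \<open>Oscillation of the part with times beyond the squared radius\<close>

lemma heat_dt_diff_le:
  fixes f :: "'a::euclidean_space \<Rightarrow> 'b::euclidean_space"
  assumes f: "mean_osc_le f N" and N: "N > 0" and t: "t > 0" and y: "norm (y - y') \<le> 2 * sqrt t"
  shows "norm (heat_dt t f y - heat_dt t f y') \<le>
    heat_kernel_smooth_const TYPE('a) * heat_osc_const TYPE('a) * N * norm (y - y') / (t * sqrt t)"
proof -
  note fm[measurable] = mean_osc_le_measurable[OF f]
  define A where "A = heat_kernel_smooth_const TYPE('a) * norm (y - y') / (t * sqrt t)"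
  have A: "A \<ge> 0" using t by (simp add: A_def heat_kernel_smooth_const_def)
  have gf: "gauss_integrable f" by (rule mean_osc_le_imp_gauss_integrable[OF f N])
  \<comment> \<open>The smoothness bound involves the kernel at time \<open>4 * t\<close>, so the
    constant to subtract is a centre for the ball whose squared radius is that time.\<close>
  define r where "r = sqrt (4 * t)"
  have r: "r > 0" "r\<^sup>2 = 4 * t" using t by (auto simp: r_def)
  obtain c where c: "(abs_dev f (ball y r) c) \<le> ennreal (2 * N) * emeasure lborel (ball y r)"
    using mean_osc_le_center[OF f N r(1)] by blast
  have gvc: "gauss_integrable (\<lambda>z. f z - c)" by (intro gauss_integrable_diff gauss_integrable_const gf)
  have i: "integrable lborel (\<lambda>z. heat_kernel_dt t (u - z) *\<^sub>R (f z - c))" for u by (rule integrable_heat_kernel_dt[OF gvc t])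
  have "heat_dt t f y - heat_dt t f y' = (LINT z|lborel. (heat_kernel_dt t (y - z) - heat_kernel_dt t (y' - z)) *\<^sub>R (f z - c))"
    using heat_dt_diff_const[OF gf t, of c y] heat_dt_diff_const[OF gf t, of c y'] Bochner_Integration.integral_diff[OF i i, of y y']
    unfolding heat_dt_def by (simp add: scaleR_diff_left)
  moreover have "integrable lborel (\<lambda>z. (heat_kernel_dt t (y - z) - heat_kernel_dt t (y' - z)) *\<^sub>R (f z - c))"
    using Bochner_Integration.integrable_diff[OF i i, of y y'] by (simp add: scaleR_diff_left)
  ultimately have "ennreal (norm (heat_dt t f y - heat_dt t f y')) \<le>
      (\<integral>\<^sup>+z. ennreal (norm ((heat_kernel_dt t (y - z) - heat_kernel_dt t (y' - z)) *\<^sub>R (f z - c))) \<partial>lborel)"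
    using integral_norm_bound_ennreal by metis
  also have "\<dots> \<le> (\<integral>\<^sup>+z. ennreal A * (ennreal (heat_kernel (r\<^sup>2) (y - z)) * ennreal (norm (f z - c))) \<partial>lborel)"
  proof (intro nn_integral_mono)
    fix z
    have "\<bar>heat_kernel_dt t (y - z) - heat_kernel_dt t (y' - z)\<bar> \<le> A * heat_kernel (r\<^sup>2) (y - z)"
      using abs_heat_kernel_dt_diff_le[OF t, of "y - z" "y' - z"] y by (simp add: A_def r(2))
    then have "\<bar>heat_kernel_dt t (y - z) - heat_kernel_dt t (y' - z)\<bar> * norm (f z - c) \<le> A * heat_kernel (r\<^sup>2) (y - z) * norm (f z - c)"
      by (rule mult_right_mono) simp
    then show "ennreal (norm ((heat_kernel_dt t (y - z) - heat_kernel_dt t (y' - z)) *\<^sub>R (f z - c))) \<le>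
      ennreal A * (ennreal (heat_kernel (r\<^sup>2) (y - z)) * ennreal (norm (f z - c)))"
      using A by (simp add: ennreal_mult[symmetric] ennreal_leI mult.assoc)
  qed
  also have "\<dots> = ennreal A * (abs_heat (\<lambda>z. f z - c) (r\<^sup>2) y)"
    by (rule nn_integral_cmult) measurable
  also have "\<dots> \<le> ennreal A * ennreal (heat_osc_const TYPE('a) * N)"
    by (intro mult_left_mono heat_kernel_osc_le[OF f N r(1) c]) auto
  also have "\<dots> = ennreal (A * (heat_osc_const TYPE('a) * N))"
    using A N heat_osc_const_pos[where 'a='a] by (intro ennreal_mult[symmetric]) auto
  finally have "norm (heat_dt t f y - heat_dt t f y') \<le> A * (heat_osc_const TYPE('a) * N)"
    using A N heat_osc_const_pos[where 'a='a] by (subst (asm) ennreal_le_iff) auto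
  then show ?thesis by (simp add: A_def ac_simps)
qed

lemma nn_integral_inverse_square:
  assumes "a > 0"
  shows "(\<integral>\<^sup>+t\<in>{a<..}. ennreal (1 / t\<^sup>2) \<partial>lborel) \<le> ennreal (1 / a)"
proof -
  have "(\<integral>\<^sup>+t\<in>{a<..}. ennreal (1 / t\<^sup>2) \<partial>lborel) \<le> (\<integral>\<^sup>+t\<in>{a..}. ennreal (1 / t\<^sup>2) \<partial>lborel)"
    by (intro nn_integral_mono) (auto simp: indicator_def)
  also have "\<dots> = ennreal (0 - (- (1 / a)))"
  proof (rule nn_integral_FTC_atLeast)
    show "((\<lambda>t::real. - (1 / t)) \<longlongrightarrow> 0) at_top"
    proof -
      have "((\<lambda>t::real. inverse t) \<longlongrightarrow> 0) at_top" by (rule tendsto_inverse_0_at_top[OF filterlim_ident])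
      from tendsto_minus[OF this] show ?thesis by (simp add: inverse_eq_divide)
    qed
    show "((\<lambda>t::real. - (1 / t)) has_real_derivative 1 / t\<^sup>2) (at t)" if "a \<le> t" for t
      using that assms by (auto intro!: derivative_eq_intros simp: power2_eq_square)
  qed auto
  finally show ?thesis by simp
qed

text \<open>The difference of the derivatives is of size \<open>r / t^(3/2)\<close>, so its weighted
  square is of size \<open>r^2 / t^2\<close>, whose integral over \<open>t > r^2\<close> is bounded
  independently of \<open>r\<close>. The same range of \<open>t\<close> ensures that points of the
  ball are within \<open>2 * sqrt t\<close> of each other, as the smoothness bound requires.\<close>

lemma far_square_function_diff:
  fixes f :: "'a::euclidean_space \<Rightarrow> 'b::euclidean_space"
  assumes f: "mean_osc_le f N" and N: "N > 0" and r: "r > 0" and y: "y \<in> ball x r" "y' \<in> ball x r"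
  shows "(\<integral>\<^sup>+t\<in>{r\<^sup>2<..}. ennreal (t * (norm (heat_dt t f y - heat_dt t f y'))\<^sup>2) \<partial>lborel)
    \<le> ennreal ((2 * heat_kernel_smooth_const TYPE('a) * heat_osc_const TYPE('a) * N)\<^sup>2)"
proof -
  define A where "A = heat_kernel_smooth_const TYPE('a) * heat_osc_const TYPE('a) * N"
  have A: "A \<ge> 0"
    using N heat_osc_const_pos[where 'a='a] by (simp add: A_def heat_kernel_smooth_const_def)
  have yy: "norm (y - y') \<le> 2 * r"
    using y dist_triangle2[of y y' x] by (simp add: dist_norm norm_minus_commute)
  have "(\<integral>\<^sup>+t\<in>{r\<^sup>2<..}. ennreal (t * (norm (heat_dt t f y - heat_dt t f y'))\<^sup>2) \<partial>lborel) \<le>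
    (\<integral>\<^sup>+t. ennreal ((2 * A * r)\<^sup>2) * (ennreal (1 / t\<^sup>2) * indicator {r\<^sup>2<..} t) \<partial>lborel)"
  proof (intro nn_integral_mono)
    fix t :: real
    show "ennreal (t * (norm (heat_dt t f y - heat_dt t f y'))\<^sup>2) * indicator {r\<^sup>2<..} t \<le>
      ennreal ((2 * A * r)\<^sup>2) * (ennreal (1 / t\<^sup>2) * indicator {r\<^sup>2<..} t)"
    proof (cases "t > r\<^sup>2")
      case True
      moreover have "r\<^sup>2 > 0" using r by simp
      ultimately have t: "t > 0" by linarith
      have "r \<le> sqrt t" using True r by (intro real_le_rsqrt) auto
      then have "norm (heat_dt t f y - heat_dt t f y') \<le> A * norm (y - y') / (t * sqrt t)"
        unfolding A_def using yy t by (intro heat_dt_diff_le[OF f N]) auto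
      also have "\<dots> \<le> A * (2 * r) / (t * sqrt t)"
        using A t yy by (intro divide_right_mono mult_left_mono) auto
      finally have "(norm (heat_dt t f y - heat_dt t f y'))\<^sup>2 \<le> (A * (2 * r) / (t * sqrt t))\<^sup>2"
        by (intro power_mono) auto
      then have "t * (norm (heat_dt t f y - heat_dt t f y'))\<^sup>2 \<le> t * (A * (2 * r) / (t * sqrt t))\<^sup>2"
        using t by (intro mult_left_mono) auto
      also have "\<dots> = (2 * A * r)\<^sup>2 * (1 / t\<^sup>2)"
        using t by (simp add: power_divide power_mult_distrib power2_eq_square)
      finally show ?thesis using True by (simp add: ennreal_mult[symmetric] ennreal_leI)
    qed simp
  qed
  also have "\<dots> = ennreal ((2 * A * r)\<^sup>2) * (\<integral>\<^sup>+t\<in>{r\<^sup>2<..}. ennreal (1 / t\<^sup>2) \<partial>lborel)"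
    by (rule nn_integral_cmult) measurable
  also have "\<dots> \<le> ennreal ((2 * A * r)\<^sup>2) * ennreal (1 / r\<^sup>2)"
    using r by (intro mult_left_mono nn_integral_inverse_square) auto
  also have "\<dots> = ennreal ((2 * A)\<^sup>2)"
    using r by (subst ennreal_mult[symmetric]) (auto simp: power_mult_distrib)
  finally show ?thesis by (simp add: A_def mult.assoc)
qed

section \<open>From mean oscillation to BLO\<close>

lemma lebesgue_ex_borel_measurable:
  fixes f :: "'a::euclidean_space \<Rightarrow> 'b::euclidean_space"
  assumes f: "f \<in> borel_measurable lebesgue"
  obtains f' where "f' \<in> borel_measurable borel" "AE x in lebesgue. f x = f' x"
proof -
  have "\<exists>g. g \<in> borel_measurable lborel \<and> (AE x in lborel. f x \<bullet> i = g x)" for i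
    using completion_ex_borel_measurable_real[of "\<lambda>x. f x \<bullet> i" lborel] f by auto
  then obtain g where g: "\<And>i. g i \<in> borel_measurable lborel" "\<And>i. AE x in lborel. f x \<bullet> i = g i x"
    by metis
  note [measurable] = g(1)
  have "(\<lambda>x. \<Sum>i\<in>Basis. g i x *\<^sub>R i) \<in> borel_measurable borel"
    using g(1) by simp
  moreover have "AE x in lborel. \<forall>i\<in>(Basis::'b set). f x \<bullet> i = g i x"
    using g(2) by (intro AE_finite_allI) auto
  then have "AE x in lborel. f x = (\<Sum>i\<in>Basis. g i x *\<^sub>R i)"
  proof eventually_elim
    case (elim x)
    then have "(\<Sum>i\<in>Basis. g i x *\<^sub>R i) = (\<Sum>i\<in>Basis. (f x \<bullet> i) *\<^sub>R i)" by (intro sum.cong) auto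
    then show ?case by (simp add: euclidean_representation)
  qed
  then have "AE x in lebesgue. f x = (\<Sum>i\<in>Basis. g i x *\<^sub>R i)" by (rule AE_completion)
  ultimately show ?thesis using that by blast
qed

lemma locally_integrable_imp_measurable:
  fixes f :: "'a::euclidean_space \<Rightarrow> 'b::{banach, second_countable_topology}"
  assumes "locally_integrable f"
  shows "f \<in> borel_measurable lebesgue"
proof (rule borel_measurable_LIMSEQ_metric)
  fix i :: nat
  have "f absolutely_integrable_on cball 0 (real i)" using assms by (auto simp: locally_integrable_def)
  then show "(\<lambda>x. indicator (cball 0 (real i)) x *\<^sub>R f x) \<in> borel_measurable lebesgue"
    unfolding set_integrable_def by (rule borel_measurable_integrable)
next
  fix x :: 'a
  obtain k :: nat where k: "norm x \<le> real k" using real_arch_simple by blast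
  have "\<forall>\<^sub>F i in sequentially. indicator (cball 0 (real i)) x *\<^sub>R f x = f x"
    using eventually_ge_at_top[of k]
  proof eventually_elim
    case (elim i)
    then have "norm x \<le> real i" using k by linarith
    then show ?case by simp
  qed
  then show "(\<lambda>i. indicator (cball 0 (real i)) x *\<^sub>R f x) \<longlonglongrightarrow> f x"
    by (rule tendsto_eventually)
qed

text \<open>Inserting the average between the two points costs the factor 2. The average enters only
  as some constant, so replacing \<open>f\<close> by its Borel representative affects just the
  integral of the deviation.\<close>

lemma bmo_imp_mean_osc_le:
  fixes f f' :: "'a::euclidean_space \<Rightarrow> 'b::euclidean_space"
  assumes f'[measurable]: "f' \<in> borel_measurable borel" and ae: "AE x in lebesgue. f x = f' x"
    and N: "bmo_norm f \<le> ennreal N" "N \<ge> 0"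
  shows "mean_osc_le f' (2 * N)"
  unfolding mean_osc_le_def
proof (intro conjI allI impI)
  fix x :: 'a and r :: real assume r: "r > 0"
  let ?B = "ball x r"
  have [measurable]: "?B \<in> sets borel" by simp
  define b where "b = measure lborel ?B"
  have b: "b > 0" "emeasure lborel ?B = ennreal b"
    using content_ball_pos[OF r, of x] emeasure_lborel_ball_eq_measure[of x r] by (simp_all add: b_def)
  define c where "c = average ?B f"
  have "?B \<in> balls" using r by (auto simp: balls_def)
  then have "(\<integral>\<^sup>+y\<in>?B. ennreal (norm (f y - c)) \<partial>lebesgue) / emeasure lebesgue ?B \<le> bmo_norm f"
    unfolding bmo_norm_def c_def by (rule SUP_upper)
  also note N(1)
  finally have "(\<integral>\<^sup>+y\<in>?B. ennreal (norm (f y - c)) \<partial>lebesgue) / ennreal b \<le> ennreal N"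
    using b(2) by simp
  then have "(\<integral>\<^sup>+y\<in>?B. ennreal (norm (f y - c)) \<partial>lebesgue) / ennreal b * ennreal b \<le> ennreal N * ennreal b"
    by (rule mult_right_mono) simp
  then have "(\<integral>\<^sup>+y\<in>?B. ennreal (norm (f y - c)) \<partial>lebesgue) \<le> ennreal N * ennreal b"
  proof -
    have "inverse (ennreal b) * ennreal b = 1"
      using b(1) by (simp add: inverse_ennreal ennreal_mult[symmetric])
    moreover assume "(\<integral>\<^sup>+y\<in>?B. ennreal (norm (f y - c)) \<partial>lebesgue) / ennreal b * ennreal b \<le> ennreal N * ennreal b"
    ultimately show ?thesis by (simp add: divide_ennreal_def mult.assoc)
  qed
  also have "(\<integral>\<^sup>+y\<in>?B. ennreal (norm (f y - c)) \<partial>lebesgue) = (\<integral>\<^sup>+y\<in>?B. ennreal (norm (f' y - c)) \<partial>lebesgue)"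
    using ae by (intro nn_integral_cong_AE) auto
  also have "\<dots> = (abs_dev f' ?B c)"
    by (rule nn_integral_completion)
  finally have J: "(abs_dev f' ?B c) \<le> ennreal N * ennreal b" .
  have inner: "(\<integral>\<^sup>+z\<in>?B. ennreal (norm (f' y - f' z)) \<partial>lborel) \<le> ennreal N * ennreal b + ennreal (norm (f' y - c)) * ennreal b" for y
  proof -
    have "(\<integral>\<^sup>+z\<in>?B. ennreal (norm (f' y - f' z)) \<partial>lborel) = (abs_dev f' ?B (f' y))"
      by (simp add: norm_minus_commute)
    also have "\<dots> \<le> (abs_dev f' ?B c) + ennreal (norm (c - f' y)) * emeasure lborel ?B"
      by (rule nn_integral_recenter) measurable
    also have "\<dots> \<le> ennreal N * ennreal b + ennreal (norm (f' y - c)) * ennreal b"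
      using J by (simp add: b(2) norm_minus_commute add_right_mono)
    finally show ?thesis .
  qed
  have "(\<integral>\<^sup>+y\<in>?B. (\<integral>\<^sup>+z\<in>?B. ennreal (norm (f' y - f' z)) \<partial>lborel) \<partial>lborel) \<le>
    (\<integral>\<^sup>+y. ennreal N * ennreal b * indicator ?B y + (ennreal (norm (f' y - c)) * indicator ?B y) * ennreal b \<partial>lborel)"
    using inner by (intro nn_integral_mono) (simp add: indicator_def)
  also have "\<dots> = ennreal N * ennreal b * ennreal b + (abs_dev f' ?B c) * ennreal b"
    by (subst nn_integral_add) (auto simp: nn_integral_cmult_indicator nn_integral_multc b(2))
  also have "\<dots> \<le> ennreal N * ennreal b * ennreal b + ennreal N * ennreal b * ennreal b"
    by (intro add_left_mono mult_right_mono J) auto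
  also have "\<dots> = ennreal (2 * N) * (ennreal b)\<^sup>2"
  proof -
    have "ennreal (2 * N) = ennreal N + ennreal N" using N(2) by (simp add: ennreal_plus[symmetric] del: ennreal_plus)
    then show ?thesis by (simp add: distrib_right power2_eq_square mult.assoc)
  qed
  finally show "(\<integral>\<^sup>+y\<in>?B. (\<integral>\<^sup>+z\<in>?B. ennreal (norm (f' y - f' z)) \<partial>lborel) \<partial>lborel) \<le> ennreal (2 * N) * (emeasure lborel ?B)\<^sup>2"
    by (simp add: b(2))
qed fact

definition square_function :: "('a::euclidean_space \<Rightarrow> 'b::{banach, second_countable_topology}) \<Rightarrow> 'a \<Rightarrow> ennreal" where
  "square_function f y = (\<integral>\<^sup>+t\<in>{0<..}. heat_sq f t y \<partial>lborel)"

lemma square_function_measurable [measurable]: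
  assumes [measurable]: "f \<in> borel_measurable borel"
  shows "square_function f \<in> borel_measurable borel"
  unfolding square_function_def by measurable

text \<open>The semigroup is an integral and therefore the same for \<open>f\<close> and its Borel
  representative at every point and time. Hence the identity holds everywhere, not just almost
  everywhere.\<close>

lemma g_function_eq:
  assumes gf: "gauss_integrable f'" and f: "f \<in> borel_measurable lebesgue" and ae: "AE x in lebesgue. f x = f' x"
  shows "g_function f y = ennreal_sqrt (square_function f' y)"
proof -
  note [measurable] = gauss_integrable_measurable[OF gf]
  have sg: "heat_semigroup s f y = heat_semigroup s f' y" for s
    unfolding heat_semigroup_def
  proof (rule integral_cong_AE)
    have "(\<lambda>z. heat_kernel s (y - z)) \<in> borel_measurable lborel" by measurable
    then have k: "(\<lambda>z. heat_kernel s (y - z)) \<in> borel_measurable lebesgue" by (rule measurable_completion)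
    show "(\<lambda>z. heat_kernel s (y - z) *\<^sub>R f z) \<in> borel_measurable lebesgue"
      by (intro borel_measurable_scaleR k f)
    show "(\<lambda>z. heat_kernel s (y - z) *\<^sub>R f' z) \<in> borel_measurable lebesgue"
      by (rule measurable_completion) measurable
    show "AE z in lebesgue. heat_kernel s (y - z) *\<^sub>R f z = heat_kernel s (y - z) *\<^sub>R f' z"
      using ae by eventually_elim simp
  qed
  have "(\<integral>\<^sup>+t\<in>{0<..}. ennreal ((norm (t *\<^sub>R vector_derivative (\<lambda>s. heat_semigroup s f y) (at t)))\<^sup>2 / t) \<partial>lebesgue) =
    (\<integral>\<^sup>+t\<in>{0<..}. heat_sq f' t y \<partial>lebesgue)"
  proof (intro nn_integral_cong)
    fix t :: real
    show "ennreal ((norm (t *\<^sub>R vector_derivative (\<lambda>s. heat_semigroup s f y) (at t)))\<^sup>2 / t) * indicator {0<..} t =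
      heat_sq f' t y * indicator {0<..} t"
    proof (cases "t > 0")
      case True
      then have "vector_derivative (\<lambda>s. heat_semigroup s f y) (at t) = heat_dt t f' y"
        unfolding sg by (intro vector_derivative_at has_vector_derivative_heat_semigroup gf)
      then show ?thesis using True by (simp add: power_mult_distrib power2_eq_square)
    qed simp
  qed
  also have "\<dots> = square_function f' y"
    unfolding square_function_def by (rule nn_integral_completion)
  finally show ?thesis by (simp add: g_function_def)
qed

lemma enn2real_ennreal_sqrt: "enn2real (ennreal_sqrt a) = sqrt (enn2real a)"
  by (simp add: ennreal_sqrt_def)

text \<open>The choice \<open>\<theta> = z / sqrt a\<close> would turn the bound into
  \<open>(sqrt a + z)^2\<close>; adding \<open>e\<close> to \<open>sqrt a\<close> avoids division by
  zero. Together with \<open>norm_power2_le_weighted\<close>, integrated in \<open>t\<close>, this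
  yields the triangle inequality for the L2 norm weighted by \<open>t\<close>.\<close>

lemma sqrt_le_add_of_weighted:
  assumes "a \<ge> 0" "z > 0" and le: "\<And>\<theta>. \<theta> > 0 \<Longrightarrow> b \<le> (1 + \<theta>) * a + (1 + 1 / \<theta>) * z\<^sup>2"
  shows "sqrt b \<le> sqrt a + z"
proof (rule field_le_epsilon)
  fix e :: real assume e: "e > 0"
  define w where "w = sqrt a + e"
  have w: "w > 0" using assms e by (simp add: w_def add_nonneg_pos)
  have "(sqrt a)\<^sup>2 \<le> w\<^sup>2" using assms e unfolding w_def by (intro power_mono) auto
  then have aw: "a \<le> w\<^sup>2" using assms by simp
  have "b \<le> (1 + z / w) * a + (1 + 1 / (z / w)) * z\<^sup>2" using assms w by (intro le) auto
  also have "\<dots> \<le> (1 + z / w) * w\<^sup>2 + (1 + 1 / (z / w)) * z\<^sup>2"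
    using aw w assms by (intro add_right_mono mult_left_mono) auto
  also have "\<dots> = (w + z)\<^sup>2"
    using w assms by (simp add: field_simps power2_eq_square)
  finally have "sqrt b \<le> w + z" using w assms by (intro real_le_lsqrt) auto
  then show "sqrt b \<le> sqrt a + z + e" by (simp add: w_def)
qed

lemma norm_power2_le_weighted:
  fixes u v :: "'a::real_normed_vector"
  assumes "\<theta> > 0"
  shows "(norm u)\<^sup>2 \<le> (1 + \<theta>) * (norm v)\<^sup>2 + (1 + 1 / \<theta>) * (norm (u - v))\<^sup>2"
proof -
  define p q where "p = norm v" and "q = norm (u - v)"
  have "(norm u)\<^sup>2 \<le> (p + q)\<^sup>2"
    using norm_triangle_sub[of u v] unfolding p_def q_def by (intro power_mono) auto
  also have "\<dots> \<le> (1 + \<theta>) * p\<^sup>2 + (1 + 1 / \<theta>) * q\<^sup>2"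
  proof -
    have "0 \<le> (\<theta> * p - q)\<^sup>2 / \<theta>" using assms by simp
    also have "\<dots> = \<theta> * p\<^sup>2 + q\<^sup>2 / \<theta> - 2 * p * q"
      using assms by (simp add: power2_eq_square field_simps)
    finally show ?thesis by (simp add: power2_eq_square algebra_simps)
  qed
  finally show ?thesis by (simp add: p_def q_def)
qed

text \<open>Subadditivity of the square root separates local and far part at \<open>y\<close>, the
  far part is moved to \<open>y'\<close>, and there it is at most the full square function. Since
  \<open>enn2real\<close> sends infinity to 0, finiteness is what allows the sums and comparisons to
  pass to the reals.\<close>

lemma sqrt_square_function_le:
  fixes f :: "'a::euclidean_space \<Rightarrow> 'b::euclidean_space"
  assumes f: "mean_osc_le f N" and N: "N > 0" and r: "r > 0" and y: "y \<in> ball x r" "y' \<in> ball x r"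
    and fin: "square_function f y < \<infinity>" "square_function f y' < \<infinity>"
    and z: "z > 0" "2 * heat_kernel_smooth_const TYPE('a) * heat_osc_const TYPE('a) * N \<le> z"
  shows "sqrt (enn2real (square_function f y)) \<le>
    sqrt (enn2real (\<integral>\<^sup>+t\<in>{0<..r\<^sup>2}. heat_sq f t y \<partial>lborel)) + z + sqrt (enn2real (square_function f y'))"
proof -
  note [measurable] = mean_osc_le_measurable[OF f]
  define L where "L y = (\<integral>\<^sup>+t\<in>{0<..r\<^sup>2}. heat_sq f t y \<partial>lborel)" for y
  define F where "F y = (\<integral>\<^sup>+t\<in>{r\<^sup>2<..}. heat_sq f t y \<partial>lborel)" for y
  have LF: "square_function f y = L y + F y" for y
  proof -
    have "indicator {0<..} t = (indicator {0<..r\<^sup>2} t + indicator {r\<^sup>2<..} t :: ennreal)" for t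
    proof -
      have "r\<^sup>2 > 0" using r by simp
      then have "t > 0" if "r\<^sup>2 < t" using that by linarith
      then show ?thesis by (auto simp: indicator_def)
    qed
    then have "square_function f y = (\<integral>\<^sup>+t. heat_sq f t y * indicator {0<..r\<^sup>2} t + heat_sq f t y * indicator {r\<^sup>2<..} t \<partial>lborel)"
      unfolding square_function_def by (simp add: distrib_left)
    also have "\<dots> = L y + F y" unfolding L_def F_def by (rule nn_integral_add) measurable
    finally show ?thesis .
  qed
  have fin': "L y < \<infinity>" "F y < \<infinity>" "F y' < \<infinity>" using fin unfolding LF by auto
  have z0: "2 * heat_kernel_smooth_const TYPE('a) * heat_osc_const TYPE('a) * N \<ge> 0"
    using N heat_osc_const_pos[where 'a='a] by (simp add: heat_kernel_smooth_const_def)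
  have far: "(\<integral>\<^sup>+t\<in>{r\<^sup>2<..}. ennreal (t * (norm (heat_dt t f y - heat_dt t f y'))\<^sup>2) \<partial>lborel) \<le> ennreal (z\<^sup>2)"
    by (rule order_trans[OF far_square_function_diff[OF f N r y]]) (intro ennreal_leI power_mono z z0)
  have "sqrt (enn2real (F y)) \<le> sqrt (enn2real (F y')) + z"
  proof (rule sqrt_le_add_of_weighted)
    fix \<theta> :: real assume \<theta>: "\<theta> > 0"
    have "F y \<le> (\<integral>\<^sup>+t. ennreal (1 + \<theta>) * (heat_sq f t y' * indicator {r\<^sup>2<..} t) +
      ennreal (1 + 1 / \<theta>) * (ennreal (t * (norm (heat_dt t f y - heat_dt t f y'))\<^sup>2) * indicator {r\<^sup>2<..} t) \<partial>lborel)"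
      unfolding F_def
    proof (intro nn_integral_mono)
      fix t :: real
      show "heat_sq f t y * indicator {r\<^sup>2<..} t \<le>
        ennreal (1 + \<theta>) * (heat_sq f t y' * indicator {r\<^sup>2<..} t) +
        ennreal (1 + 1 / \<theta>) * (ennreal (t * (norm (heat_dt t f y - heat_dt t f y'))\<^sup>2) * indicator {r\<^sup>2<..} t)"
      proof (cases "t > r\<^sup>2")
        case True
        moreover have "r\<^sup>2 > 0" using r by simp
        ultimately have t: "t > 0" by linarith
        have "t * (norm (heat_dt t f y))\<^sup>2 \<le> t * ((1 + \<theta>) * (norm (heat_dt t f y'))\<^sup>2 + (1 + 1 / \<theta>) * (norm (heat_dt t f y - heat_dt t f y'))\<^sup>2)"
          using t by (intro mult_left_mono norm_power2_le_weighted \<theta>) auto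
        also have "\<dots> = (1 + \<theta>) * (t * (norm (heat_dt t f y'))\<^sup>2) + (1 + 1 / \<theta>) * (t * (norm (heat_dt t f y - heat_dt t f y'))\<^sup>2)"
          by (simp only: distrib_left mult.left_commute)
        finally have "heat_sq f t y \<le> ennreal \<dots>" by (rule ennreal_leI)
        also have "\<dots> = ennreal (1 + \<theta>) * heat_sq f t y' + ennreal (1 + 1 / \<theta>) * ennreal (t * (norm (heat_dt t f y - heat_dt t f y'))\<^sup>2)"
          using t \<theta> by (subst ennreal_plus) (auto simp: ennreal_mult simp del: ennreal_plus)
        finally show ?thesis using True by simp
      qed simp
    qed
    also have "\<dots> = ennreal (1 + \<theta>) * F y' + ennreal (1 + 1 / \<theta>) * (\<integral>\<^sup>+t\<in>{r\<^sup>2<..}. ennreal (t * (norm (heat_dt t f y - heat_dt t f y'))\<^sup>2) \<partial>lborel)"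
      unfolding F_def by (subst nn_integral_add, measurable, subst (1 2) nn_integral_cmult, measurable)
    also have "\<dots> \<le> ennreal (1 + \<theta>) * ennreal (enn2real (F y')) + ennreal (1 + 1 / \<theta>) * ennreal (z\<^sup>2)"
      using fin'(3) far by (intro add_mono mult_left_mono) auto
    also have "\<dots> = ennreal ((1 + \<theta>) * enn2real (F y') + (1 + 1 / \<theta>) * z\<^sup>2)"
      using \<theta> by (subst ennreal_plus) (auto simp: ennreal_mult simp del: ennreal_plus)
    finally have "F y \<le> \<dots>" .
    then show "enn2real (F y) \<le> (1 + \<theta>) * enn2real (F y') + (1 + 1 / \<theta>) * z\<^sup>2"
      using \<theta> by (intro enn2real_leI) auto
  qed (use z in auto)
  moreover have "sqrt (enn2real (F y')) \<le> sqrt (enn2real (square_function f y'))"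
    using fin(2) unfolding LF by (intro real_sqrt_le_mono enn2real_mono) auto
  moreover have "sqrt (enn2real (square_function f y)) \<le> sqrt (enn2real (L y)) + sqrt (enn2real (F y))"
    using fin'(1,2) unfolding LF by (simp add: enn2real_plus sqrt_add_le_add_sqrt)
  ultimately show ?thesis unfolding L_def by linarith
qed

text \<open>Integrates \<open>sqrt l \<le> l / z + z\<close>, a substitute for the Cauchy--Schwarz
  inequality. With \<open>z\<close> proportional to \<open>N\<close>, a quadratic bound on the mean
  of \<open>L\<close> becomes a linear bound on the mean of its root.\<close>

lemma nn_integral_sqrt_le:
  fixes L :: "'a \<Rightarrow> ennreal"
  assumes [measurable]: "L \<in> borel_measurable M" "B \<in> sets M" and z: "z > 0"
  shows "(\<integral>\<^sup>+y\<in>B. ennreal (sqrt (enn2real (L y))) \<partial>M) \<le> ennreal (1 / z) * (\<integral>\<^sup>+y\<in>B. L y \<partial>M) + ennreal z * emeasure M B"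
proof -
  have "ennreal (sqrt (enn2real a)) \<le> ennreal (1 / z) * a + ennreal z" for a
  proof (cases a)
    case (real l)
    have "0 \<le> (sqrt l - z)\<^sup>2" by simp
    also have "\<dots> = l - 2 * sqrt l * z + z\<^sup>2" using real by (simp add: power2_diff)
    finally have "2 * (sqrt l * z) \<le> l + z * z" by (simp add: power2_eq_square)
    moreover have "sqrt l * z \<ge> 0" using real z by simp
    ultimately have "sqrt l * z \<le> l + z * z" by linarith
    then have "sqrt l \<le> (l + z * z) / z" using z by (simp add: pos_le_divide_eq)
    then have "sqrt l \<le> 1 / z * l + z" using z by (simp add: add_divide_distrib)
    then have "ennreal (sqrt l) \<le> ennreal (1 / z * l + z)" by (rule ennreal_leI)
    also have "\<dots> = ennreal (1 / z * l) + ennreal z" using real(1) z by (intro ennreal_plus) auto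
    also have "ennreal (1 / z * l) = ennreal (1 / z) * ennreal l" using real(1) z by (intro ennreal_mult) auto
    finally show ?thesis
      unfolding real(2) using real(1) by (simp only: enn2real_ennreal)
  next
    case top
    have "ennreal (1 / z) > 0" using z by simp
    then show ?thesis using top by (simp add: ennreal_mult_top)
  qed
  then have "(\<integral>\<^sup>+y\<in>B. ennreal (sqrt (enn2real (L y))) \<partial>M) \<le> (\<integral>\<^sup>+y. ennreal (1 / z) * (L y * indicator B y) + ennreal z * indicator B y \<partial>M)"
    by (intro nn_integral_mono) (simp add: indicator_def)
  also have "\<dots> = ennreal (1 / z) * (\<integral>\<^sup>+y\<in>B. L y \<partial>M) + ennreal z * emeasure M B"
    by (subst nn_integral_add) (auto simp: nn_integral_cmult nn_integral_cmult_indicator)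
  finally show ?thesis .
qed

lemma square_function_blo:
  "\<exists>C>0. \<forall>(f::'a::euclidean_space \<Rightarrow> 'b::euclidean_space) N. mean_osc_le f N \<longrightarrow> N > 0 \<longrightarrow> (AE y in lborel. square_function f y < \<infinity>) \<longrightarrow>
     locally_integrable (\<lambda>y. sqrt (enn2real (square_function f y))) \<and>
     blo_norm (\<lambda>y. sqrt (enn2real (square_function f y))) \<le> ennreal (C * N)"
proof -
  obtain C where C: "C > 0" and loc: "\<And>(f::'a \<Rightarrow> 'b) N x r. mean_osc_le f N \<Longrightarrow> N > 0 \<Longrightarrow> r > 0 \<Longrightarrow>
     (\<integral>\<^sup>+y\<in>ball x r. (\<integral>\<^sup>+t\<in>{0<..r\<^sup>2}. heat_sq f t y \<partial>lborel) \<partial>lborel)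
       \<le> ennreal (C * N\<^sup>2) * emeasure lborel (ball x r)"
    using local_square_function[where 'a='a and 'b='b] by blast
  define Z where "Z = 2 * heat_kernel_smooth_const TYPE('a) * heat_osc_const TYPE('a) + 1"
  have Z: "Z > 0" "2 * heat_kernel_smooth_const TYPE('a) * heat_osc_const TYPE('a) \<le> Z"
    using heat_osc_const_pos[where 'a='a] by (auto simp: Z_def heat_kernel_smooth_const_def add_nonneg_pos)
  \<comment> \<open>For \<open>z = Z * N\<close> the local part contributes \<open>C / Z\<close> and
    one \<open>Z\<close> through \<open>nn_integral_sqrt_le\<close>; the other \<open>Z\<close> is
    the far oscillation.\<close>
  define C' where "C' = C / Z + 2 * Z"
  have C': "C' > 0" using C Z by (simp add: C'_def add_pos_pos)
  have main: "locally_integrable (\<lambda>y. sqrt (enn2real (square_function f y))) \<and>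
     blo_norm (\<lambda>y. sqrt (enn2real (square_function f y))) \<le> ennreal (C' * N)"
    if f: "mean_osc_le f N" and N: "N > 0" and ae: "AE y in lborel. square_function f y < \<infinity>" for f :: "'a \<Rightarrow> 'b" and N
  proof -
    note [measurable] = mean_osc_le_measurable[OF f]
    define z where "z = Z * N"
    have z: "z > 0" "2 * heat_kernel_smooth_const TYPE('a) * heat_osc_const TYPE('a) * N \<le> z"
      using Z N by (auto simp: z_def intro!: mult_right_mono)
    define \<Gamma> where "\<Gamma> y = sqrt (enn2real (square_function f y))" for y
    have \<Gamma>0: "\<Gamma> y \<ge> 0" for y by (simp add: \<Gamma>_def)
    have \<Gamma>m[measurable]: "\<Gamma> \<in> borel_measurable borel" unfolding \<Gamma>_def by measurable
    define L where "L r y = (\<integral>\<^sup>+t\<in>{0<..r\<^sup>2}. heat_sq f t y \<partial>lborel)" for r y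
    have Lm[measurable]: "L r \<in> borel_measurable borel" for r unfolding L_def by measurable
    \<comment> \<open>\<open>\<Lambda> r y\<close> bounds the excess of \<open>\<Gamma> y\<close>
      over its value at any other point of the ball with finite square function, hence over the
      essential infimum. It does not involve that other point, so only its mean remains to be
      estimated.\<close>
    define \<Lambda> where "\<Lambda> r y = sqrt (enn2real (L r y)) + z" for r y
    have \<Lambda>m[measurable]: "\<Lambda> r \<in> borel_measurable borel" for r unfolding \<Lambda>_def by measurable
    have \<Lambda>0: "\<Lambda> r y \<ge> 0" for r y using z by (simp add: \<Lambda>_def)
    have comp: "\<Gamma> y \<le> \<Lambda> r y + \<Gamma> y'"
      if "r > 0" "y \<in> ball x r" "y' \<in> ball x r" "square_function f y < \<infinity>" "square_function f y' < \<infinity>" for x r y y'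
      unfolding \<Gamma>_def \<Lambda>_def L_def using sqrt_square_function_le[OF f N that z] .
    have int\<Lambda>: "(\<integral>\<^sup>+y\<in>ball x r. ennreal (\<Lambda> r y) \<partial>lborel) \<le> ennreal (C' * N) * emeasure lborel (ball x r)" if r: "r > 0" for x r
    proof -
      have [measurable]: "ball x r \<in> sets lborel" by simp
      have "(\<integral>\<^sup>+y\<in>ball x r. ennreal (\<Lambda> r y) \<partial>lborel) = (\<integral>\<^sup>+y\<in>ball x r. ennreal (sqrt (enn2real (L r y))) \<partial>lborel) + ennreal z * emeasure lborel (ball x r)"
        unfolding \<Lambda>_def using z
        by (simp add: distrib_right nn_integral_add nn_integral_cmult_indicator)
      also have "\<dots> \<le> (ennreal (1 / z) * (\<integral>\<^sup>+y\<in>ball x r. L r y \<partial>lborel) + ennreal z * emeasure lborel (ball x r)) + ennreal z * emeasure lborel (ball x r)"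
        using z by (intro add_right_mono nn_integral_sqrt_le) auto
      also have "\<dots> \<le> (ennreal (1 / z) * (ennreal (C * N\<^sup>2) * emeasure lborel (ball x r)) + ennreal z * emeasure lborel (ball x r)) + ennreal z * emeasure lborel (ball x r)"
        unfolding L_def by (intro add_right_mono mult_left_mono loc[OF f N r]) auto
      also have "\<dots> = (ennreal (1 / z) * ennreal (C * N\<^sup>2) + ennreal z + ennreal z) * emeasure lborel (ball x r)"
        by (simp only: distrib_right mult.assoc)
      also have "ennreal (1 / z) * ennreal (C * N\<^sup>2) + ennreal z + ennreal z = ennreal (1 / z * (C * N\<^sup>2) + z + z)"
        using z C by (simp add: ennreal_mult[symmetric] ennreal_plus[symmetric] del: ennreal_plus)
      also have "1 / z * (C * N\<^sup>2) + z + z = C' * N"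
        using Z N by (simp add: z_def C'_def power2_eq_square distrib_right)
      finally show ?thesis .
    qed
    have ex: "\<exists>y'\<in>ball x r. square_function f y' < \<infinity>" if r: "r > 0" for x r
    proof (rule ccontr)
      assume neg: "\<not> ?thesis"
      have "AE y in lborel. y \<notin> ball x r" using ae by eventually_elim (use neg in auto)
      then have "emeasure lborel (ball x r) = 0" by (subst (asm) AE_iff_measurable[of "ball x r"]) auto
      then show False using emeasure_ball_pos[OF r, of x] by simp
    qed
    \<comment> \<open>A single point \<open>y'\<close> with finite value controls
      \<open>\<Gamma>\<close> almost everywhere on a ball containing \<open>K\<close>, up to the
      function \<open>\<Lambda> r\<close>, which is integrable there.\<close>
    have "locally_integrable \<Gamma>"
      unfolding locally_integrable_def
    proof (intro allI impI)
      fix K :: "'a set" assume K: "compact K"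
      then obtain r0 where r0: "K \<subseteq> ball 0 r0" using compact_imp_bounded bounded_subset_ballD by blast
      define r where "r = max r0 1"
      have r: "r > 0" "K \<subseteq> ball 0 r" using r0 by (auto simp: r_def)
      have [measurable]: "K \<in> sets borel" "ball 0 r \<in> sets (borel :: 'a measure)" using K by (auto intro: borel_compact)
      obtain y' where y': "y' \<in> ball 0 r" "square_function f y' < \<infinity>" using ex[OF r(1), of 0] by blast
      have "(\<integral>\<^sup>+y. norm (indicator K y *\<^sub>R \<Gamma> y) \<partial>lborel) \<le> (\<integral>\<^sup>+y. ennreal (\<Lambda> r y) * indicator (ball 0 r) y + ennreal (\<Gamma> y') * indicator (ball 0 r) y \<partial>lborel)"
        using ae
      proof (intro nn_integral_mono_AE, eventually_elim)
        case (elim y)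
        show ?case
        proof (cases "y \<in> K")
          case True
          then have y: "y \<in> ball 0 r" using r by auto
          have "ennreal (\<Gamma> y) \<le> ennreal (\<Lambda> r y + \<Gamma> y')"
            using comp[OF r(1) y y'(1) elim(2) y'(2)] by (rule ennreal_leI)
          then show ?thesis using True y \<Gamma>0 \<Lambda>0 by (simp add: ennreal_plus)
        qed simp
      qed
      also have "\<dots> = (\<integral>\<^sup>+y\<in>ball 0 r. ennreal (\<Lambda> r y) \<partial>lborel) + ennreal (\<Gamma> y') * emeasure lborel (ball 0 r :: 'a set)"
        by (subst nn_integral_add) (auto simp: nn_integral_cmult_indicator)
      also have "\<dots> < \<infinity>"
      proof -
        have "(\<integral>\<^sup>+y\<in>ball 0 r. ennreal (\<Lambda> r y) \<partial>lborel) < \<infinity>"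
          by (rule le_less_trans[OF int\<Lambda>[OF r(1)]]) (use emeasure_lborel_ball_finite[of "0::'a" r] in \<open>auto simp: ennreal_mult_less_top\<close>)
        then show ?thesis
          using emeasure_lborel_ball_finite[of "0::'a" r] by (auto simp: ennreal_mult_less_top)
      qed
      finally have "integrable lborel (\<lambda>y. indicator K y *\<^sub>R \<Gamma> y)"
        by (intro integrableI_bounded) auto
      then show "\<Gamma> absolutely_integrable_on K"
        unfolding set_integrable_def by (subst integrable_completion) auto
    qed
    moreover have "blo_norm \<Gamma> \<le> ennreal (C' * N)"
      unfolding blo_norm_def
    proof (rule SUP_least)
      fix B :: "'a set" assume "B \<in> balls"
      then obtain x r where B: "B = ball x r" and r: "r > 0" by (auto simp: balls_def)
      have [measurable]: "B \<in> sets borel" by (simp add: B)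
      define b where "b = measure lborel B"
      have b: "b > 0" "emeasure lborel B = ennreal b"
        using content_ball_pos[OF r, of x] emeasure_lborel_ball_eq_measure[of x r] by (simp_all add: b_def B)
      define m where "m = ess_inf B \<Gamma>"
      have le: "e2ennreal (ereal (\<Gamma> y) - m) \<le> ennreal (\<Lambda> r y)" if y: "y \<in> B" "square_function f y < \<infinity>" for y
      proof -
        \<comment> \<open>For fixed \<open>y\<close> the comparison holds for almost every
          \<open>y'\<close>, so \<open>\<Gamma> y - \<Lambda> r y\<close> is an essential lower
          bound and thus at most the essential infimum. In particular \<open>m\<close> is not minus
          infinity.\<close>
        have "AE y' in lborel. y' \<in> B \<longrightarrow> ereal (\<Gamma> y - \<Lambda> r y) \<le> ereal (\<Gamma> y')"
          using ae
        proof eventually_elim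
          case (elim y')
          then show ?case using comp[OF r, of y x y'] y by (auto simp: B)
        qed
        then have "AE y' in lebesgue. y' \<in> B \<longrightarrow> ereal (\<Gamma> y - \<Lambda> r y) \<le> ereal (\<Gamma> y')"
          by (rule AE_completion)
        then have "ereal (\<Gamma> y - \<Lambda> r y) \<le> m"
          unfolding m_def ess_inf_def by (intro Sup_upper) simp
        then have "ereal (\<Gamma> y) - m \<le> ereal (\<Lambda> r y)"
          by (cases m) auto
        then show ?thesis
          using \<Lambda>0[of r y] by (metis e2ennreal_mono e2ennreal_ereal)
      qed
      have "(\<integral>\<^sup>+y\<in>B. e2ennreal (ereal (\<Gamma> y) - m) \<partial>lebesgue) \<le> (\<integral>\<^sup>+y\<in>B. ennreal (\<Lambda> r y) \<partial>lebesgue)"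
        using AE_completion[OF ae]
      proof (intro nn_integral_mono_AE, eventually_elim)
        case (elim y)
        then show ?case using le[of y] by (simp add: indicator_def)
      qed
      also have "\<dots> = (\<integral>\<^sup>+y\<in>B. ennreal (\<Lambda> r y) \<partial>lborel)" by (rule nn_integral_completion)
      also have "\<dots> \<le> ennreal (C' * N) * ennreal b" using int\<Lambda>[OF r, of x] by (simp add: B[symmetric] b)
      finally have "(\<integral>\<^sup>+y\<in>B. e2ennreal (ereal (\<Gamma> y) - m) \<partial>lebesgue) / ennreal b \<le> ennreal (C' * N) * ennreal b / ennreal b"
        by (rule divide_right_mono_ennreal)
      also have "\<dots> = ennreal (C' * N)"
        using b(1) C' N by (simp add: ennreal_mult[symmetric] divide_ennreal)
      finally show "(\<integral>\<^sup>+y\<in>B. e2ennreal (ereal (\<Gamma> y) - ess_inf B \<Gamma>) \<partial>lebesgue) / emeasure lebesgue B \<le> ennreal (C' * N)"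
        by (simp add: m_def b)
    qed
    ultimately show ?thesis by (simp add: \<Gamma>_def[abs_def])
  qed
  with C' show ?thesis by blast
qed

theorem corollary2p7:
  "\<exists>C::real. C > 0 \<and>
     (\<forall>f :: real ^ 'n \<Rightarrow> complex.
        f \<in> BMO \<longrightarrow> (AE x in lebesgue. g_function f x < \<infinity>) \<longrightarrow>
        (\<lambda>x. enn2real (g_function f x)) \<in> BLO \<and>
        blo_norm (\<lambda>x. enn2real (g_function f x)) \<le> ennreal C * bmo_norm f)"
proof -
  obtain C where C: "C > 0" and blo: "\<And>(f::real ^ 'n \<Rightarrow> complex) N. mean_osc_le f N \<Longrightarrow> N > 0 \<Longrightarrow> (AE y in lborel. square_function f y < \<infinity>) \<Longrightarrow>
     locally_integrable (\<lambda>y. sqrt (enn2real (square_function f y))) \<and>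
     blo_norm (\<lambda>y. sqrt (enn2real (square_function f y))) \<le> ennreal (C * N)"
    using square_function_blo[where 'a="real ^ 'n" and 'b=complex] by blast
  have "(\<lambda>x. enn2real (g_function f x)) \<in> BLO \<and> blo_norm (\<lambda>x. enn2real (g_function f x)) \<le> ennreal (2 * C) * bmo_norm f"
    if f: "f \<in> BMO" and fin: "AE x in lebesgue. g_function f x < \<infinity>" for f :: "real ^ 'n \<Rightarrow> complex"
  proof -
    have li: "locally_integrable f" and bmo: "bmo_norm f < \<infinity>" using f by (auto simp: BMO_def)
    have fm: "f \<in> borel_measurable lebesgue" by (rule locally_integrable_imp_measurable[OF li])
    obtain f' where f': "f' \<in> borel_measurable borel" "AE x in lebesgue. f x = f' x"
      using lebesgue_ex_borel_measurable[OF fm] by blast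
    note [measurable] = f'(1)
    define b where "b = enn2real (bmo_norm f)"
    have b: "bmo_norm f = ennreal b" "b \<ge> 0" using bmo by (auto simp: b_def)
    \<comment> \<open>The estimates ask for a positive constant while the BMO seminorm may vanish,
      so it is enlarged by \<open>e > 0\<close>, which tends to 0 at the end. The factor 2 is that
      of \<open>bmo_imp_mean_osc_le\<close>.\<close>
    have osc: "mean_osc_le f' (2 * (b + e))" if "e > 0" for e
      using that b by (intro bmo_imp_mean_osc_le[OF f'] ) (auto intro!: ennreal_leI)
    have gf: "gauss_integrable f'"
      using mean_osc_le_imp_gauss_integrable[OF osc[of 1]] b by simp
    have g: "g_function f y = ennreal_sqrt (square_function f' y)" for y
      by (rule g_function_eq[OF gf fm f'(2)])
    have "AE y in lebesgue. square_function f' y < \<infinity>"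
      using fin
    proof eventually_elim
      case (elim y)
      then show ?case unfolding g ennreal_sqrt_def by (auto simp: less_top split: if_splits)
    qed
    then have ae: "AE y in lborel. square_function f' y < \<infinity>"
      by (subst (asm) AE_completion_iff) auto
    have eq: "(\<lambda>x. enn2real (g_function f x)) = (\<lambda>y. sqrt (enn2real (square_function f' y)))"
      by (simp add: g enn2real_ennreal_sqrt)
    have bound: "blo_norm (\<lambda>x. enn2real (g_function f x)) \<le> ennreal (C * (2 * (b + e)))" if "e > 0" for e
      using blo[OF osc[OF that] _ ae] that b unfolding eq by simp
    have le: "blo_norm (\<lambda>x. enn2real (g_function f x)) \<le> ennreal (2 * C) * bmo_norm f"
    proof (rule ennreal_le_epsilon)
      fix e :: real assume e: "e > 0"
      have "blo_norm (\<lambda>x. enn2real (g_function f x)) \<le> ennreal (C * (2 * (b + e / (2 * C))))"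
        using e C by (intro bound) auto
      also have "C * (2 * (b + e / (2 * C))) = 2 * C * b + e" using C by (simp add: field_simps)
      also have "ennreal (2 * C * b + e) = ennreal (2 * C) * bmo_norm f + ennreal e"
        using C b e by (simp add: ennreal_plus ennreal_mult)
      finally show "blo_norm (\<lambda>x. enn2real (g_function f x)) \<le> ennreal (2 * C) * bmo_norm f + ennreal e" .
    qed
    have "blo_norm (\<lambda>x. enn2real (g_function f x)) < \<infinity>"
      by (rule le_less_trans[OF le]) (use b in \<open>auto simp: ennreal_mult_less_top\<close>)
    moreover have "locally_integrable (\<lambda>x. enn2real (g_function f x))"
      using blo[OF osc[of 1] _ ae] b unfolding eq by simp
    ultimately show ?thesis using le by (simp add: BLO_def)
  qed
  moreover have "2 * C > 0" using C by simp
  ultimately show ?thesis by blast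
qed

end
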